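(* If an open convex set $H\subset[0,1]^2$ has area (Lebesgue measure) less than $0.11802$, then $\dim_{\mathrm H}\mathcal J(H)>0$, where $\mathcal J(H)$ is the survivor set of $H$ for the baker's map and $\dim_{\mathrm H}$ is Hausdorff dimension.
   Context: Let $X=[0,1]^2$. The baker's map is $B(x,y)=(2x,\frac y2)$ if $0\le x<\frac12$ and $B(x,y)=(2x-1,\frac{y+1}2)$ if $\frac12\le x<1$. For a bi-infinite sequence $u=(x_n)_{n\in\mathbb Z}\in\{0,1\}^{\mathbb Z}$, written $\dots x_{-1}x_0\cdot x_1x_2\dots$, put $\pi(u)=\left(\sum_{n\ge1}x_n2^{-n},\ \sum_{n\ge0}x_{-n}2^{-n-1}\right)$. The map $\pi$ conjugates the left shift $\sigma$ and $B$; points and sequences are used interchangeably, so the $B$-orbit of the point $\pi(u)$ is $(\pi(\sigma^n u))_{n\in\mathbb Z}$. For $H\subset X$ the survivor set is $\mathcal J(H)=\{(x,y)\in X: B^n(x,y)\notin H \text{ for all } n\in\mathbb Z\}$, i.e. $\mathcal J(H)=\{\pi(u): \pi(\sigma^nu)\notin H\ \text{for all } n\in\mathbb Z\}$. *)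

theory Defs
  imports "HOL-Analysis.Analysis"
begin

section \<open>Hausdorff dimension\<close>

text \<open>
  The case distinction fixes the usual conventions that the empty set contributes nothing and that
  every nonempty set, singletons included, contributes 1 when \<open>s = 0\<close>
  (whereas \<open>0 powr 0 = 0\<close> in HOL).
\<close>

definition diam_powr :: "real \<Rightarrow> 'a::metric_space set \<Rightarrow> ennreal" where
  "diam_powr s U = (if U = {} then 0 else if s = 0 then 1 else ennreal (diameter U powr s))"

text \<open>
  Boundedness is required explicitly, since \<^const>\<open>diameter\<close> is meaningless for unbounded sets.
\<close>

definition hausdorff_premeasure :: "real \<Rightarrow> real \<Rightarrow> 'a::metric_space set \<Rightarrow> ennreal" where
  "hausdorff_premeasure s \<delta> A =
     (INF U \<in> {U :: nat \<Rightarrow> 'a set. A \<subseteq> (\<Union>i. U i) \<and> (\<forall>i. bounded (U i) \<and> diameter (U i) \<le> \<delta>)}.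
        \<Sum>i. diam_powr s (U i))"

definition hausdorff_measure :: "real \<Rightarrow> 'a::metric_space set \<Rightarrow> ennreal" where
  "hausdorff_measure s A = (SUP \<delta> \<in> {0<..}. hausdorff_premeasure s \<delta> A)"

definition hausdorff_dim :: "'a::metric_space set \<Rightarrow> ennreal" where
  "hausdorff_dim A = (INF s \<in> {s. 0 \<le> s \<and> hausdorff_measure s A = 0}. ennreal s)"


section \<open>The baker's map and its symbolic coding\<close>

abbreviation unit_square :: "(real \<times> real) set" where
  "unit_square \<equiv> {0..1} \<times> {0..1}"

text \<open>The baker's map is only meaningful for \<open>0 \<le> x < 1\<close>.\<close>

definition baker :: "real \<times> real \<Rightarrow> real \<times> real" where
  "baker = (\<lambda>(x, y). if x < 1/2 then (2 * x, y / 2) else (2 * x - 1, (y + 1) / 2))"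

definition binary_seqs :: "(int \<Rightarrow> nat) set" where
  "binary_seqs = {u. \<forall>i. u i \<in> {0, 1}}"

text \<open>\<open>shift n\<close> is the \<open>n\<close>-th power of the left shift, for any integer \<open>n\<close>.\<close>

definition shift :: "int \<Rightarrow> (int \<Rightarrow> nat) \<Rightarrow> (int \<Rightarrow> nat)" where
  "shift n u = (\<lambda>i. u (i + n))"

definition coding :: "(int \<Rightarrow> nat) \<Rightarrow> real \<times> real" where
  "coding u = (\<Sum>n. real (u (int (Suc n))) / 2 ^ Suc n, \<Sum>n. real (u (- int n)) / 2 ^ Suc n)"

text \<open>
  The map \<^const>\<open>baker\<close> is only meaningful for \<open>x < 1\<close> and not onto the square, so two-sided
  orbits are the images under \<^const>\<open>coding\<close> of shift orbits.  Points with a dyadic coordinate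
  may have more than one such orbit; they survive as soon as one of them avoids \<open>H\<close>.
\<close>

definition survivor_set :: "(real \<times> real) set \<Rightarrow> (real \<times> real) set" where
  "survivor_set H = {coding u |u. u \<in> binary_seqs \<and> (\<forall>n. coding (shift n u) \<notin> H)}"

text \<open>
  Consistency of the coding with the map: outside the sequences ending in \<open>111\<dots>\<close>, the shift
  acts as the baker's map.
\<close>

lemma summable_binary:
  assumes "\<And>n. d n \<in> {0, 1 :: nat}"
  shows "summable (\<lambda>n. real (d n) / 2 ^ Suc n)"
proof (rule summable_comparison_test')
  show "summable (\<lambda>n. (1/2 :: real) ^ Suc n)"
    using summable_geometric[of "1/2 :: real"] by (simp only: summable_Suc_iff) simp
  show "norm (real (d n) / 2 ^ Suc n) \<le> (1/2) ^ Suc n" for n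
    using assms[of n] by (auto simp: power_divide)
qed

lemma baker_coding:
  assumes u: "u \<in> binary_seqs" and lt: "fst (coding (shift 1 u)) < 1"
  shows "baker (coding u) = coding (shift 1 u)"
proof -
  define x y x' where "x = fst (coding u)" and "y = snd (coding u)"
    and "x' = fst (coding (shift 1 u))"
  have u01: "u i \<in> {0, 1}" for i
    using u by (auto simp: binary_seqs_def)
  have "x = real (u 1) / 2 + (\<Sum>n. real (u (int (Suc (Suc n)))) / 2 ^ Suc (Suc n))"
    using suminf_split_head[OF summable_binary[of "\<lambda>n. u (int (Suc n))", OF u01]]
    unfolding x_def coding_def fst_conv by simp
  also have "(\<Sum>n. real (u (int (Suc (Suc n)))) / 2 ^ Suc (Suc n)) = x' / 2"
    using suminf_divide[OF summable_binary[of "\<lambda>n. u (int (Suc (Suc n)))", OF u01], of 2]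
    unfolding x'_def coding_def shift_def fst_conv by (simp add: algebra_simps)
  finally have x: "x = real (u 1) / 2 + x' / 2" .
  have "snd (coding (shift 1 u))
      = real (u 1) / 2 + (\<Sum>n. real (u (- int n)) / 2 ^ Suc (Suc n))"
    using suminf_split_head[OF summable_binary[of "\<lambda>n. u (- int n + 1)", OF u01]]
    unfolding coding_def shift_def snd_conv by simp
  also have "(\<Sum>n. real (u (- int n)) / 2 ^ Suc (Suc n)) = y / 2"
    using suminf_divide[OF summable_binary[of "\<lambda>n. u (- int n)", OF u01], of 2]
    unfolding y_def coding_def snd_conv by (simp add: algebra_simps)
  finally have y': "snd (coding (shift 1 u)) = real (u 1) / 2 + y / 2" .
  have "0 \<le> x'"
    unfolding x'_def coding_def shift_def fst_conv
    by (intro suminf_nonneg summable_binary u01) auto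
  have "baker (x, y) = (x', real (u 1) / 2 + y / 2)"
    using u01[of 1] lt \<open>0 \<le> x'\<close> unfolding x x'_def[symmetric]
    by (auto simp: baker_def add_divide_distrib)
  then show ?thesis
    unfolding y'[symmetric] by (simp add: x_def y_def x'_def)
qed

end

theory Submission
  imports Defs "HOL-Library.Sublist"
begin

text \<open>
  Let \<open>A\<close> and \<open>M\<close> be words with \<open>AM \<noteq> MA\<close>.  The free concatenations of the two blocks \<open>UV\<close> and \<open>VU\<close>,
  where \<open>U = A\<^sup>N M\<close> and \<open>V = A\<^sup>N\<^sup>+\<^sup>1 M\<close>, code a set of positive dimension.  Hence, if the survivor set
  has dimension 0, then \<open>H\<close> contains a point of each of these sets.  Every window of length at most
  \<open>N |A|\<close> of such a concatenation is a factor of \<open>A\<^sup>N\<^sup>+\<^sup>1 M A\<^sup>N\<close>, so up to an error that vanishes with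
  \<open>1 / N\<close> the point lies on the orbit homoclinic to \<open>A\<close> through \<open>M\<close>, which gives finitely many
  possibilities.  For suitably chosen finitely many pairs \<open>(A, M)\<close>, any choice of one point on each of
  these orbits has a convex hull of area at least 0.11802, contradicting the area of \<open>H\<close>.

  The last assertion is a branch and bound search over boxes with integer coordinates.  The search
  tree was found by computer and is replayed by rewriting.  Reversing and complementing
  words, that is transposing and rotating the square, reduces the number of cases.
\<close>

section \<open>Hausdorff dimension of block codings\<close>

text \<open>The blocks are \<open>UV\<close> and \<open>VU\<close> rather than \<open>U\<close> and
  \<open>V\<close> because equal lengths m make the x-coordinate of a coded point a series in base
  \<open>2^m\<close> with two digit values; cancelling common factors shows that
  \<open>UV = VU\<close> would mean \<open>AM = MA\<close>. No limit in N is taken: for windows of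
  \<open>2 * L\<close> digits, N = 2L already suffices, and H must meet one of finitely many squares
  of side \<open>2^-L\<close>.

  A point of H is thus known only up to a box, which leaves the shape of the convex hull uncertain.
  Each test therefore names a polygon by an order of its vertices and bounds its area from below for
  all positions of the vertices in their boxes. This also needs a certificate that the triangles of
  the polygon do not overlap: the sign conditions on \<open>cross\<close>.

  The search starts from the orbits homoclinic to 0 and to 1. Outside a small box at one corner, the
  first consists of a few points on the two edges at that corner; the second is its image under the
  half turn. So H reaches from one pair of edges nearly to the opposite pair, which makes it long
  from the beginning.\<close>

definition blocks :: "nat list \<Rightarrow> nat list \<Rightarrow> (int \<Rightarrow> bool) \<Rightarrow> int \<Rightarrow> nat" where
  "blocks P Q e i =
     (if e ((i - 1) div int (length P)) then P else Q) ! nat ((i - 1) mod int (length P))"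

lemma blocks_binary:
  assumes "set P \<subseteq> {0, 1}" "set Q \<subseteq> {0, 1}" "length Q = length P" "P \<noteq> []"
  shows "blocks P Q e \<in> binary_seqs"
proof -
  have "blocks P Q e i \<in> {0, 1}" for i
  proof -
    have "nat ((i - 1) mod int (length P)) < length P"
      using \<open>P \<noteq> []\<close> by (simp add: nat_less_iff)
    then show ?thesis
      unfolding blocks_def using assms nth_mem by (smt (verit) subset_iff)
  qed
  then show ?thesis by (simp add: binary_seqs_def)
qed

primrec binval :: "nat list \<Rightarrow> real" where
  "binval [] = 0"
| "binval (b # bs) = (real b + binval bs) / 2"

lemma binval_sum: "binval bs = (\<Sum>i<length bs. real (bs ! i) / 2 ^ Suc i)"
  by (induction bs) (simp_all add: sum.lessThan_Suc_shift sum_divide_distrib add_divide_distrib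
      del: sum.lessThan_Suc)

lemma binval_bounds:
  assumes "set bs \<subseteq> {0, 1}"
  shows "0 \<le> binval bs" "binval bs < 1"
  using assms by (induction bs) auto

lemma binval_inj:
  assumes "length bs = length cs" "set bs \<subseteq> {0, 1}" "set cs \<subseteq> {0, 1}" "binval bs = binval cs"
  shows "bs = cs"
  using assms
proof (induction bs cs rule: list_induct2)
  case (Cons b bs c cs)
  then show ?case
    using binval_bounds[of bs] binval_bounds[of cs] by auto
qed simp

text \<open>The offset 1 in \<open>blocks\<close> makes block 0 start at digit 1, the first digit of
  the x-coordinate. Grouping the binary series by blocks leaves a series in base
  \<open>2 ^ length P\<close> whose only digit values are \<open>binval P\<close> and
  \<open>binval Q\<close>.\<close>

lemma binary_series_block:
  assumes bits: "set P \<subseteq> {0, 1}" "set Q \<subseteq> {0, 1}" and len: "length Q = length P" "P \<noteq> []"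
  shows "(\<lambda>k. binval (if e (int k) then P else Q) * (1 / 2 ^ length P) ^ k) sums
           fst (coding (blocks P Q e))"
proof -
  let ?m = "length P" and ?w = "\<lambda>k. if e (int k) then P else Q"
  let ?f = "\<lambda>n. real (blocks P Q e (int (Suc n))) / 2 ^ Suc n"
  have bin: "blocks P Q e i \<in> {0, 1}" for i
    using blocks_binary[OF bits len] by (auto simp: binary_seqs_def)
  have "?f sums fst (coding (blocks P Q e))"
    unfolding coding_def fst_conv using bin by (intro summable_sums summable_binary)
  then have "(\<lambda>k. sum ?f {k * ?m..<k * ?m + ?m}) sums fst (coding (blocks P Q e))"
    using len by (intro sums_group) auto
  moreover have "sum ?f {k * ?m..<k * ?m + ?m} = binval (?w k) * (1 / 2 ^ ?m) ^ k" for k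
  proof -
    have "sum ?f {k * ?m..<k * ?m + ?m} = (\<Sum>i<?m. ?f (i + k * ?m))"
      using sum.shift_bounds_nat_ivl[of ?f 0 "k * ?m" ?m] by (simp add: lessThan_atLeast0 add.commute)
    also have "\<dots> = (\<Sum>i<?m. real (?w k ! i) / 2 ^ Suc i * (1 / 2 ^ ?m) ^ k)"
    proof (rule sum.cong[OF refl])
      fix i assume i: "i \<in> {..<?m}"
      have "blocks P Q e (int (Suc (i + k * ?m))) = ?w k ! i"
      proof -
        have "(int i + int k * int ?m) div int ?m = int k"
          using i by (subst div_mult_self1) auto
        then show ?thesis using i by (simp add: blocks_def)
      qed
      moreover have "(2::real) ^ Suc (i + k * ?m) = 2 ^ Suc i * (2 ^ ?m) ^ k"
        by (simp add: power_add power_mult[symmetric] mult.commute)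
      ultimately show "?f (i + k * ?m) = real (?w k ! i) / 2 ^ Suc i * (1 / 2 ^ ?m) ^ k"
        by (simp add: power_divide)
    qed
    also have "\<dots> = binval (?w k) * (1 / 2 ^ ?m) ^ k"
      using len by (simp add: binval_sum sum_distrib_right)
    finally show ?thesis .
  qed
  ultimately show ?thesis by simp
qed

text \<open>All later terms together amount to at most \<open>q / (1 - q) \<le> 1 / 3\<close> of
  \<open>q ^ k\<close>, too little to cancel the first nonzero term. The bound 1/4 on q is what
  blocks of length at least 2 provide.\<close>

lemma first_digit_dominates:
  fixes \<delta> :: "nat \<Rightarrow> real"
  assumes "0 \<le> q" "q \<le> 1 / 4" and \<delta>: "\<And>j. \<bar>\<delta> j\<bar> \<le> 1" "\<And>j. j < k \<Longrightarrow> \<delta> j = 0" "\<bar>\<delta> k\<bar> = 1"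
    and s: "(\<lambda>j. \<delta> j * q ^ j) sums s"
  shows "2 / 3 * q ^ k \<le> \<bar>s\<bar>"
proof -
  have sm: "summable (\<lambda>j. q ^ Suc j)"
    using assms by (subst summable_Suc_iff) (simp add: summable_geometric)
  have bd: "norm (\<delta> (j + Suc k) * q ^ Suc j) \<le> q ^ Suc j" for j
    using \<delta>(1)[of "j + Suc k"] \<open>0 \<le> q\<close> by (simp add: abs_mult mult_left_le_one_le)
  have sm': "summable (\<lambda>j. \<delta> (j + Suc k) * q ^ Suc j)"
    by (rule summable_comparison_test'[OF sm bd])
  define r where "r = (\<Sum>j. \<delta> (j + Suc k) * q ^ Suc j)"
  have "norm r \<le> (\<Sum>j. q ^ Suc j)"
    unfolding r_def by (rule norm_suminf_le[OF bd sm])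
  also have "(\<Sum>j. q ^ Suc j) = q / (1 - q)"
    using assms by (simp add: suminf_mult summable_geometric suminf_geometric)
  also have "q / (1 - q) \<le> 1 / 3"
    using assms by (simp add: field_simps)
  finally have r: "\<bar>r\<bar> \<le> 1 / 3" by simp
  have "s = (\<Sum>j. \<delta> (j + Suc k) * q ^ (j + Suc k)) + (\<Sum>j<Suc k. \<delta> j * q ^ j)"
    using suminf_split_initial_segment[of "\<lambda>j. \<delta> j * q ^ j" "Suc k"] s by (simp only: sums_iff)
  also have "(\<Sum>j<Suc k. \<delta> j * q ^ j) = \<delta> k * q ^ k"
    using \<delta>(2) by simp
  also have "(\<Sum>j. \<delta> (j + Suc k) * q ^ (j + Suc k)) = r * q ^ k"
    unfolding r_def by (subst suminf_mult2[OF sm']) (simp add: power_add mult_ac)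
  finally have "s = (r + \<delta> k) * q ^ k" by (simp add: algebra_simps)
  then have "\<bar>s\<bar> = \<bar>r + \<delta> k\<bar> * q ^ k" using \<open>0 \<le> q\<close> by (simp add: abs_mult)
  moreover have "2 / 3 \<le> \<bar>r + \<delta> k\<bar>" using r \<delta>(3) by linarith
  ultimately show ?thesis using \<open>0 \<le> q\<close> by (metis mult_right_mono zero_le_power)
qed

definition binary_digit :: "real \<Rightarrow> nat \<Rightarrow> bool" where
  "binary_digit t k = odd \<lfloor>2 ^ Suc k * t\<rfloor>"

text \<open>Each digit is a difference of a floor and twice the preceding floor, so the partial sums
  telescope to truncations of t. The weights start at \<open>(1 / 2) ^ 0\<close> to match the powers
  \<open>q ^ k\<close> termwise; hence the factor 2.\<close>

lemma binary_digit_sums: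
  assumes "0 \<le> t" "t < 1"
  shows "(\<lambda>k. of_bool (binary_digit t k) * (1 / 2) ^ k) sums (2 * t)"
proof -
  have step: "of_bool (binary_digit t k) = real_of_int \<lfloor>2 ^ Suc k * t\<rfloor> - 2 * real_of_int \<lfloor>2 ^ k * t\<rfloor>" for k
  proof -
    have "\<lfloor>2 ^ Suc k * t\<rfloor> div 2 = \<lfloor>2 ^ k * t\<rfloor>"
      using floor_divide_real_eq_div[of 2 "2 ^ Suc k * t"] by simp
    then show ?thesis
      unfolding binary_digit_def using mod_div_mult_eq[of "\<lfloor>2 ^ Suc k * t\<rfloor>" 2]
      by (simp add: odd_iff_mod_2_eq_one)
  qed
  have part: "(\<Sum>k<n. of_bool (binary_digit t k) * (1 / 2) ^ k) = 2 * (real_of_int \<lfloor>2 ^ n * t\<rfloor> / 2 ^ n)" for n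
  proof (induction n)
    case 0
    have "\<lfloor>t\<rfloor> = 0" using assms by (simp add: floor_eq_iff)
    then show ?case by simp
  next
    case (Suc n)
    then show ?case by (simp only: sum.lessThan_Suc step) (simp add: field_simps power_divide)
  qed
  have "(\<lambda>n. real_of_int \<lfloor>2 ^ n * t\<rfloor> / 2 ^ n) \<longlonglongrightarrow> t"
  proof (rule real_tendsto_sandwich)
    show "\<forall>\<^sub>F n in sequentially. t - (1 / 2) ^ n \<le> real_of_int \<lfloor>2 ^ n * t\<rfloor> / 2 ^ n"
    proof (rule always_eventually, rule allI)
      fix n
      have "2 ^ n * t - 1 \<le> real_of_int \<lfloor>2 ^ n * t\<rfloor>" by linarith
      then have "(2 ^ n * t - 1) / 2 ^ n \<le> real_of_int \<lfloor>2 ^ n * t\<rfloor> / 2 ^ n"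
        by (rule divide_right_mono) simp
      then show "t - (1 / 2) ^ n \<le> real_of_int \<lfloor>2 ^ n * t\<rfloor> / 2 ^ n"
        by (simp add: diff_divide_distrib power_divide)
    qed
    show "\<forall>\<^sub>F n in sequentially. real_of_int \<lfloor>2 ^ n * t\<rfloor> / 2 ^ n \<le> t"
      by (rule always_eventually) (simp add: field_simps)
    show "(\<lambda>n. t - (1 / 2) ^ n) \<longlonglongrightarrow> t"
      using tendsto_diff[OF tendsto_const[of t] LIMSEQ_realpow_zero[of "1 / 2 :: real"]] by simp
  qed simp
  then have "(\<lambda>n. 2 * (real_of_int \<lfloor>2 ^ n * t\<rfloor> / 2 ^ n)) \<longlonglongrightarrow> 2 * t"
    by (rule tendsto_mult_left)
  then show ?thesis by (simp only: sums_def part)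
qed

text \<open>The bits of \<open>t\<close> select the blocks; this injects \<open>[0, 1)\<close> into \<open>S\<close>
  with a Hoelder continuous inverse.\<close>

lemma hausdorff_dim_blocks_pos:
  assumes bits: "set P \<subseteq> {0, 1}" "set Q \<subseteq> {0, 1}" and len: "length Q = length P" "2 \<le> length P"
    and ne: "P \<noteq> Q" and S: "\<And>e. coding (blocks P Q e) \<in> S"
  shows "0 < hausdorff_dim S"
proof -
  define m where "m = length P"
  \<comment> \<open>With \<open>q = 2^-m\<close> this exponent gives
    \<open>(q ^ k) powr s = (1 / 2) ^ k\<close>, the scale of the distance between parameters whose
    digits first differ at k.\<close>
  define s where "s = 1 / real m"
  define q where "q = (1 / 2 :: real) ^ m"
  define c where "c = \<bar>binval P - binval Q\<bar>"
  define C where "C = (3 / (2 * c)) powr s"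
  \<comment> \<open>Only the x-coordinate enters the estimate, so the blocks of negative index are
    irrelevant and \<open>nat\<close> may give them all digit 0.\<close>
  define p where "p t = coding (blocks P Q (\<lambda>i. binary_digit t (nat i)))" for t
  have m: "2 \<le> m" "m \<noteq> 0" and P: "P \<noteq> []" using len by (auto simp: m_def)
  have s: "0 < s" using m by (simp add: s_def)
  have "c \<noteq> 0" using binval_inj[of P Q] bits len ne by (auto simp: c_def)
  then have c: "0 < c" by (simp add: c_def)
  then have C: "0 < C" by (simp add: C_def)
  have q: "0 \<le> q" "q \<le> 1 / 4"
    using power_decreasing[of 2 m "1 / 2 :: real"] m by (simp_all add: q_def power2_eq_square)
  have hoelder: "\<bar>t - t'\<bar> \<le> C * dist (p t) (p t') powr s"
    if t: "0 \<le> t" "t < 1" and t': "0 \<le> t'" "t' < 1" for t t' :: real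
  proof (cases "t = t'")
    case True
    then show ?thesis using C by simp
  next
    case False
    define \<delta> where "\<delta> j = of_bool (binary_digit t j) - (of_bool (binary_digit t' j) :: real)" for j
    have sm: "(\<lambda>k. \<delta> k * (1 / 2) ^ k) sums (2 * (t - t'))"
      using sums_diff[OF binary_digit_sums[OF t] binary_digit_sums[OF t']]
      by (simp only: \<delta>_def left_diff_distrib right_diff_distrib)
    have "\<exists>k. \<delta> k \<noteq> 0"
    proof (rule ccontr)
      assume "\<nexists>k. \<delta> k \<noteq> 0"
      then have "\<delta> = (\<lambda>_. 0)" by (simp add: fun_eq_iff)
      then have "(\<lambda>_::nat. 0 :: real) sums (2 * (t - t'))" using sm by simp
      then have "2 * (t - t') = 0" by (rule sums_unique2) (rule sums_zero)
      then show False using False by simp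
    qed
    define k where "k = (LEAST k. \<delta> k \<noteq> 0)"
    have k1: "\<delta> k \<noteq> 0"
      unfolding k_def by (rule LeastI_ex) fact
    have k2: "\<delta> j = 0" if "j < k" for j
      using not_less_Least[of j "\<lambda>k. \<delta> k \<noteq> 0"] that unfolding k_def by blast
    have d1: "\<bar>\<delta> j\<bar> \<le> 1" for j unfolding \<delta>_def of_bool_def by simp
    have dk: "\<bar>\<delta> k\<bar> = 1" using k1 unfolding \<delta>_def of_bool_def by (simp split: if_splits)
    have tt: "\<bar>t - t'\<bar> \<le> (1 / 2) ^ k"
    proof -
      have h: "summable (\<lambda>j. (1 / 2 :: real) ^ (j + k))"
        by (simp only: summable_iff_shift) (simp add: summable_geometric)
      have "2 * (t - t') = (\<Sum>j. \<delta> (j + k) * (1 / 2) ^ (j + k)) + (\<Sum>j<k. \<delta> j * (1 / 2) ^ j)"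
        using suminf_split_initial_segment[of "\<lambda>j. \<delta> j * (1 / 2) ^ j" k] sm by (simp only: sums_iff)
      also have "(\<Sum>j<k. \<delta> j * (1 / 2) ^ j) = 0" using k2 by simp
      finally have split: "2 * (t - t') = (\<Sum>j. \<delta> (j + k) * (1 / 2) ^ (j + k))" by simp
      have "2 * \<bar>t - t'\<bar> = \<bar>2 * (t - t')\<bar>" by (simp only: abs_mult abs_numeral)
      also have "\<dots> = norm (\<Sum>j. \<delta> (j + k) * (1 / 2) ^ (j + k))"
        by (simp only: split real_norm_def)
      also have "\<dots> \<le> (\<Sum>j. (1 / 2) ^ (j + k))"
        using d1 by (intro norm_suminf_le[OF _ h]) (simp add: abs_mult mult_left_le_one_le)
      also have "\<dots> = 2 * (1 / 2) ^ k"
        by (simp add: power_add suminf_mult2[symmetric] summable_geometric suminf_geometric)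
      finally show ?thesis by simp
    qed
    define D where "D = \<bar>fst (p t) - fst (p t')\<bar>"
    have "(\<lambda>k. \<delta> k * q ^ k) sums ((fst (p t) - fst (p t')) / (binval P - binval Q))"
    proof -
      have "(\<lambda>k. binval (if binary_digit t k then P else Q) * q ^ k -
            binval (if binary_digit t' k then P else Q) * q ^ k)
          sums (fst (p t) - fst (p t'))"
        using sums_diff[OF binary_series_block[OF bits len(1) P, of "\<lambda>i. binary_digit t (nat i)"]
            binary_series_block[OF bits len(1) P, of "\<lambda>i. binary_digit t' (nat i)"]]
        by (simp add: p_def q_def m_def power_divide)
      also have "(\<lambda>k. binval (if binary_digit t k then P else Q) * q ^ k -
            binval (if binary_digit t' k then P else Q) * q ^ k)
          = (\<lambda>k. \<delta> k * q ^ k * (binval P - binval Q))"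
        by (auto simp: \<delta>_def fun_eq_iff algebra_simps)
      finally show ?thesis
        using \<open>c \<noteq> 0\<close> sums_divide[of "\<lambda>k. \<delta> k * q ^ k * (binval P - binval Q)" _ "binval P - binval Q"]
        by (simp add: c_def)
    qed
    from first_digit_dominates[OF q d1 k2 dk this] have "2 / 3 * q ^ k \<le> D / c"
      by (simp add: D_def c_def)
    then have "q ^ k \<le> 3 / (2 * c) * D"
      using c by (simp add: field_simps)
    then have "(q ^ k) powr s \<le> (3 / (2 * c) * D) powr s"
      using q s by (intro powr_mono2) auto
    also have "(q ^ k) powr s = (1 / 2) ^ k"
    proof -
      have "q ^ k = (1 / 2) powr (real m * real k)"
        using powr_realpow[of "1 / 2 :: real" "m * k"] by (simp add: q_def power_mult)
      then have "(q ^ k) powr s = (1 / 2) powr (real m * real k * s)"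
        by (simp only: powr_powr)
      also have "real m * real k * s = real k"
        using m by (simp add: s_def)
      finally show ?thesis by (simp add: powr_realpow)
    qed
    also have "(3 / (2 * c) * D) powr s = C * D powr s"
      unfolding C_def by (rule powr_mult)
    also have "\<dots> \<le> C * dist (p t) (p t') powr s"
      using C s by (intro mult_left_mono powr_mono2)
        (auto simp: D_def dist_prod_def dist_real_def intro: real_sqrt_ge_abs1)
    finally show ?thesis using tt by linarith
  qed
  \<comment> \<open>The scale 1 is enough, because the measure is a supremum over scales. It also
    keeps all diameters at most 1, so that the estimate for the exponent s serves every smaller
    exponent.\<close>
  have low: "ennreal (1 / (2 * C)) \<le> hausdorff_premeasure s' 1 S" if s': "0 \<le> s'" "s' \<le> s" for s'
    unfolding hausdorff_premeasure_def
  proof (rule INF_greatest, clarify)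
    fix U :: "nat \<Rightarrow> (real \<times> real) set"
    assume cov: "S \<subseteq> (\<Union>i. U i)" and U: "\<forall>i. bounded (U i) \<and> diameter (U i) \<le> 1"
    \<comment> \<open>The cover is pulled back to the parameters: by the Hoelder bound each
      \<open>U i\<close> catches parameters from an interval of radius \<open>r i\<close> only, and
      these intervals must have total length at least 1.\<close>
    define V where "V i = {t. 0 \<le> t \<and> t < 1 \<and> p t \<in> U i}" for i
    define t0 where "t0 i = (SOME t. t \<in> V i)" for i
    define r where "r i = C * diameter (U i) powr s" for i
    define J where "J i = (if V i = {} then {} else {t0 i - r i..t0 i + r i})" for i
    have r0: "0 \<le> r i" for i using C by (simp add: r_def)
    have VJ: "V i \<subseteq> J i" for i
    proof
      fix t assume t: "t \<in> V i"
      then have t0: "t0 i \<in> V i" unfolding t0_def by (rule someI)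
      have "\<bar>t - t0 i\<bar> \<le> C * dist (p t) (p (t0 i)) powr s"
        using t t0 by (intro hoelder) (auto simp: V_def)
      also have "\<dots> \<le> r i"
        unfolding r_def using t t0 U C s
        by (intro mult_left_mono powr_mono2 diameter_bounded_bound) (auto simp: V_def)
      finally show "t \<in> J i" using t by (auto simp: J_def)
    qed
    have "{0..<1} \<subseteq> (\<Union>i. J i)"
    proof
      fix t :: real assume t: "t \<in> {0..<1}"
      have "p t \<in> (\<Union>i. U i)" using S cov unfolding p_def by blast
      then show "t \<in> (\<Union>i. J i)" using t VJ by (auto simp: V_def)
    qed
    have "ennreal 1 = emeasure lborel {0..<1::real}" by simp
    also have "\<dots> \<le> emeasure lborel (\<Union>i. J i)"
      using \<open>{0..<1} \<subseteq> (\<Union>i. J i)\<close> by (intro emeasure_mono) (auto simp: J_def)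
    also have "\<dots> \<le> (\<Sum>i. emeasure lborel (J i))"
      by (intro emeasure_subadditive_countably) (auto simp: J_def)
    also have "\<dots> \<le> (\<Sum>i. ennreal (2 * C) * diam_powr s' (U i))"
    proof (intro suminf_le allI)
      fix i
      show "emeasure lborel (J i) \<le> ennreal (2 * C) * diam_powr s' (U i)"
      proof (cases "V i = {}")
        case False
        then have "U i \<noteq> {}" by (auto simp: V_def)
        have d: "0 \<le> diameter (U i)" "diameter (U i) \<le> 1" using U by (auto intro: diameter_ge_0)
        have le: "ennreal (diameter (U i) powr s) \<le> diam_powr s' (U i)"
        proof (cases "s' = 0")
          case True
          have "diameter (U i) powr s \<le> 1"
            using d s powr_mono2[of s "diameter (U i)" 1] by simp
          then show ?thesis using True \<open>U i \<noteq> {}\<close> by (simp add: diam_powr_def ennreal_le_1)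
        next
          case False
          have "diameter (U i) powr s \<le> diameter (U i) powr s'"
            using d s' by (intro powr_mono') auto
          then show ?thesis using False \<open>U i \<noteq> {}\<close> by (simp add: diam_powr_def ennreal_leI)
        qed
        have "emeasure lborel (J i) = ennreal (2 * r i)"
          using False r0[of i] by (simp add: J_def)
        also have "\<dots> = ennreal (2 * C) * ennreal (diameter (U i) powr s)"
          using C by (simp add: r_def ennreal_mult[symmetric] mult.assoc)
        also have "\<dots> \<le> ennreal (2 * C) * diam_powr s' (U i)"
          using le by (rule mult_left_mono) simp
        finally show ?thesis .
      qed (simp add: J_def)
    qed auto
    also have "\<dots> = ennreal (2 * C) * (\<Sum>i. diam_powr s' (U i))"
      by (rule ennreal_suminf_cmult)
    finally have "ennreal (1 / (2 * C)) * ennreal 1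
        \<le> ennreal (1 / (2 * C)) * (ennreal (2 * C) * (\<Sum>i. diam_powr s' (U i)))"
      by (rule mult_left_mono) simp
    also have "\<dots> = (\<Sum>i. diam_powr s' (U i))"
      using C by (simp add: mult.assoc[symmetric] ennreal_mult[symmetric])
    finally show "ennreal (1 / (2 * C)) \<le> (\<Sum>i. diam_powr s' (U i))" by simp
  qed
  have "ennreal s \<le> hausdorff_dim S"
    unfolding hausdorff_dim_def
  proof (rule INF_greatest, clarify)
    fix s' :: real
    assume s': "0 \<le> s'" "hausdorff_measure s' S = 0"
    have "\<not> s' \<le> s"
    proof
      assume "s' \<le> s"
      have "hausdorff_premeasure s' 1 S \<le> hausdorff_measure s' S"
        unfolding hausdorff_measure_def by (rule SUP_upper) simp
      with low[OF s'(1) \<open>s' \<le> s\<close>] s'(2) have "ennreal (1 / (2 * C)) \<le> 0" by simp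
      then show False using C by (simp add: ennreal_eq_0_iff)
    qed
    then show "ennreal s \<le> ennreal s'" by (intro ennreal_leI) simp
  qed
  then show ?thesis
    using s by (metis ennreal_less_zero_iff less_le_trans)
qed

section \<open>Areas of convex sets in the plane\<close>

text \<open>Twice the signed area of the triangle, positive if p, q, r turn to the left.\<close>

definition cross :: "real \<times> real \<Rightarrow> real \<times> real \<Rightarrow> real \<times> real \<Rightarrow> real" where
  "cross p q r = (fst q - fst p) * (snd r - snd p) - (snd q - snd p) * (fst r - fst p)"

lemma Basis_prod_real: "(Basis :: (real \<times> real) set) = {(1, 0), (0, 1)}"
  by (auto simp: Basis_prod_def)

lemma Basis_vec2: "(Basis :: (real ^ 2) set) = {axis 1 1, axis 2 1}"
  by (auto simp: Basis_vec_def UNIV_2)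

text \<open>Carries the triangle formula \<open>content_triangle\<close>, which is about
  \<open>real ^ 2\<close>, over to pairs.\<close>

lemma distr_vec2_lborel: "distr lborel borel (\<lambda>v::real^2. (v $ 1, v $ 2)) = lborel"
proof (rule lborel_eqI[symmetric])
  fix l u :: "real \<times> real"
  assume le: "\<And>b. b \<in> Basis \<Longrightarrow> l \<bullet> b \<le> u \<bullet> b"
  let ?v = "\<lambda>p :: real \<times> real. vector [fst p, snd p] :: real^2"
  have [measurable]: "(\<lambda>v::real^2. (v $ 1, v $ 2)) \<in> borel_measurable borel"
    by (intro borel_measurable_continuous_onI continuous_intros)
  have eq: "(\<lambda>v::real^2. (v $ 1, v $ 2)) -` box l u = box (?v l) (?v u)"
    by (auto simp: mem_box Basis_prod_real Basis_vec2 inner_axis inner_prod_def)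
  have "emeasure (distr lborel borel (\<lambda>v::real^2. (v $ 1, v $ 2))) (box l u) =
      emeasure lborel (box (?v l) (?v u))"
    by (subst emeasure_distr) (auto simp: eq)
  also have "\<dots> = (\<Prod>b\<in>Basis. (?v u - ?v l) \<bullet> b)"
    using le[of "(1, 0)"] le[of "(0, 1)"] by (intro emeasure_lborel_box)
      (auto simp: Basis_vec2 Basis_prod_real inner_axis inner_prod_def)
  also have "(\<Prod>b\<in>Basis. (?v u - ?v l) \<bullet> b) = (\<Prod>b\<in>Basis. (u - l) \<bullet> b)"
    by (cases l; cases u) (simp add: Basis_vec2 Basis_prod_real inner_axis axis_eq_axis)
  finally show "emeasure (distr lborel borel (\<lambda>v::real^2. (v $ 1, v $ 2))) (box l u) = (\<Prod>b\<in>Basis. (u - l) \<bullet> b)" .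
qed simp

lemma measure_triangle:
  "measure lebesgue (convex hull {p, q, r :: real \<times> real}) = \<bar>cross p q r\<bar> / 2"
proof -
  let ?f = "\<lambda>v::real^2. (v $ 1, v $ 2)" and ?v = "\<lambda>p :: real \<times> real. vector [fst p, snd p] :: real^2"
  have lin: "linear ?f" by (intro linearI) auto
  have inj: "inj ?f" by (rule injI) (simp add: vec_eq_iff forall_2)
  have f: "?f (?v p) = p" for p by simp
  have meas [measurable]: "?f \<in> borel_measurable borel"
    by (intro borel_measurable_continuous_onI continuous_intros)
  have comp: "compact (convex hull {p, q, r})" for p q r :: "'b::euclidean_space"
    by (intro finite_imp_compact_convex_hull) auto
  then have bor: "convex hull {p, q, r} \<in> sets borel" for p q r :: "'b::euclidean_space"
    by (intro borel_compact comp)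
  have img: "convex hull {p, q, r} = ?f ` (convex hull {?v p, ?v q, ?v r})"
    by (simp add: convex_hull_linear_image[OF lin] f)
  have vim: "?f -` (convex hull {p, q, r}) = convex hull {?v p, ?v q, ?v r}"
    unfolding img by (rule inj_vimage_image_eq[OF inj])
  have "measure lebesgue (convex hull {p, q, r}) = measure lborel (convex hull {p, q, r})"
    by (rule measure_completion) (simp add: bor)
  also have "\<dots> = measure (distr lborel borel ?f) (convex hull {p, q, r})"
    by (simp add: distr_vec2_lborel)
  also have "\<dots> = measure lborel (?f -` (convex hull {p, q, r}))"
    by (subst measure_distr) (simp_all add: bor)
  also have "\<dots> = measure lborel (convex hull {?v p, ?v q, ?v r})"
    by (simp only: vim)
  also have "\<dots> = \<bar>cross p q r\<bar> / 2"
  proof -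
    have "(?v r $ 1 - ?v p $ 1) * (?v q $ 2 - ?v p $ 2) - (?v q $ 1 - ?v p $ 1) * (?v r $ 2 - ?v p $ 2)
        = - cross p q r"
      by (simp add: cross_def algebra_simps)
    then show ?thesis by (simp only: content_triangle abs_minus_cancel)
  qed
  finally show ?thesis .
qed

lemma triangle_le_measure:
  assumes "convex H" "bounded H" "p \<in> H" "q \<in> H" "r \<in> H"
  shows "cross p q r / 2 \<le> measure lebesgue H"
proof -
  have "convex hull {p, q, r} \<subseteq> H"
    using assms by (intro hull_minimal) auto
  then have "measure lebesgue (convex hull {p, q, r}) \<le> measure lebesgue H"
    using assms by (intro measure_mono_fmeasurable measurable_convex)
      (auto intro!: fmeasurableD measurable_convex convex_convex_hull bounded_convex_hull)
  then show ?thesis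
    unfolding measure_triangle by linarith
qed

text \<open>The signed area is affine in the third vertex, so fixing its sign cuts out a half
  plane.\<close>

lemma cross_conv_inner:
  "cross p q z = (snd p - snd q, fst q - fst p) \<bullet> z - (fst q * snd p - snd q * fst p)"
  by (cases p; cases q; cases z) (simp add: cross_def algebra_simps)

lemma convex_side:
  "convex {z. 0 \<le> cross p q z}" "convex {z. cross p q z \<le> 0}"
  using convex_halfspace_ge[of "fst q * snd p - snd q * fst p" "(snd p - snd q, fst q - fst p)"]
    convex_halfspace_le[of "(snd p - snd q, fst q - fst p)" "fst q * snd p - snd q * fst p"]
  unfolding cross_conv_inner diff_ge_0_iff_ge diff_le_0_iff_le by auto

lemma measure_split:
  assumes "convex H" "bounded H" "p \<noteq> q"
  shows "measure lebesgue H =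
    measure lebesgue (H \<inter> {z. 0 \<le> cross p q z}) + measure lebesgue (H \<inter> {z. cross p q z \<le> 0})"
proof -
  let ?A = "H \<inter> {z. 0 \<le> cross p q z}" and ?B = "H \<inter> {z. cross p q z \<le> 0}"
  have lm: "?A \<in> lmeasurable" "?B \<in> lmeasurable"
    using assms by (auto intro!: measurable_convex convex_Int convex_side bounded_Int)
  have "negligible {z. cross p q z = 0}"
  proof -
    have "(snd p - snd q, fst q - fst p) \<noteq> 0"
      using \<open>p \<noteq> q\<close> by (auto simp: prod_eq_iff)
    then have "negligible {z. (snd p - snd q, fst q - fst p) \<bullet> z = fst q * snd p - snd q * fst p}"
      by (intro negligible_hyperplane) auto
    then show ?thesis by (simp only: cross_conv_inner right_minus_eq)
  qed
  then have "negligible (?A \<inter> ?B)"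
    by (rule negligible_subset) auto
  then have "measure lebesgue (?A \<inter> ?B) = 0"
    by (simp add: negligible_imp_measure0)
  moreover have "H = ?A \<union> ?B" by auto
  ultimately show ?thesis
    using measure_Un3[OF lm] by simp
qed

text \<open>Both ends of the cutting chord belong to both halves of H, so each half is a convex set
  to which an area bound for its own points applies, and the halves share only a null set. Every
  polygon bound below arises from such cuts.\<close>

lemma measure_ge_separated_pieces:
  assumes H: "convex H" "bounded H" "p \<in> H" "q \<in> H" "A \<subseteq> H" "B \<subseteq> H"
    and A: "\<And>z. z \<in> A \<Longrightarrow> cross p q z \<le> 0" and B: "\<And>z. z \<in> B \<Longrightarrow> 0 \<le> cross p q z"
    and a: "\<And>H'. \<lbrakk>convex H'; bounded H'; A \<union> {p, q} \<subseteq> H'\<rbrakk> \<Longrightarrow> a \<le> measure lebesgue H'"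
    and b: "\<And>H'. \<lbrakk>convex H'; bounded H'; B \<union> {p, q} \<subseteq> H'\<rbrakk> \<Longrightarrow> b \<le> measure lebesgue H'"
    and ne: "p \<noteq> q"
  shows "a + b \<le> measure lebesgue H"
proof -
  have pq: "cross p q p = 0" "cross p q q = 0" by (auto simp: cross_def)
  have "a \<le> measure lebesgue (H \<inter> {z. cross p q z \<le> 0})"
    using H A pq by (intro a convex_Int convex_side bounded_Int) auto
  moreover have "b \<le> measure lebesgue (H \<inter> {z. 0 \<le> cross p q z})"
    using H B pq by (intro b convex_Int convex_side bounded_Int) auto
  ultimately show ?thesis
    using measure_split[of H p q] H ne by linarith
qed

text \<open>Twice the area of a polygon triangulated from its vertex p.\<close>

fun fan :: "real \<times> real \<Rightarrow> (real \<times> real) list \<Rightarrow> real" where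
  "fan p (q # r # qs) = cross p q r + fan p (r # qs)"
| "fan p _ = 0"

text \<open>The sorting condition puts the vertices in angular order around p. The chord from p to
  the second vertex then separates the first triangle from the rest of the fan, and the cuts can be
  repeated.\<close>

lemma fan_le_measure:
  assumes "convex H" "bounded H" "p \<in> H" "set qs \<subseteq> H"
    and "sorted_wrt (\<lambda>q r. 0 \<le> cross p q r) qs"
  shows "fan p qs / 2 \<le> measure lebesgue H"
  using assms
proof (induction p qs arbitrary: H rule: fan.induct)
  case (1 p q r qs)
  show ?case
  proof (cases "p = r")
    \<comment> \<open>There is no chord to cut along, but the first triangle is degenerate.\<close>
    case True
    then have "fan p (q # r # qs) = fan p (r # qs)" by (simp add: cross_def)
    then show ?thesis using 1 by simp
  next
    case False
    have "cross p q r / 2 + fan p (r # qs) / 2 \<le> measure lebesgue H"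
    proof (rule measure_ge_separated_pieces[where p = p and q = r and A = "{q}" and B = "set qs"])
      show "cross p r z \<le> 0" if "z \<in> {q}" for z
        using that "1.prems"(5) by (auto simp: cross_def algebra_simps)
      show "cross p q r / 2 \<le> measure lebesgue H'"
        if "convex H'" "bounded H'" "{q} \<union> {p, r} \<subseteq> H'" for H'
        using that by (intro triangle_le_measure) auto
      show "fan p (r # qs) / 2 \<le> measure lebesgue H'"
        if "convex H'" "bounded H'" "set qs \<union> {p, r} \<subseteq> H'" for H'
        using that "1.prems" by (intro "1.IH") auto
    qed (use "1.prems" False in auto)
    then show ?thesis by (simp add: add_divide_distrib)
  qed
qed auto

text \<open>The chord from p to the last vertex has the fan on one side and, by the strict sign, x
  on the other. This form suits the search: the fan stays fixed while x runs through a
  family.\<close>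

lemma fan_last_le_measure:
  assumes "convex H" "bounded H" "p \<in> H" "set qs \<subseteq> H" "qs \<noteq> []" "x \<in> H"
    and "sorted_wrt (\<lambda>q r. 0 \<le> cross p q r) qs" "0 < cross p (last qs) x"
  shows "(fan p qs + cross p (last qs) x) / 2 \<le> measure lebesgue H"
proof -
  have ne: "p \<noteq> last qs" using assms(8) by (auto simp: cross_def)
  have "fan p qs / 2 + cross p (last qs) x / 2 \<le> measure lebesgue H"
  proof (rule measure_ge_separated_pieces[where p = p and q = "last qs" and A = "set qs" and B = "{x}"])
    show "cross p (last qs) z \<le> 0" if "z \<in> set qs" for z
    proof -
      have "z = last qs \<or> z \<in> set (butlast qs)"
        using that \<open>qs \<noteq> []\<close> by (cases qs rule: rev_cases) auto
      moreover have "sorted_wrt (\<lambda>q r. 0 \<le> cross p q r) (butlast qs @ [last qs])"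
        using assms by simp
      ultimately show ?thesis
        by (auto simp: sorted_wrt_append cross_def algebra_simps)
    qed
    show "fan p qs / 2 \<le> measure lebesgue H'"
      if "convex H'" "bounded H'" "set qs \<union> {p, last qs} \<subseteq> H'" for H'
      using that assms by (intro fan_le_measure) auto
    show "cross p (last qs) x / 2 \<le> measure lebesgue H'"
      if "convex H'" "bounded H'" "{x} \<union> {p, last qs} \<subseteq> H'" for H'
      using that assms by (intro triangle_le_measure) auto
  qed (use assms ne in auto)
  then show ?thesis by (simp add: add_divide_distrib)
qed

text \<open>The same cut along the opening edge of the fan instead of the closing one.\<close>

lemma fan_first_le_measure:
  assumes "convex H" "bounded H" "p \<in> H" "set (q # qs) \<subseteq> H" "x \<in> H"
    and "sorted_wrt (\<lambda>q r. 0 \<le> cross p q r) (q # qs)" "0 < cross q p x"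
  shows "(fan p (q # qs) + cross q p x) / 2 \<le> measure lebesgue H"
proof -
  have ne: "p \<noteq> q" using assms(7) by (auto simp: cross_def)
  have "fan p (q # qs) / 2 + cross q p x / 2 \<le> measure lebesgue H"
  proof (rule measure_ge_separated_pieces[where p = q and q = p and A = "set qs" and B = "{x}"])
    show "cross q p z \<le> 0" if "z \<in> set qs" for z
      using assms(6) that by (auto simp: cross_def algebra_simps)
    show "fan p (q # qs) / 2 \<le> measure lebesgue H'"
      if "convex H'" "bounded H'" "set qs \<union> {q, p} \<subseteq> H'" for H'
      using that assms by (intro fan_le_measure) auto
    show "cross q p x / 2 \<le> measure lebesgue H'"
      if "convex H'" "bounded H'" "{x} \<union> {q, p} \<subseteq> H'" for H'
      using that assms by (intro triangle_le_measure) auto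
  qed (use assms ne in auto)
  then show ?thesis by (simp add: add_divide_distrib)
qed

section \<open>Windows of homoclinic sequences\<close>

primrec wpow :: "nat \<Rightarrow> 'a list \<Rightarrow> 'a list" where
  "wpow 0 A = []"
| "wpow (Suc n) A = A @ wpow n A"

lemma wpow_numeral [simp]: "wpow (numeral k) A = A @ wpow (pred_numeral k) A"
  by (simp add: numeral_eq_Suc)

lemma length_wpow [simp]: "length (wpow n A) = n * length A"
  by (induction n) auto

lemma set_wpow: "set (wpow n A) \<subseteq> set A"
  by (induction n) auto

lemma wpow_add: "wpow (m + n) A = wpow m A @ wpow n A"
  by (induction m) auto

lemma wpow_Suc_right: "wpow (Suc n) A = wpow n A @ A"
  using wpow_add[of n 1 A] by simp

lemma rev_wpow: "rev (wpow n A) = wpow n (rev A)"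
proof (induction n)
  case (Suc n)
  have "rev (wpow (Suc n) A) = wpow n (rev A) @ rev A" using Suc by simp
  then show ?case by (simp only: wpow_Suc_right)
qed simp

lemma map_wpow: "map f (wpow n A) = wpow n (map f A)"
  by (induction n) auto

lemma wpow_nth:
  assumes "i < n * length A"
  shows "wpow n A ! i = A ! (i mod length A)"
  using assms
proof (induction n arbitrary: i)
  case (Suc n)
  show ?case
  proof (cases "i < length A")
    case False
    then have "wpow (Suc n) A ! i = A ! ((i - length A) mod length A)"
      using Suc by (simp add: nth_append)
    then show ?thesis using False by (simp add: le_mod_geq)
  qed (simp add: nth_append)
qed simp

text \<open>Occurrence in the bi-infinite word that repeats A on both sides of a single M, expressed
  by finite powers.\<close>

definition factor :: "nat list \<Rightarrow> nat list \<Rightarrow> nat list \<Rightarrow> bool" where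
  "factor A M w \<longleftrightarrow> (\<exists>K. sublist w (wpow K A @ M @ wpow K A))"

lemma sublist_wpow_mono:
  assumes "K \<le> K'" shows "sublist (wpow K A @ M @ wpow K A) (wpow K' A @ M @ wpow K' A)"
proof -
  have "wpow K' A @ M @ wpow K' A = wpow (K' - K) A @ (wpow K A @ M @ wpow K A) @ wpow (K' - K) A"
    using assms wpow_add[of "K' - K" K A] wpow_add[of K "K' - K" A] by simp
  then show ?thesis by (metis sublist_appendI)
qed

lemma factorI:
  assumes "sublist w (wpow a A @ M @ wpow b A)" shows "factor A M w"
proof -
  have "wpow (max a b) A @ M @ wpow (max a b) A =
      wpow (max a b - a) A @ (wpow a A @ M @ wpow b A) @ wpow (max a b - b) A"
    using wpow_add[of "max a b - a" a A] wpow_add[of b "max a b - b" A] by simp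
  then have "sublist (wpow a A @ M @ wpow b A) (wpow (max a b) A @ M @ wpow (max a b) A)"
    by (metis sublist_appendI)
  then show ?thesis using assms unfolding factor_def by (metis sublist_order.order_trans)
qed

lemma factor_piece:
  assumes "k \<le> length (wpow a A @ M)" "n \<le> N * length A"
  shows "factor A M (take n (drop k ((wpow a A @ M) @ wpow N A @ R)))"
proof (rule factorI)
  have "take n (drop k ((wpow a A @ M) @ wpow N A @ R)) = take n (drop k (wpow a A @ M @ wpow N A))"
    using assms by (simp add: drop_append take_append)
  also have "sublist \<dots> (wpow a A @ M @ wpow N A)"
    by (meson sublist_drop sublist_order.order_trans sublist_take)
  finally show "sublist (take n (drop k ((wpow a A @ M) @ wpow N A @ R))) (wpow a A @ M @ wpow N A)" .
qed

text \<open>Two successive blocks cover the window. Consecutive copies of M are at least N copies of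
  A apart, which is no less than the window length, so a window starting in a stretch
  \<open>A^a M\<close> ends within the first N copies of A after it.\<close>

lemma blocks_window:
  assumes P: "P = (wpow N A @ M) @ (wpow (Suc N) A @ M)" and Q: "Q = (wpow (Suc N) A @ M) @ (wpow N A @ M)"
    and n: "n \<le> N * length A" and ne: "A \<noteq> []"
  shows "factor A M (map (\<lambda>i. blocks P Q e (p + int i)) [0..<n])"
proof -
  define m where "m = length P"
  define c where "c = (p - 1) div int m"
  define d where "d = nat ((p - 1) mod int m)"
  define X where "X = (if e c then P else Q)"
  define Y where "Y = (if e (c + 1) then P else Q)"
  have len: "length Q = m" "length X = m" "length Y = m"
    by (auto simp: m_def X_def Y_def P Q)
  have m: "0 < m" using ne by (simp add: m_def P)
  have nm: "n \<le> m" using n by (simp add: m_def P)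
  have d: "d < m" "p - 1 = c * int m + int d"
    using m by (auto simp: d_def c_def nat_less_iff)
  have "map (\<lambda>i. blocks P Q e (p + int i)) [0..<n] = take n (drop d (X @ Y))"
  proof (rule nth_equalityI)
    fix i assume "i < length (map (\<lambda>i. blocks P Q e (p + int i)) [0..<n])"
    then have i: "i < n" by simp
    have p: "p + int i - 1 = int (d + i) + c * int m" using d by simp
    have "blocks P Q e (p + int i) = (X @ Y) ! (d + i)"
    proof (cases "d + i < m")
      case True
      then have "(p + int i - 1) div int m = c" "nat ((p + int i - 1) mod int m) = d + i"
        unfolding p by (auto simp flip: of_nat_add)
      then show ?thesis using True len by (simp add: blocks_def m_def[symmetric] X_def nth_append)
    next
      case False
      have p': "p + int i - 1 = int (d + i - m) + (c + 1) * int m"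
        using p False by (simp add: algebra_simps of_nat_diff)
      have lt: "d + i - m < m" using False i nm d by linarith
      then have "(p + int i - 1) div int m = c + 1" "nat ((p + int i - 1) mod int m) = d + i - m"
        unfolding p' by (auto simp del: of_nat_diff)
      then show ?thesis
        using False len by (simp add: blocks_def m_def[symmetric] Y_def nth_append)
    qed
    then show "map (\<lambda>i. blocks P Q e (p + int i)) [0..<n] ! i = take n (drop d (X @ Y)) ! i"
      using i len nm d by (simp del: take_append drop_append)
  qed (use len nm d in simp)
  moreover have "factor A M (take n (drop d (X @ Y)))"
  proof -
    have "\<exists>R. Y = wpow N A @ R" by (auto simp: Y_def P Q wpow_Suc_right simp del: wpow.simps)
    then obtain R where R: "Y = wpow N A @ R" ..
    \<comment> \<open>In either order of the two stretches, the second one opens with at least N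
      copies of A, and so does the following block.\<close>
    obtain a b where X: "X = (wpow a A @ M) @ (wpow b A @ M)" "N \<le> b"
      by (cases "e c") (auto simp: X_def P Q simp del: wpow.simps)
    show ?thesis
    proof (cases "d \<le> length (wpow a A @ M)")
      case True
      have "X @ Y = (wpow a A @ M) @ wpow N A @ (wpow (b - N) A @ M @ Y)"
        using X wpow_add[of N "b - N" A] by simp
      then show ?thesis by (simp only: factor_piece[OF True n])
    next
      case False
      have "drop d (X @ Y) = drop (d - length (wpow a A @ M)) ((wpow b A @ M) @ wpow N A @ R)"
        using False by (simp add: X R)
      moreover have "d - length (wpow a A @ M) \<le> length (wpow b A @ M)"
        using d(1) len X by (simp add: m_def)
      ultimately show ?thesis by (simp only: factor_piece[OF _ n])
    qed
  qed
  ultimately show ?thesis by simp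
qed

text \<open>
  The points coded by sequences whose \<open>2 * L\<close> digits around the centre are \<open>w\<close>.
\<close>

definition cell :: "nat list \<Rightarrow> (real \<times> real) set" where
  "cell w = (let L = length w div 2 in
     {binval (drop L w)..binval (drop L w) + (1 / 2) ^ L} \<times>
     {binval (rev (take L w))..binval (rev (take L w)) + (1 / 2) ^ L})"

lemma binval_prefix:
  assumes "\<And>n. d n \<in> {0, 1 :: nat}"
  shows "(\<Sum>n. real (d n) / 2 ^ Suc n) \<in> {binval (map d [0..<L])..binval (map d [0..<L]) + (1 / 2) ^ L}"
proof -
  let ?f = "\<lambda>n. real (d n) / 2 ^ Suc n"
  have sm: "summable ?f" using assms by (rule summable_binary)
  then have sm': "summable (\<lambda>n. ?f (n + L))" by (rule summable_ignore_initial_segment)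
  have g: "(\<lambda>n. (1 / 2 :: real) ^ L * (1 / 2) ^ Suc n) sums ((1 / 2) ^ L * 1)"
    by (intro sums_mult power_half_series)
  have le: "?f (n + L) \<le> (1 / 2) ^ L * (1 / 2) ^ Suc n" for n
    using assms[of "n + L"] by (auto simp: power_add power_divide mult_ac)
  have "(\<Sum>n. ?f (n + L)) \<le> (1 / 2) ^ L"
    using suminf_le[OF le sm' sums_summable[OF g]] sums_unique[OF g] by simp
  moreover have "0 \<le> (\<Sum>n. ?f (n + L))" by (rule suminf_nonneg[OF sm']) simp
  moreover have "suminf ?f = (\<Sum>n. ?f (n + L)) + binval (map d [0..<L])"
    by (subst suminf_split_initial_segment[OF sm, of L]) (simp add: binval_sum)
  ultimately show ?thesis by simp
qed

text \<open>A survivor set of dimension 0 cannot contain all block codings, so some coded orbit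
  enters H. The digits around the centre at the time of entry form the window.\<close>

lemma window_hit:
  assumes bits: "set A \<subseteq> {0, 1}" "set M \<subseteq> {0, 1}" and nc: "A @ M \<noteq> M @ A"
    and dim: "\<not> 0 < hausdorff_dim (survivor_set H)"
  shows "\<exists>w. factor A M w \<and> length w = 2 * L \<and> cell w \<inter> H \<noteq> {}"
proof -
  \<comment> \<open>A is nonempty, so N copies of it are at least as long as the window.\<close>
  define N where "N = 2 * L"
  define P where "P = (wpow N A @ M) @ (wpow (Suc N) A @ M)"
  define Q where "Q = (wpow (Suc N) A @ M) @ (wpow N A @ M)"
  have ne: "A \<noteq> []" "M \<noteq> []" using nc by auto
  have PQ: "set P \<subseteq> {0, 1}" "set Q \<subseteq> {0, 1}" "length Q = length P" "2 \<le> length P" "P \<noteq> []"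
    using bits set_wpow[of N A] ne by (auto simp: P_def Q_def Suc_le_eq simp flip: length_greater_0_conv)
  have "P \<noteq> Q"
  proof
    assume "P = Q"
    moreover have "P = wpow N A @ (M @ A) @ wpow N A @ M" by (simp add: P_def)
    moreover have "Q = wpow N A @ (A @ M) @ wpow N A @ M"
      unfolding Q_def wpow_Suc_right by simp
    ultimately have "(M @ A) @ wpow N A @ M = (A @ M) @ wpow N A @ M" by simp
    then show False using nc by (simp only: append_same_eq)
  qed
  then obtain e where "coding (blocks P Q e) \<notin> survivor_set H"
    using hausdorff_dim_blocks_pos[OF PQ(1-4)] dim by blast
  moreover have bin: "blocks P Q e \<in> binary_seqs"
    using blocks_binary PQ by blast
  ultimately obtain n where n: "coding (shift n (blocks P Q e)) \<in> H"
    unfolding survivor_set_def by blast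
  define u where "u = blocks P Q e"
  define w where "w = map (\<lambda>i. u (n - int L + 1 + int i)) [0..<2 * L]"
  have u: "u i \<in> {0, 1}" for i using bin by (auto simp: u_def binary_seqs_def)
  have "factor A M w"
    unfolding w_def u_def using ne by (intro blocks_window[OF P_def Q_def]) (auto simp: N_def Suc_le_eq)
  moreover have "length w = 2 * L" by (simp add: w_def)
  moreover have "coding (shift n u) \<in> cell w"
  proof -
    have "drop L w = map (\<lambda>i. u (int (Suc i) + n)) [0..<L]"
      by (rule nth_equalityI) (auto simp: w_def algebra_simps)
    moreover have "rev (take L w) = map (\<lambda>i. u (- int i + n)) [0..<L]"
      by (rule nth_equalityI) (auto simp: w_def rev_nth algebra_simps of_nat_diff)
    ultimately show ?thesis
      using binval_prefix[of "\<lambda>i. u (int (Suc i) + n)" L] binval_prefix[of "\<lambda>i. u (- int i + n)" L] u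
      by (simp add: cell_def \<open>length w = 2 * L\<close> coding_def shift_def)
  qed
  ultimately show ?thesis using n u_def by blast
qed

lemma periodic_window:
  assumes "j + n \<le> K * length A" "j mod length A + n \<le> N * length A"
  shows "take n (drop j (wpow K A)) = take n (drop (j mod length A) (wpow N A))"
proof (rule nth_equalityI)
  fix i assume "i < length (take n (drop j (wpow K A)))"
  then have "i < n" by simp
  then show "take n (drop j (wpow K A)) ! i = take n (drop (j mod length A) (wpow N A)) ! i"
    using assms by (simp add: wpow_nth mod_add_left_eq)
qed (use assms in simp)

text \<open>This makes the set of windows finite. A window that meets M needs no more than N copies
  of A on either side. One that misses M is periodic and can be moved to start within the first copy
  of A, which costs the additional copy on the left.\<close>

lemma factor_window:
  assumes f: "factor A M w" "length w = n" and n: "n \<le> N * length A" and ne: "A \<noteq> []"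
  shows "\<exists>j. j + n \<le> length (wpow N A @ A @ M @ wpow N A) \<and> w = take n (drop j (wpow N A @ A @ M @ wpow N A))"
proof -
  let ?a = "length A"
  let ?W = "wpow (Suc N) A @ M @ wpow N A"
  obtain K0 where "sublist w (wpow K0 A @ M @ wpow K0 A)" using f by (auto simp: factor_def)
  define K where "K = max K0 (Suc N)"
  have K: "Suc N \<le> K" by (simp add: K_def)
  have "sublist w (wpow K A @ M @ wpow K A)"
    using \<open>sublist w _\<close> sublist_wpow_mono[of K0 K A M] by (metis K_def max.cobounded1 sublist_order.order_trans)
  then obtain p s where ps: "wpow K A @ M @ wpow K A = p @ w @ s" by (auto simp: sublist_def)
  define j where "j = length p"
  have j: "j + n \<le> 2 * (K * ?a) + length M" and w: "w = take n (drop j (wpow K A @ M @ wpow K A))"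
    using arg_cong[OF ps, of length] f(2) unfolding j_def by (simp, simp only: ps, simp)
  have per: "\<exists>j. j + n \<le> length ?W \<and> w = take n (drop j ?W)"
    if i: "i + n \<le> K * ?a" "w = take n (drop i (wpow K A))" for i
  proof (intro exI conjI)
    have lt: "i mod ?a < ?a" using ne by simp
    then have le: "i mod ?a + n \<le> Suc N * ?a" using n by simp
    then show "i mod ?a + n \<le> length ?W" by simp
    show "w = take n (drop (i mod ?a) ?W)"
      using periodic_window[OF i(1) le] i(2) le by (simp add: drop_append take_append del: wpow.simps)
  qed
  have "\<exists>j. j + n \<le> length ?W \<and> w = take n (drop j ?W)"
  proof (cases "j + n \<le> K * ?a")
    case True
    then have "w = take n (drop j (wpow K A))" using w by simp
    then show ?thesis using per True by blast
  next
    case 1: False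
    show ?thesis
    proof (cases "K * ?a + length M \<le> j")
      case True
      then have "w = take n (drop (j - (K * ?a + length M)) (wpow K A))" using w by simp
      moreover have "j - (K * ?a + length M) + n \<le> K * ?a" using True j by linarith
      ultimately show ?thesis by (intro per)
    next
      case False
      \<comment> \<open>Trimming the left power to its last N + 1 copies moves the window by a
        multiple of \<open>length A\<close>.\<close>
      define i where "i = j - (K - Suc N) * ?a"
      have K': "K * ?a = (K - Suc N) * ?a + Suc N * ?a"
        using K by (simp only: add_mult_distrib[symmetric]) simp
      have i: "j = (K - Suc N) * ?a + i" using 1 n K' by (simp add: i_def)
      have "wpow K A @ M @ wpow K A = wpow (K - Suc N) A @ ?W @ wpow (K - N) A"
        using K wpow_add[of "K - Suc N" "Suc N" A] wpow_add[of N "K - N" A] by simp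
      then have "w = take n (drop i (?W @ wpow (K - N) A))"
        using w i by (simp del: append.assoc wpow.simps)
      moreover have le: "i + n \<le> length ?W" using False n K' i by simp
      ultimately show ?thesis by (intro exI[of _ i]) (simp del: append.assoc wpow.simps)
    qed
  qed
  then show ?thesis by (simp only: wpow_Suc_right append.assoc)
qed

section \<open>The search tree checker\<close>

text \<open>
  A box \<open>(a, b, c, d)\<close> stands for \<open>[a, b] \<times> [c, d]\<close> in units of \<open>2\<^sup>-\<^sup>2\<^sup>0\<close>.  Nested conditionals replace
  conjunctions below because \<open>code_simp\<close> would evaluate both conjuncts.
\<close>

type_synonym box = "int \<times> int \<times> int \<times> int"

definition sq :: "int \<Rightarrow> int \<Rightarrow> int \<Rightarrow> box" where
  "sq w x y = (w * x, w * x + w, w * y, w * y + w)"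

fun box_le :: "box \<Rightarrow> box \<Rightarrow> bool" where
  "box_le (a, b, c, d) (a1, b1, c1, d1) =
     (if a1 \<le> a then if b \<le> b1 then if c1 \<le> c then d \<le> d1 else False else False else False)"

text \<open>The least product of a number in \<open>[a, b]\<close> and one in \<open>[c, d]\<close>.
  It is attained at a corner, which the signs determine except when 0 is interior to the first
  interval.\<close>

fun mult_low :: "int \<Rightarrow> int \<Rightarrow> int \<Rightarrow> int \<Rightarrow> int" where
  "mult_low a b c d =
     (if 0 \<le> a then (if 0 \<le> c then a * c else b * c)
      else if b \<le> 0 then (if 0 \<le> d then a * d else b * d)
      else min (a * d) (b * c))"

text \<open>Interval arithmetic: the two products of \<open>cross\<close> are bounded independently,
  although both depend on the position of the first point in its box.\<close>

fun cross_low :: "box \<Rightarrow> box \<Rightarrow> box \<Rightarrow> int" where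
  "cross_low (a, b, c, d) (a1, b1, c1, d1) (a2, b2, c2, d2) =
     mult_low (a1 - b) (b1 - a) (c2 - d) (d2 - c) + mult_low (c - d1) (d - c1) (a2 - b) (b2 - a)"

fun fan_low :: "box \<Rightarrow> box list \<Rightarrow> int" where
  "fan_low p (q # r # qs) = cross_low p q r + fan_low p (r # qs)"
| "fan_low p _ = 0"

fun turns_left :: "box \<Rightarrow> box \<Rightarrow> box list \<Rightarrow> bool" where
  "turns_left p q [] = True"
| "turns_left p q (r # rs) = (if 0 \<le> cross_low p q r then turns_left p q rs else False)"

fun fan_convex :: "box \<Rightarrow> box list \<Rightarrow> bool" where
  "fan_convex p [] = True"
| "fan_convex p (q # qs) = (if turns_left p q qs then fan_convex p qs else False)"

text \<open>
  Twice the critical area, in units of \<open>2\<^sup>-\<^sup>4\<^sup>0\<close> and rounded up.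
\<close>

definition twice_area :: int where
  "twice_area = 259528724621"

text \<open>What an additional triangle has to contribute to reach the critical area. If the angular
  order of the vertices is not certain, the polygon counts for nothing and the triangle must reach
  that area alone.\<close>

definition missing_area :: "box \<Rightarrow> box list \<Rightarrow> int" where
  "missing_area p qs = (if fan_convex p qs then twice_area - fan_low p qs else twice_area)"

text \<open>
  The value for indices out of range is the whole square, which every trap hits.
\<close>

fun box_at :: "box list \<Rightarrow> int \<Rightarrow> box" where
  "box_at (b # bs) i = (if i = 0 then b else box_at bs (i - 1))"
| "box_at [] i = (0, 1048576, 0, 1048576)"

text \<open>
  Given the boxes on the path to a node, the test \<open>KL [i\<^sub>1, \<dots>, i\<^sub>m]\<close> rejects a further box \<open>x\<close> if the
  polygon \<open>i\<^sub>1 \<dots> i\<^sub>m\<close> and the triangle \<open>i\<^sub>1 i\<^sub>m x\<close> on the other side of their common edge have too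
  large a total area; \<open>KF\<close> attaches the triangle to the edge \<open>i\<^sub>1 i\<^sub>2\<close> instead.  The polygon is
  evaluated once per node, so that each \<open>x\<close> costs one cross product.
\<close>

datatype kill = KL "int list" | KF "int list"

fun prepare :: "box list \<Rightarrow> kill \<Rightarrow> int \<times> box \<times> box" where
  "prepare bs (KL is) =
     (case map (box_at bs) is of
        p # q # qs \<Rightarrow> (missing_area p (q # qs), p, last (q # qs))
      | _ \<Rightarrow> (twice_area, box_at [] 0, box_at [] 0))"
| "prepare bs (KF is) =
     (case map (box_at bs) is of
        p # q # qs \<Rightarrow> (missing_area p (q # qs), q, p)
      | _ \<Rightarrow> (twice_area, box_at [] 0, box_at [] 0))"

text \<open>A nonpositive first entry means that the polygon is too large already, whatever x
  is.\<close>

fun killed :: "box \<Rightarrow> (int \<times> box \<times> box) list \<Rightarrow> bool" where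
  "killed x [] = False"
| "killed x ((s, p, q) # ks) =
     (if s \<le> 0 then True else if s \<le> cross_low x p q then True else killed x ks)"

text \<open>
  A node branches over a family of boxes of which every trap hits at least one.  The family is a
  function so that \<open>code_simp\<close> does not unfold it inside a tree.  \<open>Cut\<close> is a branch that is closed
  by a separate lemma.
\<close>

datatype tree = Cut | Nd "unit \<Rightarrow> box list" "kill list" "(box \<times> tree) list"

fun in_child :: "box \<Rightarrow> (box \<times> tree) list \<Rightarrow> bool" where
  "in_child x [] = False"
| "in_child x ((b, t) # cs) = (if box_le x b then True else in_child x cs)"

fun covered :: "box list \<Rightarrow> (int \<times> box \<times> box) list \<Rightarrow> (box \<times> tree) list \<Rightarrow> bool" where
  "covered [] ks cs = True"
| "covered (x # xs) ks cs =
     (if killed x ks then covered xs ks cs else if in_child x cs then covered xs ks cs else False)"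

text \<open>Boxes are appended along the path, so their positions, to which the tests refer, stay
  the same throughout a subtree.\<close>

fun check :: "box list \<Rightarrow> tree \<Rightarrow> bool" and checks :: "box list \<Rightarrow> (box \<times> tree) list \<Rightarrow> bool" where
  "check bs Cut = True"
| "check bs (Nd f ks cs) = (if covered (f ()) (map (prepare bs) ks) cs then checks bs cs else False)"
| "checks bs [] = True"
| "checks bs ((b, t) # cs) = (if check (bs @ [b]) t then checks bs cs else False)"

section \<open>Enumeration of windows\<close>

fun bits_value :: "nat list \<Rightarrow> int \<Rightarrow> int" where
  "bits_value [] a = a"
| "bits_value (x # xs) a = bits_value xs (if x = 0 then 2 * a else 2 * a + 1)"

fun window_box :: "int \<Rightarrow> nat list \<Rightarrow> nat list \<Rightarrow> box" where
  "window_box s l r = sq s (bits_value r 0) (bits_value l 0)"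

fun windows :: "int \<Rightarrow> nat list \<Rightarrow> nat list \<Rightarrow> nat list \<Rightarrow> box list" where
  "windows s l r [] = [window_box s l r]"
| "windows s l r (x#xs) = window_box s l r # windows s (hd r # butlast l) (tl r @ [x]) xs"

text \<open>
  A fast version of \<open>windows\<close>: both coordinates are updated from the digit \<open>a\<close> leaving the window
  on the left, the digit \<open>b\<close> crossing its centre and the digit \<open>c\<close> entering on the right.
\<close>

fun slide :: "int \<Rightarrow> int \<Rightarrow> int \<Rightarrow> int \<Rightarrow> nat list \<Rightarrow> nat list \<Rightarrow> nat list \<Rightarrow> box list" where
  "slide s t x y (a # as) (b # bs) (c # cs) = sq s x y #
   slide s t (if b = 0 then bits_value [c] x else bits_value [c] x - t)
     (((if a = 0 then y else y - 1) + (if b = 0 then 0 else t)) div 2) as bs cs"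
| "slide s t x y _ _ _ = [sq s x y]"

lemma bits_value_add: "bits_value bs a = a * 2 ^ length bs + bits_value bs 0"
proof (induction bs arbitrary: a)
  case (Cons b bs)
  show ?case using Cons[of "2 * a"] Cons[of "2 * a + 1"] Cons[of 1] by (simp add: algebra_simps)
qed simp

lemma bits_value_append: "bits_value (bs @ cs) a = bits_value cs (bits_value bs a)"
  by (induction bs arbitrary: a) auto

text \<open>The crossing digit b is the leading digit of x, so after doubling it is removed with
  weight \<open>2 ^ L\<close>. The leaving digit a is the last digit of y; once it is subtracted and
  b is put on top with weight \<open>2 ^ L\<close>, the value is even and is halved.\<close>

lemma windows_slide:
  assumes "length l = L" "length r = L" "0 < L"
  shows "windows s l r xs = slide s (2 ^ L) (bits_value r 0) (bits_value l 0) (rev l @ r @ xs) (r @ xs) xs"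
  using assms
proof (induction xs arbitrary: l r)
  case Nil
  then show ?case by simp
next
  case (Cons c xs)
  obtain b rs where r: "r = b # rs" using Cons.prems by (cases r) auto
  obtain a ls where l: "l = ls @ [a]" using Cons.prems by (cases l rule: rev_cases) auto
  have L: "L = Suc (length rs)" "L = Suc (length ls)" using Cons.prems r l by auto
  have "bits_value (rs @ [c]) 0 =
      (if b = 0 then bits_value [c] (bits_value r 0) else bits_value [c] (bits_value r 0) - 2 ^ L)"
    unfolding bits_value_append r using bits_value_add[of rs 1] L(1) by simp
  moreover have "bits_value (b # ls) 0 =
      ((if a = 0 then bits_value l 0 else bits_value l 0 - 1) + (if b = 0 then 0 else 2 ^ L)) div 2"
    unfolding bits_value_append l using bits_value_add[of ls 1] L(2) by simp
  moreover have "windows s (b # ls) (rs @ [c]) xs = slide s (2 ^ L) (bits_value (rs @ [c]) 0) (bits_value (b # ls) 0)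
      (rev (b # ls) @ (rs @ [c]) @ xs) ((rs @ [c]) @ xs) xs"
    using L by (intro Cons.IH) auto
  ultimately show ?case by (simp add: r l)
qed

text \<open>
  The boxes of side \<open>s = 2\<^sup>2\<^sup>0 / 2\<^sup>L\<close> for the windows of \<open>2 * L\<close> digits of \<open>A\<^sup>N\<^sup>+\<^sup>1 M A\<^sup>N\<close>; these are
  all windows of the homoclinic orbit if \<open>2 * L \<le> N * length A\<close>.
\<close>

definition family :: "int \<Rightarrow> nat \<Rightarrow> nat \<Rightarrow> nat list \<Rightarrow> nat list \<Rightarrow> box list" where
  "family s L N A M = (let W = wpow N A @ A @ M @ wpow N A; V = drop L W in
     slide s (2 ^ L) (bits_value (take L V) 0) (bits_value (rev (take L W)) 0) W V (drop L V))"

lemma family_windows: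
  assumes "0 < L" "2 * L \<le> N * length A"
  shows "family s L N A M = (let W = wpow N A @ A @ M @ wpow N A in
     windows s (rev (take L W)) (take L (drop L W)) (drop L (drop L W)))"
proof -
  let ?W = "wpow N A @ A @ M @ wpow N A"
  have "2 * L \<le> length ?W" using assms(2) by (simp only: length_append length_wpow)
  then have "length (rev (take L ?W)) = L" "length (take L (drop L ?W)) = L"
    by (simp_all only: length_rev length_take length_drop)
  then show ?thesis
    unfolding family_def Let_def
    by (subst windows_slide[OF _ _ assms(1)]) (simp_all only: rev_rev_ident append_take_drop_id)
qed

section \<open>Traps and their symmetries\<close>

definition region :: "box \<Rightarrow> (real \<times> real) set" where
  "region = (\<lambda>(a, b, c, d). {z. of_int a \<le> 2 ^ 20 * fst z \<and> 2 ^ 20 * fst z \<le> of_int b \<and>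
     of_int c \<le> 2 ^ 20 * snd z \<and> 2 ^ 20 * snd z \<le> of_int d})"

definition hit :: "(real \<times> real) set \<Rightarrow> box \<Rightarrow> bool" where
  "hit H b \<longleftrightarrow> region b \<inter> H \<noteq> {}"

definition trap :: "(real \<times> real) set \<Rightarrow> bool" where
  "trap H \<longleftrightarrow> H \<subseteq> unit_square \<and> convex H \<and> H \<in> sets borel \<and> measure lebesgue H < 0.11802 \<and>
     (\<forall>A M L. set A \<subseteq> {0, 1} \<longrightarrow> set M \<subseteq> {0, 1} \<longrightarrow> A @ M \<noteq> M @ A \<longrightarrow>
       (\<exists>w. factor A M w \<and> length w = 2 * L \<and> cell w \<inter> H \<noteq> {}))"

definition bad :: "box list \<Rightarrow> bool" where
  "bad bs \<longleftrightarrow> (\<forall>H. trap H \<longrightarrow> \<not> (\<forall>b\<in>set bs. hit H b))"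

lemma box_le_region: "box_le x b \<Longrightarrow> region x \<subseteq> region b"
  by (cases x; cases b) (force simp: region_def split: if_splits)

lemma box_le_hit: "box_le x b \<Longrightarrow> hit H x \<Longrightarrow> hit H b"
  using box_le_region unfolding hit_def by blast

section \<open>Invariance of traps under transposition and half turn\<close>

lemma distr_swap_lborel: "distr lborel borel prod.swap = (lborel :: (real \<times> real) measure)"
proof (rule lborel_eqI[symmetric])
  fix l u :: "real \<times> real"
  assume le: "\<And>b. b \<in> Basis \<Longrightarrow> l \<bullet> b \<le> u \<bullet> b"
  have [measurable]: "(prod.swap :: real \<times> real \<Rightarrow> _) \<in> borel_measurable borel"
    unfolding prod.swap_def by (intro borel_measurable_continuous_onI continuous_intros)
  have eq: "prod.swap -` box l u = box (prod.swap l) (prod.swap u)"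
    by (auto simp: mem_box Basis_prod_real inner_prod_def)
  have "emeasure (distr lborel borel prod.swap) (box l u) = emeasure lborel (box (prod.swap l) (prod.swap u))"
    by (subst emeasure_distr) (auto simp: eq)
  also have "\<dots> = (\<Prod>b\<in>Basis. (prod.swap u - prod.swap l) \<bullet> b)"
    using le[of "(1, 0)"] le[of "(0, 1)"]
    by (intro emeasure_lborel_box) (auto simp: Basis_prod_real inner_prod_def)
  also have "(\<Prod>b\<in>Basis. (prod.swap u - prod.swap l) \<bullet> b) = (\<Prod>b\<in>Basis. (u - l) \<bullet> b)"
    by (simp add: Basis_prod_real inner_prod_def)
  finally show "emeasure (distr lborel borel prod.swap) (box l u) = (\<Prod>b\<in>Basis. (u - l) \<bullet> b)" .
qed simp

lemma swap_borel:
  assumes "H \<in> sets borel"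
  shows "prod.swap ` H \<in> sets borel" "measure lebesgue (prod.swap ` H) = measure lebesgue (H :: (real \<times> real) set)"
proof -
  have [measurable]: "(prod.swap :: real \<times> real \<Rightarrow> _) \<in> borel_measurable borel"
    unfolding prod.swap_def by (intro borel_measurable_continuous_onI continuous_intros)
  have eq: "prod.swap ` H = prod.swap -` H"
    by (force simp: image_iff)
  have "prod.swap -` H \<inter> space borel \<in> sets borel"
    by (rule measurable_sets[OF _ assms]) measurable
  then show b: "prod.swap ` H \<in> sets borel" by (simp add: eq)
  have "measure lborel (prod.swap -` H) = measure (distr lborel borel prod.swap) H"
    using assms by (subst measure_distr) auto
  then have "measure lborel (prod.swap ` H) = measure lborel H"
    by (simp only: eq distr_swap_lborel)
  then show "measure lebesgue (prod.swap ` H) = measure lebesgue H"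
    using assms b by (simp add: measure_completion)
qed

lemma factor_rev: "factor A M w \<Longrightarrow> factor (rev A) (rev M) (rev w)"
  unfolding factor_def by (metis append.assoc rev_append rev_wpow sublist_rev)

lemma factor_map: "factor A M w \<Longrightarrow> factor (map f A) (map f M) (map f w)"
  unfolding factor_def sublist_def by (metis map_append map_wpow)

lemma factor_bits:
  assumes "factor A M w" "set A \<subseteq> {0, 1}" "set M \<subseteq> {0, 1}" shows "set w \<subseteq> {0, 1}"
proof -
  obtain K where "sublist w (wpow K A @ M @ wpow K A)" using assms by (auto simp: factor_def)
  then have "set w \<subseteq> set (wpow K A @ M @ wpow K A)" by (rule set_mono_sublist)
  also have "\<dots> \<subseteq> set A \<union> set M" using set_wpow[of K A] by auto
  finally show ?thesis using assms(2,3) by blast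
qed

lemma cell_rev: "length w = 2 * L \<Longrightarrow> cell (rev w) = prod.swap ` cell w"
  by (auto simp: cell_def take_rev drop_rev)

lemma binval_compl:
  assumes "set bs \<subseteq> {0, 1}"
  shows "binval (map (\<lambda>b. 1 - b) bs) = 1 - (1 / 2) ^ length bs - binval bs"
  using assms by (induction bs) (auto simp: field_simps)

lemma cell_compl:
  assumes "length w = 2 * L" "set w \<subseteq> {0, 1}"
  shows "cell (map (\<lambda>b. 1 - b) w) = (\<lambda>z. (1, 1) - z) ` cell w"
proof -
  have "set (drop L w) \<subseteq> {0, 1}" "set (rev (take L w)) \<subseteq> {0, 1}"
    using assms by (auto dest: in_set_dropD in_set_takeD)
  then have c: "binval (drop L (map (\<lambda>b. 1 - b) w)) = 1 - (1 / 2) ^ L - binval (drop L w)"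
    "binval (rev (take L (map (\<lambda>b. 1 - b) w))) = 1 - (1 / 2) ^ L - binval (rev (take L w))"
    using binval_compl[of "drop L w"] binval_compl[of "rev (take L w)"] assms
    by (simp_all add: drop_map take_map rev_map)
  have "z \<in> cell (map (\<lambda>b. 1 - b) w) \<longleftrightarrow> (1, 1) - z \<in> cell w" for z
    using c by (cases z) (auto simp: cell_def assms(1))
  moreover have "z \<in> (\<lambda>z. (1, 1) - z) ` cell w \<longleftrightarrow> (1, 1) - z \<in> cell w" for z
    by (auto intro!: image_eqI[of _ _ "(1, 1) - z"])
  ultimately show ?thesis by (intro set_eqI) (simp only:)
qed

text \<open>Reversing a sequence exchanges past and future, hence the two coordinates. The window
  for A and M is the reversal of a window for \<open>rev A\<close> and \<open>rev M\<close>.\<close>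

lemma trap_swap: assumes "trap H" shows "trap (prod.swap ` H)"
  unfolding trap_def
proof (intro conjI allI impI)
  note H = assms[unfolded trap_def]
  show "prod.swap ` H \<subseteq> unit_square" using H by auto
  show "convex (prod.swap ` H)"
    using H by (intro convex_linear_image linearI) auto
  show "prod.swap ` H \<in> sets borel" "measure lebesgue (prod.swap ` H) < 0.11802"
    using H swap_borel[of H] by auto
  fix A M :: "nat list" and L
  assume A: "set A \<subseteq> {0, 1}" "set M \<subseteq> {0, 1}" "A @ M \<noteq> M @ A"
  then have "set (rev A) \<subseteq> {0, 1}" "set (rev M) \<subseteq> {0, 1}" "rev A @ rev M \<noteq> rev M @ rev A"
    by (auto simp flip: rev_append)
  then obtain w where w: "factor (rev A) (rev M) w" "length w = 2 * L" "cell w \<inter> H \<noteq> {}"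
    using H by blast
  have "factor A M (rev w)" using factor_rev[OF w(1)] by simp
  moreover have "cell (rev w) \<inter> prod.swap ` H \<noteq> {}"
    using w unfolding cell_rev[OF w(2)] by blast
  ultimately show "\<exists>w. factor A M w \<and> length w = 2 * L \<and> cell w \<inter> prod.swap ` H \<noteq> {}"
    using w(2) by (intro exI[of _ "rev w"]) auto
qed

text \<open>Complementing all digits replaces both coordinates by their differences from 1, so the
  window is the complement of a window for the complemented words.\<close>

lemma trap_rot: assumes "trap H" shows "trap ((\<lambda>z. (1, 1) - z) ` H)"
  unfolding trap_def
proof (intro conjI allI impI)
  note H = assms[unfolded trap_def]
  let ?r = "\<lambda>z :: real \<times> real. (1, 1) - z"
  have aff: "?r ` H = (\<lambda>z. (1, 1) + (- 1) *\<^sub>R z) ` H" by simp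
  show "?r ` H \<subseteq> unit_square" using H by auto
  show "convex (?r ` H)"
    unfolding aff using H by (intro convex_affinity) auto
  have "?r ` H = ?r -` H"
  proof (intro set_eqI iffI)
    fix z assume "z \<in> ?r -` H"
    then show "z \<in> ?r ` H" by (intro image_eqI[of _ _ "?r z"]) auto
  qed auto
  moreover have "?r -` H \<inter> space borel \<in> sets borel"
    using H by (intro measurable_sets[of _ borel borel] borel_measurable_continuous_onI continuous_intros) auto
  ultimately show "?r ` H \<in> sets borel" by simp
  have "measure lebesgue (?r ` H) = measure lebesgue H"
    unfolding aff using measure_lebesgue_affine[of "- 1" "(1, 1)" H] by simp
  moreover have "measure lebesgue H < 0.11802" using H by blast
  ultimately show "measure lebesgue (?r ` H) < 0.11802" by (simp only:)
  let ?c = "map (\<lambda>b. 1 - b) :: nat list \<Rightarrow> _"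
  \<comment> \<open>The subtraction on natural numbers is truncated, so it is an involution only on
    words over 0 and 1.\<close>
  have cc: "?c (?c v) = v" if "set v \<subseteq> {0, 1}" for v
    using that by (induction v) auto
  fix A M :: "nat list" and L
  assume A: "set A \<subseteq> {0, 1}" "set M \<subseteq> {0, 1}" "A @ M \<noteq> M @ A"
  have "?c A @ ?c M \<noteq> ?c M @ ?c A"
  proof
    assume "?c A @ ?c M = ?c M @ ?c A"
    then have "?c (?c (A @ M)) = ?c (?c (M @ A))" by simp
    then show False using A cc[of "A @ M"] cc[of "M @ A"] by simp
  qed
  moreover have c01: "set (?c A) \<subseteq> {0, 1}" "set (?c M) \<subseteq> {0, 1}" by auto
  ultimately obtain w where w: "factor (?c A) (?c M) w" "length w = 2 * L" "cell w \<inter> H \<noteq> {}"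
    using H by blast
  have "factor A M (?c w)" using factor_map[OF w(1), of "\<lambda>b. 1 - b"] cc A by metis
  moreover have "cell (?c w) \<inter> ?r ` H \<noteq> {}"
    using w unfolding cell_compl[OF w(2) factor_bits[OF w(1) c01]] by blast
  ultimately show "\<exists>w. factor A M w \<and> length w = 2 * L \<and> cell w \<inter> ?r ` H \<noteq> {}"
    using w(2) by (intro exI[of _ "?c w"]) auto
qed

fun swapb :: "box \<Rightarrow> box" where "swapb (a, b, c, d) = (c, d, a, b)"
fun rotb :: "box \<Rightarrow> box" where
  "rotb (a, b, c, d) = (1048576 - b, 1048576 - a, 1048576 - d, 1048576 - c)"

lemma hit_swap: "hit H b \<Longrightarrow> hit (prod.swap ` H) (swapb b)"
  by (cases b) (force simp: hit_def region_def)

lemma hit_rot: "hit H b \<Longrightarrow> hit ((\<lambda>z. (1, 1) - z) ` H) (rotb b)"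
proof -
  assume "hit H b"
  then obtain z where z: "z \<in> H" "z \<in> region b" by (auto simp: hit_def)
  then have "(1, 1) - z \<in> region (rotb b)"
    by (cases b; cases z) (simp add: region_def algebra_simps)
  then show ?thesis using z by (auto simp: hit_def)
qed

lemma swapb_swapb [simp]: "swapb (swapb b) = b" by (cases b) auto
lemma rotb_rotb [simp]: "rotb (rotb b) = b" by (cases b) auto

lemma bad_swap:
  assumes "bad (map swapb bs)" shows "bad bs"
  unfolding bad_def
proof (intro allI impI notI)
  fix H assume "trap H" "\<forall>b\<in>set bs. hit H b"
  then have "trap (prod.swap ` H)" "\<forall>b\<in>set (map swapb bs). hit (prod.swap ` H) b"
    using trap_swap hit_swap by auto
  then show False using assms unfolding bad_def by blast
qed

lemma bad_rot:
  assumes "bad (map rotb bs)" shows "bad bs"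
  unfolding bad_def
proof (intro allI impI notI)
  fix H assume "trap H" "\<forall>b\<in>set bs. hit H b"
  then have "trap ((\<lambda>z. (1, 1) - z) ` H)" "\<forall>b\<in>set (map rotb bs). hit ((\<lambda>z. (1, 1) - z) ` H) b"
    using trap_rot hit_rot by auto
  then show False using assms unfolding bad_def by blast
qed

lemma bad_mono: "bad bs \<Longrightarrow> set bs \<subseteq> set cs \<Longrightarrow> bad cs"
  unfolding bad_def by blast

section \<open>Soundness of the checker\<close>

lemma mult_low_le:
  fixes x y :: real
  assumes "of_int a \<le> x" "x \<le> of_int b" "of_int c \<le> y" "y \<le> of_int d"
  shows "of_int (mult_low a b c d) \<le> x * y"
proof -
  consider "0 \<le> a" "0 \<le> c" | "0 \<le> a" "c < 0" | "a < 0" "b \<le> 0" "0 \<le> d" | "a < 0" "b \<le> 0" "d < 0"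
    | "a < 0" "0 < b" by linarith
  then show ?thesis
  proof cases
    case 1
    then have "real_of_int a * real_of_int c \<le> x * y" using assms by (intro mult_mono) auto
    then show ?thesis using 1 by simp
  next
    case 2
    have "real_of_int b * real_of_int c \<le> x * real_of_int c"
      using 2 assms by (intro mult_right_mono_neg) auto
    also have "\<dots> \<le> x * y" using 2 assms by (intro mult_left_mono) auto
    finally show ?thesis using 2 by simp
  next
    case 3
    have "real_of_int a * real_of_int d \<le> x * real_of_int d"
      using 3 assms by (intro mult_right_mono) auto
    also have "\<dots> \<le> x * y" using 3 assms by (intro mult_left_mono_neg) auto
    finally show ?thesis using 3 by simp
  next
    case 4
    have "real_of_int b * real_of_int d \<le> x * real_of_int d"
      using 4 assms by (intro mult_right_mono_neg) auto
    also have "\<dots> \<le> x * y" using 4 assms by (intro mult_left_mono_neg) auto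
    finally show ?thesis using 4 by simp
  next
    case 5
    have "min (real_of_int a * real_of_int d) (real_of_int b * real_of_int c) \<le> x * y"
    proof (cases "0 \<le> x")
      case True
      have "real_of_int b * real_of_int c \<le> x * y \<or> 0 \<le> y"
        using mult_right_mono_neg[of x b c] mult_left_mono[of c y x] assms True
        by (cases "c \<le> 0") auto
      moreover have "real_of_int a * real_of_int d \<le> x * y" if "0 \<le> y"
      proof -
        have "real_of_int a * real_of_int d \<le> 0"
          by (rule mult_nonpos_nonneg) (use 5 that assms in auto)
        also have "0 \<le> x * y" using True that by (rule mult_nonneg_nonneg)
        finally show ?thesis .
      qed
      ultimately show ?thesis by linarith
    next
      case False
      have "real_of_int a * real_of_int d \<le> x * y" if "0 \<le> y"
      proof -
        have "real_of_int a * real_of_int d \<le> x * real_of_int d"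
          by (rule mult_right_mono) (use that assms in auto)
        also have "\<dots> \<le> x * y" by (rule mult_left_mono_neg) (use False assms in auto)
        finally show ?thesis .
      qed
      moreover have "real_of_int b * real_of_int c \<le> x * y" if "y \<le> 0"
      proof -
        have "real_of_int b * real_of_int c \<le> 0"
          by (rule mult_nonneg_nonpos) (use 5 that assms in auto)
        also have "0 \<le> x * y" by (rule mult_nonpos_nonpos) (use False that in auto)
        finally show ?thesis .
      qed
      ultimately show ?thesis by linarith
    qed
    moreover have "real_of_int (min (a * d) (b * c)) = min (real_of_int a * real_of_int d) (real_of_int b * real_of_int c)"
      by (simp add: min_def flip: of_int_mult)
    ultimately show ?thesis using 5 by simp
  qed
qed

lemma cross_low_le:
  assumes "p \<in> region P" "q \<in> region Q" "r \<in> region R"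
  shows "of_int (cross_low P Q R) \<le> 2 ^ 40 * cross p q r"
proof -
  obtain a b c d where P: "P = (a, b, c, d)" by (cases P)
  obtain a1 b1 c1 d1 where Q: "Q = (a1, b1, c1, d1)" by (cases Q)
  obtain a2 b2 c2 d2 where R: "R = (a2, b2, c2, d2)" by (cases R)
  let ?s = "2 ^ 20 :: real"
  have "of_int (mult_low (a1 - b) (b1 - a) (c2 - d) (d2 - c))
      \<le> (?s * fst q - ?s * fst p) * (?s * snd r - ?s * snd p)"
    using assms by (intro mult_low_le) (auto simp: region_def P Q R)
  moreover have "of_int (mult_low (c - d1) (d - c1) (a2 - b) (b2 - a))
      \<le> (?s * snd p - ?s * snd q) * (?s * fst r - ?s * fst p)"
    using assms by (intro mult_low_le) (auto simp: region_def P Q R)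
  moreover have "2 ^ 40 * cross p q r = (?s * fst q - ?s * fst p) * (?s * snd r - ?s * snd p)
      + (?s * snd p - ?s * snd q) * (?s * fst r - ?s * fst p)"
    by (simp add: cross_def algebra_simps)
  ultimately show ?thesis by (simp add: P Q R)
qed

lemma fan_low_le:
  assumes "\<And>B. B \<in> insert P (set Q) \<Longrightarrow> f B \<in> region B"
  shows "of_int (fan_low P Q) \<le> 2 ^ 40 * fan (f P) (map f Q)"
  using assms
proof (induction P Q rule: fan_low.induct)
  case (1 p q r qs)
  have "of_int (cross_low p q r) \<le> 2 ^ 40 * cross (f p) (f q) (f r)"
    using "1.prems" by (intro cross_low_le) auto
  moreover have "of_int (fan_low p (r # qs)) \<le> 2 ^ 40 * fan (f p) (map f (r # qs))"
    using "1.prems" by (intro "1.IH") auto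
  ultimately show ?case by (simp add: distrib_left)
qed auto

lemma turns_left_iff: "turns_left P Q Rs \<longleftrightarrow> (\<forall>R\<in>set Rs. 0 \<le> cross_low P Q R)"
  by (induction P Q Rs rule: turns_left.induct) auto

lemma fan_convex_sorted:
  assumes "fan_convex P Q" "\<And>B. B \<in> insert P (set Q) \<Longrightarrow> f B \<in> region B"
  shows "sorted_wrt (\<lambda>q r. 0 \<le> cross (f P) q r) (map f Q)"
  using assms
proof (induction P Q rule: fan_convex.induct)
  case (2 p q qs)
  have "0 \<le> cross (f p) (f q) (f r)" if "r \<in> set qs" for r
  proof -
    have "0 \<le> cross_low p q r" using 2 that by (auto simp: turns_left_iff split: if_splits)
    moreover have "of_int (cross_low p q r) \<le> 2 ^ 40 * cross (f p) (f q) (f r)"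
      using "2.prems" that by (intro cross_low_le) auto
    ultimately have "0 \<le> 2 ^ 40 * cross (f p) (f q) (f r)" by linarith
    then show ?thesis by (simp add: zero_le_mult_iff)
  qed
  then show ?case using 2 by (auto split: if_splits)
qed auto

section \<open>Soundness of the rejection tests for a fixed trap\<close>

context
  fixes H and f :: "box \<Rightarrow> real \<times> real"
  assumes H: "trap H" and f: "\<And>b. hit H b \<Longrightarrow> f b \<in> region b \<inter> H"
begin

text \<open>2199023255552 is \<open>2^41\<close>: the area is doubled and measured in units of
  \<open>2^-40\<close>.\<close>

lemma trapD: "convex H" "bounded H" "2199023255552 * measure lebesgue H < of_int twice_area"
  using H unfolding trap_def twice_area_def
  by (auto intro: bounded_subset[OF bounded_Times[OF bounded_closed_interval bounded_closed_interval]])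

lemma hit_whole: "hit H (box_at [] 0)"
proof -
  \<comment> \<open>Any two words that do not commute would do, as only a point of H is
    wanted.\<close>
  have "set [0] \<subseteq> {0, 1 :: nat}" "set [1] \<subseteq> {0, 1 :: nat}" "[0] @ [1] \<noteq> [1] @ [0 :: nat]" by auto
  then obtain w where "cell w \<inter> H \<noteq> {}" using H unfolding trap_def by blast
  then obtain z where "z \<in> H" "z \<in> unit_square" using H unfolding trap_def by blast
  then have "z \<in> region (box_at [] 0)" by (cases z) (simp add: region_def)
  with \<open>z \<in> H\<close> show ?thesis unfolding hit_def by blast
qed

lemma hit_box_at: "(\<And>b. b \<in> set bs \<Longrightarrow> hit H b) \<Longrightarrow> hit H (box_at bs i)"
proof (induction bs arbitrary: i)
  case Nil
  then show ?case using hit_whole by simp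
qed simp

text \<open>Refutes the tests in which the polygon contributes nothing: uncertain fans and lists
  with fewer than two indices.\<close>

lemma no_triangle:
  assumes "hit H p" "hit H q" "hit H r" "twice_area \<le> cross_low p q r" shows False
proof -
  have "cross (f p) (f q) (f r) / 2 \<le> measure lebesgue H"
    using f assms trapD by (intro triangle_le_measure) auto
  moreover have "of_int (cross_low p q r) \<le> 2 ^ 40 * cross (f p) (f q) (f r)"
    using f assms by (intro cross_low_le) auto
  moreover have "real_of_int twice_area \<le> of_int (cross_low p q r)" using assms(4) by (simp only: of_int_le_iff)
  ultimately show False using trapD(3) by simp
qed

lemma cross_rotate: "cross p q r = cross r p q"
  by (simp add: cross_def algebra_simps)

lemma no_last:
  assumes hit: "\<And>b. b \<in> insert x (insert p (set qs)) \<Longrightarrow> hit H b" and "qs \<noteq> []"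
    and le: "missing_area p qs \<le> 0 \<or> missing_area p qs \<le> cross_low x p (last qs)"
  shows False
proof (cases "fan_convex p qs")
  case True
  have in_region: "f b \<in> region b" "f b \<in> H" if "b \<in> insert x (insert p (set qs))" for b
    using f hit that by blast+
  have sorted: "sorted_wrt (\<lambda>q r. 0 \<le> cross (f p) q r) (map f qs)"
    using True in_region by (intro fan_convex_sorted) auto
  have sum: "of_int (fan_low p qs) \<le> 2 ^ 40 * fan (f p) (map f qs)"
    using in_region by (intro fan_low_le) auto
  have missing_area: "real_of_int (missing_area p qs) = of_int twice_area - of_int (fan_low p qs)"
    using True by (simp add: missing_area_def)
  have last: "last (map f qs) = f (last qs)" using \<open>qs \<noteq> []\<close> by (rule last_map)
  have "of_int (cross_low x p (last qs)) \<le> 2 ^ 40 * cross (f x) (f p) (f (last qs))"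
    using in_region \<open>qs \<noteq> []\<close> by (intro cross_low_le) auto
  then have cross_low: "of_int (cross_low x p (last qs)) \<le> 2 ^ 40 * cross (f p) (last (map f qs)) (f x)"
    by (simp only: last cross_rotate[of "f p" "f (last qs)" "f x"])
  show False
  proof (cases "missing_area p qs \<le> 0")
    case True
    have "fan (f p) (map f qs) / 2 \<le> measure lebesgue H"
      using in_region sorted trapD by (intro fan_le_measure) auto
    then show False using sum missing_area trapD(3) True[folded of_int_le_0_iff[where 'a = real]]
      by (simp del: of_int_le_0_iff fan_convex.simps fan.simps fan_low.simps list.map)
  next
    case False
    \<comment> \<open>A test does not check on which side of the edge x lies. If a positive deficit
      is covered by the lower bound, the triangle has positive orientation for all positions in the
      boxes, so x lies beyond the edge.\<close>
    then have pos: "0 < cross (f p) (last (map f qs)) (f x)"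
      using le cross_low by (smt (verit) of_int_0_less_iff zero_less_mult_iff zero_less_power)
    have "(fan (f p) (map f qs) + cross (f p) (last (map f qs)) (f x)) / 2 \<le> measure lebesgue H"
      using in_region sorted trapD pos \<open>qs \<noteq> []\<close> by (intro fan_last_le_measure) auto
    moreover have "real_of_int (missing_area p qs) \<le> of_int (cross_low x p (last qs))"
      using le False by (simp only: of_int_le_iff) simp
    ultimately show False using sum missing_area cross_low trapD(3) by simp
  qed
next
  case False
  then have "missing_area p qs = twice_area" "0 < twice_area" by (simp_all add: missing_area_def twice_area_def)
  then show False using no_triangle[of x p "last qs"] hit le \<open>qs \<noteq> []\<close> by auto
qed

lemma no_first:
  assumes hit: "\<And>b. b \<in> insert x (insert p (set (q # qs))) \<Longrightarrow> hit H b"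
    and le: "missing_area p (q # qs) \<le> 0 \<or> missing_area p (q # qs) \<le> cross_low x q p"
  shows False
proof (cases "fan_convex p (q # qs)")
  case True
  have in_region: "f b \<in> region b" "f b \<in> H" if "b \<in> insert x (insert p (set (q # qs)))" for b
    using f hit that by blast+
  have sorted: "sorted_wrt (\<lambda>q r. 0 \<le> cross (f p) q r) (map f (q # qs))"
    using True in_region by (intro fan_convex_sorted) auto
  have sum: "of_int (fan_low p (q # qs)) \<le> 2 ^ 40 * fan (f p) (map f (q # qs))"
    using in_region by (intro fan_low_le) auto
  have missing_area: "real_of_int (missing_area p (q # qs)) = of_int twice_area - of_int (fan_low p (q # qs))"
    using True by (simp only: missing_area_def if_True of_int_diff)
  have "of_int (cross_low x q p) \<le> 2 ^ 40 * cross (f x) (f q) (f p)"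
    using in_region by (intro cross_low_le) auto
  then have cross_low: "of_int (cross_low x q p) \<le> 2 ^ 40 * cross (f q) (f p) (f x)"
    by (simp only: cross_rotate[of "f q" "f p" "f x"])
  show False
  proof (cases "missing_area p (q # qs) \<le> 0")
    case True
    have "fan (f p) (map f (q # qs)) / 2 \<le> measure lebesgue H"
      using in_region sorted trapD by (intro fan_le_measure) auto
    then show False using sum missing_area trapD(3) True[folded of_int_le_0_iff[where 'a = real]]
      by (simp del: of_int_le_0_iff fan_convex.simps fan.simps fan_low.simps list.map)
  next
    case False
    then have pos: "0 < cross (f q) (f p) (f x)"
      using le cross_low by (smt (verit) of_int_0_less_iff zero_less_mult_iff zero_less_power)
    have "(fan (f p) (f q # map f qs) + cross (f q) (f p) (f x)) / 2 \<le> measure lebesgue H"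
      using in_region sorted trapD pos by (intro fan_first_le_measure) auto
    moreover have "real_of_int (missing_area p (q # qs)) \<le> of_int (cross_low x q p)"
      using le False by (simp only: of_int_le_iff) simp
    ultimately show False using sum missing_area cross_low trapD(3) by (simp del: fan.simps fan_low.simps)
  qed
next
  case False
  then have "missing_area p (q # qs) = twice_area" "0 < twice_area" by (simp_all add: missing_area_def twice_area_def)
  then show False using no_triangle[of x q p] hit le by auto
qed

lemma not_killed:
  assumes hit: "\<And>b. b \<in> set bs \<Longrightarrow> hit H b" "hit H x" and "killed x (map (prepare bs) ks)"
  shows False
  using assms(3)
proof (induction ks)
  case (Cons k ks)
  obtain s p q where k: "prepare bs k = (s, p, q)" by (cases "prepare bs k")
  have whole: "\<not> twice_area \<le> cross_low x (box_at [] 0) (box_at [] 0)" "0 < twice_area"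
    using no_triangle[OF hit(2) hit_whole hit_whole] by (auto simp: twice_area_def)
  have "\<not> (s \<le> 0 \<or> s \<le> cross_low x p q)"
  proof (cases k)
    case (KL "is")
    have h: "hit H b" if "b \<in> set (map (box_at bs) is)" for b
      using that hit_box_at[OF hit(1)] by auto
    show ?thesis
    \<comment> \<open>\<open>remdups_adj.cases\<close> merely distinguishes lists of length 0, 1 and
      at least 2.\<close>
    proof (cases "map (box_at bs) is" rule: remdups_adj.cases)
      case (3 p' q' qs)
      then have sp: "s = missing_area p' (q' # qs)" "p = p'" "q = last (q' # qs)"
        using k KL by auto
      have hh: "hit H b" if "b \<in> insert x (insert p' (set (q' # qs)))" for b
        using h[of b] that hit(2) unfolding 3 by (cases "b = x") simp_all
      show ?thesis
      proof
        assume "s \<le> 0 \<or> s \<le> cross_low x p q"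
        then have le: "missing_area p' (q' # qs) \<le> 0 \<or> missing_area p' (q' # qs) \<le> cross_low x p' (last (q' # qs))"
          by (simp only: sp)
        show False by (rule no_last[OF hh _ le]) simp_all
      qed
    qed (use k KL whole in auto)
  next
    case (KF "is")
    have h: "hit H b" if "b \<in> set (map (box_at bs) is)" for b
      using that hit_box_at[OF hit(1)] by auto
    show ?thesis
    proof (cases "map (box_at bs) is" rule: remdups_adj.cases)
      case (3 p' q' qs)
      then have sp: "s = missing_area p' (q' # qs)" "p = q'" "q = p'"
        using k KF by auto
      have hh: "hit H b" if "b \<in> insert x (insert p' (set (q' # qs)))" for b
        using h[of b] that hit(2) unfolding 3 by (cases "b = x") simp_all
      show ?thesis
      proof
        assume "s \<le> 0 \<or> s \<le> cross_low x p q"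
        then have le: "missing_area p' (q' # qs) \<le> 0 \<or> missing_area p' (q' # qs) \<le> cross_low x q' p'"
          by (simp only: sp)
        show False by (rule no_first[OF hh le])
      qed
    qed (use k KF whole in auto)
  qed
  then show ?case using Cons k by (simp split: if_splits)
qed simp

end

definition unavoidable :: "(unit \<Rightarrow> box list) \<Rightarrow> bool" where
  "unavoidable F \<longleftrightarrow> (\<forall>H. trap H \<longrightarrow> (\<exists>x\<in>set (F ()). hit H x))"

text \<open>What the evaluation of \<open>check\<close> leaves open: the families must be
  unavoidable and the cut branches bad. In the tree lemmas \<open>code_simp\<close> settles
  \<open>check\<close>, and \<open>simp\<close> settles this remainder.\<close>

fun grounded :: "box list \<Rightarrow> tree \<Rightarrow> bool" and grounded_list :: "box list \<Rightarrow> (box \<times> tree) list \<Rightarrow> bool" where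
  "grounded bs Cut \<longleftrightarrow> bad bs"
| "grounded bs (Nd F ks cs) \<longleftrightarrow> unavoidable F \<and> grounded_list bs cs"
| "grounded_list bs [] \<longleftrightarrow> True"
| "grounded_list bs ((b, t) # cs) \<longleftrightarrow> grounded (bs @ [b]) t \<and> grounded_list bs cs"

lemma in_child_iff: "in_child x cs \<longleftrightarrow> (\<exists>b\<in>fst ` set cs. box_le x b)"
  by (induction x cs rule: in_child.induct) auto

lemma covered_iff: "covered xs ks cs \<longleftrightarrow> (\<forall>x\<in>set xs. killed x ks \<or> in_child x cs)"
  by (induction xs ks cs rule: covered.induct) auto

text \<open>At a node a trap hits some box of the family. This box cannot be rejected, so it lies in
  the box of a child, which is then hit too, and the longer path is bad by induction.\<close>

lemma check_bad:
  "check bs t \<Longrightarrow> grounded bs t \<Longrightarrow> bad bs"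
  "checks bs cs \<Longrightarrow> grounded_list bs cs \<Longrightarrow> b \<in> fst ` set cs \<Longrightarrow> bad (bs @ [b])"
proof (induction bs t and bs cs arbitrary: and b rule: check_checks.induct)
  case (2 bs F ks cs)
  have cov: "covered (F ()) (map (prepare bs) ks) cs" and cs: "checks bs cs"
    using "2.prems" by (auto split: if_splits)
  show ?case
    unfolding bad_def
  proof (intro allI impI notI)
    fix H assume H: "trap H" and hit: "\<forall>b\<in>set bs. hit H b"
    \<comment> \<open>One point is chosen for each box, so that the triangles of a polygon share
      their vertices.\<close>
    define f where "f b = (SOME z. z \<in> region b \<inter> H)" for b
    have f: "f b \<in> region b \<inter> H" if "hit H b" for b
      using that unfolding f_def hit_def by (subst some_in_eq)
    obtain x where x: "x \<in> set (F ())" "hit H x"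
      using "2.prems"(2) H unfolding grounded.simps unavoidable_def by blast
    have "\<not> killed x (map (prepare bs) ks)"
      using not_killed[OF H f _ x(2)] hit by blast
    then obtain b where b: "b \<in> fst ` set cs" "box_le x b"
      using cov x(1) unfolding covered_iff in_child_iff by blast
    then have "bad (bs @ [b])" using "2.IH" cov cs "2.prems"(2) by simp
    then show False using H hit box_le_hit[OF b(2) x(2)] by (auto simp: bad_def)
  qed
next
  case (4 bs b' t cs)
  then have "check (bs @ [b']) t" "checks bs cs" by (auto split: if_splits)
  show ?case
  proof (cases "b = b'")
    case True
    then show ?thesis using "4.IH"(1) "4.prems"(2) \<open>check (bs @ [b']) t\<close> by simp
  next
    case False
    then have "b \<in> fst ` set cs" using "4.prems"(3) by simp
    then show ?thesis using "4.IH"(2) "4.prems"(2) \<open>check (bs @ [b']) t\<close> \<open>checks bs cs\<close> by simp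
  qed
qed auto

section \<open>Windows as integer boxes\<close>

lemma bits_value_binval: "set bs \<subseteq> {0, 1} \<Longrightarrow> of_int (bits_value bs a) = 2 ^ length bs * (of_int a + binval bs)"
  by (induction bs arbitrary: a) (auto simp: algebra_simps)

lemma window_box_region:
  assumes "length w = 2 * L" "set w \<subseteq> {0, 1}" "s * 2 ^ L = 1048576"
  shows "cell w \<subseteq> region (window_box s (rev (take L w)) (drop L w))"
proof
  fix z assume z: "z \<in> cell w"
  have "set (drop L w) \<subseteq> {0, 1}" "set (rev (take L w)) \<subseteq> {0, 1}"
    using assms by (auto dest: in_set_dropD in_set_takeD)
  then have bits_value: "real_of_int (bits_value (drop L w) 0) = 2 ^ L * binval (drop L w)"
    "real_of_int (bits_value (rev (take L w)) 0) = 2 ^ L * binval (rev (take L w))"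
    using assms(1) by (simp_all add: bits_value_binval)
  have s: "real_of_int s * 2 ^ L = 2 ^ 20"
    using arg_cong[OF assms(3), of real_of_int] by simp
  have sx: "real_of_int s * (2 ^ L * x) = 2 ^ 20 * x" for x
    using s by (simp add: mult.assoc[symmetric])
  have s1: "real_of_int s = 2 ^ 20 * (1 / 2) ^ L"
    using sx[of "(1 / 2) ^ L"] by (simp add: power_divide)
  have scale: "2 ^ 20 * binval v = real_of_int s * (2 ^ L * binval v)"
    "2 ^ 20 * (binval v + (1 / 2) ^ L) = real_of_int s * (2 ^ L * binval v) + of_int s" for v
    by (simp_all only: sx distrib_left) (simp only: s1)
  have "binval (drop L w) \<le> fst z" "fst z \<le> binval (drop L w) + (1 / 2) ^ L"
    "binval (rev (take L w)) \<le> snd z" "snd z \<le> binval (rev (take L w)) + (1 / 2) ^ L"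
    using z assms(1) by (auto simp: cell_def)
  then have "2 ^ 20 * binval (drop L w) \<le> 2 ^ 20 * fst z"
    "2 ^ 20 * fst z \<le> 2 ^ 20 * (binval (drop L w) + (1 / 2) ^ L)"
    "2 ^ 20 * binval (rev (take L w)) \<le> 2 ^ 20 * snd z"
    "2 ^ 20 * snd z \<le> 2 ^ 20 * (binval (rev (take L w)) + (1 / 2) ^ L)"
    by (intro mult_left_mono; simp)+
  then show "z \<in> region (window_box s (rev (take L w)) (drop L w))"
    unfolding scale region_def by (simp add: sq_def bits_value)
qed

lemma window_in_windows:
  assumes "length l = L" "length r = L" "0 < L" "j \<le> length xs" "w = take (2 * L) (drop j (rev l @ r @ xs))"
  shows "window_box s (rev (take L w)) (drop L w) \<in> set (windows s l r xs)"
  using assms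
proof (induction xs arbitrary: l r j)
  case Nil
  then show ?case by simp
next
  case (Cons x xs)
  show ?case
  proof (cases j)
    case 0
    then show ?thesis using Cons.prems by simp
  next
    case (Suc i)
    obtain r0 rs where r: "r = r0 # rs" using Cons.prems by (cases r) auto
    obtain l0 ls where l: "l = ls @ [l0]" using Cons.prems by (cases l rule: rev_cases) auto
    have "window_box s (rev (take L w)) (drop L w) \<in> set (windows s (hd r # butlast l) (tl r @ [x]) xs)"
      using Cons.prems Suc by (intro Cons.IH[where j = i]) (auto simp: r l)
    then show ?thesis by simp
  qed
qed

lemma unavoidable_family:
  assumes F: "\<And>u. F u = family s L N A M" and bits: "set A \<subseteq> {0, 1}" "set M \<subseteq> {0, 1}"
    and nc: "A @ M \<noteq> M @ A" and N: "2 * L \<le> N * length A" and s: "s * 2 ^ L = 1048576" and L: "0 < L"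
  shows "unavoidable F"
  unfolding unavoidable_def
proof (intro allI impI)
  fix H assume "trap H"
  then obtain w where w: "factor A M w" "length w = 2 * L" "cell w \<inter> H \<noteq> {}"
    using bits nc unfolding trap_def by blast
  let ?W = "wpow N A @ A @ M @ wpow N A"
  have ne: "A \<noteq> []" using nc by auto
  obtain j where j: "j + 2 * L \<le> length ?W" "w = take (2 * L) (drop j ?W)"
    using factor_window[OF w(1,2) N ne] by auto
  have W: "?W = rev (rev (take L ?W)) @ take L (drop L ?W) @ drop L (drop L ?W)"
    by (simp only: rev_rev_ident append_take_drop_id)
  have "window_box s (rev (take L w)) (drop L w) \<in> set (F ())"
    unfolding F family_windows[OF L N] Let_def
  proof (rule window_in_windows)
    show "w = take (2 * L) (drop j (rev (rev (take L ?W)) @ take L (drop L ?W) @ drop L (drop L ?W)))"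
      using j(2) W by metis
    show "j \<le> length (drop L (drop L ?W))" using j(1) by (simp only: length_drop)
    show "length (rev (take L ?W)) = L" "length (take L (drop L ?W)) = L"
      using j(1) by (simp_all only: length_rev length_take length_drop)
  qed (use L in simp)
  moreover have "hit H (window_box s (rev (take L w)) (drop L w))"
    using window_box_region[OF w(2) factor_bits[OF w(1) bits] s] w(3) unfolding hit_def by blast
  ultimately show "\<exists>x\<in>set (F ()). hit H x" by blast
qed

section \<open>Families of homoclinic orbits\<close>

text \<open>Most families have boxes of side \<open>2^-10\<close> or \<open>2^-20\<close>, with
  \<open>f27\<close> in between, and N is always the least number with
  \<open>2 * L \<le> N * length A\<close>. In \<open>f49\<close> the word M is itself a power longer
  than a window, so no window sees both ends of it: the orbit passes from the period 100 to the
  period 011 and back.\<close>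

definition "f0 (u :: unit) = family 1 20 20 [1,0] [1,1]"
definition "f1 (u :: unit) = family 1024 10 10 [0,1] [0,0,0,0,1,1]"
definition "f2 (u :: unit) = family 1024 10 10 [1,0] [1,1,1,1,0,0]"
definition "f3 (u :: unit) = family 1024 10 10 [0,1] [0,0]"
definition "f4 (u :: unit) = family 1024 10 20 [1] [0,0]"
definition "f5 (u :: unit) = family 1024 10 5 [1,1,0,0] [1,1,1,0,1,0,0]"
definition "f6 (u :: unit) = family 1024 10 10 [0,1] [0,0,1,1,0,1,1]"
definition "f7 (u :: unit) = family 1024 10 7 [1,1,0] [1,1,1,0,0,0]"
definition "f8 (u :: unit) = family 1024 10 5 [1,1,0,0] [1,1,0,1,0,0]"
definition "f9 (u :: unit) = family 1024 10 5 [0,0,1,1] [0,0]"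
definition "f10 (u :: unit) = family 1024 10 10 [1,0] [0,0,1,0,0,1]"
definition "f11 (u :: unit) = family 1024 10 10 [0,1] [0,0,1,1,1,1]"
definition "f12 (u :: unit) = family 1024 10 10 [1,0] [1,1]"
definition "f13 (u :: unit) = family 1024 10 10 [0,1] [0,0,1,1]"
definition "f14 (u :: unit) = family 1 20 40 [1] [0,1,0]"
definition "f15 (u :: unit) = family 1024 10 5 [1,1,1,0] [1,0]"
definition "f16 (u :: unit) = family 1 20 20 [0,1] [0,0,1,1,0]"
definition "f17 (u :: unit) = family 1 20 20 [0,1] [1,0,0,0,1,1,0]"
definition "f18 (u :: unit) = family 1 20 14 [0,0,1] [1]"
definition "f19 (u :: unit) = family 1 20 14 [0,0,1] [0,0,0,1,0,1]"
definition "f20 (u :: unit) = family 1 20 14 [0,0,1] [0,0,0,1,1,1,0]"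
definition "f21 (u :: unit) = family 1 20 8 [0,0,1,0,1] [0,0,1,1,0,0,1]"
definition "f22 (u :: unit) = family 1 20 10 [0,0,1,1] [0,0,1]"
definition "f23 (u :: unit) = family 1 20 20 [1,0] [1,1,0,0,0,1]"
definition "f24 (u :: unit) = family 1 20 14 [0,0,1] [0,1,1]"
definition "f25 (u :: unit) = family 1 20 14 [0,0,1] [1,0,0,1,1]"
definition "f26 (u :: unit) = family 1 20 14 [0,1,1] [1,0,0,0,1,0]"
definition "f27 (u :: unit) = family 64 14 28 [0] [1]"
definition "f28 (u :: unit) = family 1 20 14 [0,0,1] [0,0,0,1,1]"
definition "f29 (u :: unit) = family 1 20 14 [0,0,1] [0,0,0,1,1,1]"
definition "f30 (u :: unit) = family 1024 10 5 [1,1,0,0] [1,1,0]"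
definition "f31 (u :: unit) = family 1 20 10 [0,1,1,0] [1,0,0,1,1]"
definition "f32 (u :: unit) = family 1 20 10 [1,1,0,0] [1,1,0,1,0,0]"
definition "f33 (u :: unit) = family 1 20 10 [1,1,0,0] [1,1,0]"
definition "f34 (u :: unit) = family 1 20 10 [1,1,0,0] [1,1,0,1,0]"
definition "f35 (u :: unit) = family 1 20 14 [0,0,1] [1,0,1,1]"
definition "f36 (u :: unit) = family 1 20 10 [1,0,0,1] [0,1,1,0,0]"
definition "f37 (u :: unit) = family 1 20 14 [1,1,0] [0,1,0,0]"
definition "f38 (u :: unit) = family 1 20 10 [0,0,1,1] [0,0,1,0,1]"
definition "f39 (u :: unit) = family 1 20 14 [1,1,0] [1,0,0]"
definition "f40 (u :: unit) = family 1 20 20 [0,1] [0,0,1,1,0,1,1]"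
definition "f41 (u :: unit) = family 1 20 14 [0,0,1] [1,0,1,0,1,1]"
definition "f42 (u :: unit) = family 1 20 14 [1,1,0] [0,1,1,0,0]"
definition "f43 (u :: unit) = family 1 20 20 [0,1] [0,0,1,1]"
definition "f44 (u :: unit) = family 1 20 20 [1,0] [1,1,0,0,1,0,0]"
definition "f45 (u :: unit) = family 1024 10 10 [1,0] [1,1,0,0]"
definition "f46 (u :: unit) = family 1024 10 10 [0,1] [0,0,1,1,0]"
definition "f47 (u :: unit) = family 1 20 10 [1,0,0,1] [0,0,1,1,0]"
definition "f48 (u :: unit) = family 1 20 14 [1,1,0] [1,1,1,0,0,0]"
definition "f49 (u :: unit) = family 1 20 14 [1,0,0] (wpow 14 [0,1,1])"
definition "f50 (u :: unit) = family 1 20 20 [1,0] [1,1,0,0]"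
definition "f51 (u :: unit) = family 1024 10 10 [1,0] [1,1,0,0,1]"
definition "f52 (u :: unit) = family 1 20 20 [0,1] [0]"
definition "f53 (u :: unit) = family 1 20 20 [1,0] [1,1,0,0,1]"
definition "f54 (u :: unit) = family 1 20 14 [1,1,0] [0]"
definition "f55 (u :: unit) = family 1 20 20 [1,0] [0,1,1,1,0,0,1]"
definition "f56 (u :: unit) = family 1 20 14 [1,1,0] [1,1,1,0,0,0,1]"
definition "f57 (u :: unit) = family 1 20 8 [1,1,0,1,0] [1,1,0,0,1,1,0]"
definition "f58 (u :: unit) = family 1 20 14 [1,1,0] [1,1,1,0,0]"
definition "f59 (u :: unit) = family 1 20 14 [1,1,0] [1,1,1,0,1,0]"
definition "f60 (u :: unit) = family 1 20 14 [1,1,0] [0,1,0,1,0,0]"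
definition "f61 (u :: unit) = family 1 20 20 [0,1] [0,0,1,1,1,0]"
definition "f62 (u :: unit) = family 1 20 14 [1,0,0] [0,1,1,1,0,1]"
definition "f63 (u :: unit) = family 1024 10 7 [1,1,0] [1]"
definition "f64 (u :: unit) = family 1 20 14 [1,1,0] [1,0]"
definition "f65 (u :: unit) = family 1024 10 7 [1,1,0] [1,0]"
definition "f66 (u :: unit) = family 1024 10 7 [1,1,0] [1,1,1]"
definition "f67 (u :: unit) = family 1024 10 5 [0,1,1,1] [0,1,1]"
definition "f68 (u :: unit) = family 1 20 20 [1,0] [1]"
definition "f69 (u :: unit) = family 1024 10 7 [0,0,1] [0]"
definition "f70 (u :: unit) = family 1024 10 7 [0,0,1] [0,0,0]"
definition "f71 (u :: unit) = family 1024 10 7 [0,0,1] [0,1]"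
definition "f72 (u :: unit) = family 1 20 20 [0,1] [0,0]"
definition "f73 (u :: unit) = family 1 20 14 [0,0,1] [0,1]"
definition "f74 (u :: unit) = family 1024 10 5 [1,0,0,0] [1,0,0]"
definition "f75 (u :: unit) = family 1024 10 10 [1,0] [1]"
definition "f76 (u :: unit) = family 1024 10 5 [0,0,0,1] [0,1]"
definition "f77 (u :: unit) = family 1024 10 7 [0,1,0] [1,0,0,1]"
definition "f78 (u :: unit) = family 1024 10 10 [0,1] [0]"
definition "f79 (u :: unit) = family 1024 10 10 [1,0] [0,1,0,0]"
definition "f80 (u :: unit) = family 1 20 20 [1,0] [1,1,0,0,0]"
definition "f81 (u :: unit) = family 1 20 14 [0,0,1] [0]"
definition "f82 (u :: unit) = family 1024 10 7 [1,0,1] [0,1,1,0]"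
definition "f83 (u :: unit) = family 1024 10 5 [0,0,1,1] [0,0,1,0,1,1]"
definition "f84 (u :: unit) = family 1024 10 7 [1,1,0] [1,1,1,0,1,0]"
definition "f85 (u :: unit) = family 1024 10 20 [0] [1,0,1,1]"
definition "f86 (u :: unit) = family 1024 10 10 [1,0] [1,1,1,0,0]"
definition "f87 (u :: unit) = family 1024 10 20 [0] [1,1]"
definition "f88 (u :: unit) = family 1024 10 20 [0] [1,0,1,0,1,1,1]"
definition "f89 (u :: unit) = family 1024 10 20 [1] [0,1,0,1,1,0]"
definition "f90 (u :: unit) = family 1024 10 7 [0,1,1] [1,1,0,0]"
definition "f91 (u :: unit) = family 1024 10 20 [0] [1,0,0,1,0,1,1]"
definition "f92 (u :: unit) = family 1024 10 20 [0] [1,0,1,0,1,1]"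
definition "f93 (u :: unit) = family 1 20 10 [0,0,1,1] [0,0,1,0,1,1]"
definition "f94 (u :: unit) = family 1024 10 4 [1,1,1,0,0] [1,0]"
definition "f95 (u :: unit) = family 1024 10 5 [0,0,1,1] [0,0,0,1,0,1,1]"
definition "f96 (u :: unit) = family 1 20 40 [0] [1,0,1,1]"
definition "f97 (u :: unit) = family 1024 10 20 [1] [0,1,0,1,0,0]"
definition "f98 (u :: unit) = family 1024 10 20 [1] [0,1,1,0,0]"
definition "f99 (u :: unit) = family 1024 10 10 [1,0] [0,0,1,1,1]"
definition "f100 (u :: unit) = family 1024 10 4 [0,0,0,1,1] [0,1]"
definition "f101 (u :: unit) = family 1024 10 10 [1,0] [0,0,0,1,1]"
definition "f102 (u :: unit) = family 1 20 40 [1] [0,1,0,0]"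
definition "f103 (u :: unit) = family 1 20 10 [0,0,1,1] [0,0,0,1,0,1,1]"
definition "f104 (u :: unit) = family 1024 10 20 [0] [1,1,0,1,0,0,1]"
definition "f105 (u :: unit) = family 1 20 40 [0] [1,1,0,1]"
definition "f106 (u :: unit) = family 1 20 40 [0] [1,0,1]"
definition "f107 (u :: unit) = family 1024 10 10 [0,1] [0,0,0,1,1]"
definition "f108 (u :: unit) = family 1024 10 20 [1] [0,1,0]"
definition "f109 (u :: unit) = family 1024 10 20 [0] [1,0,1]"
definition "f110 (u :: unit) = family 1024 10 10 [1,0] [0,1,0,0,0,0,1]"
definition "f111 (u :: unit) = family 1024 10 20 [0] [1,0,1,0,0,1]"
definition "f112 (u :: unit) = family 1024 10 7 [1,0,0] [0,0,1,1]"
definition "f113 (u :: unit) = family 1024 10 7 [1,0,0] [1,1,0,0,0]"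
definition "f114 (u :: unit) = family 1024 10 20 [1] [0,0,1,0]"
definition "f115 (u :: unit) = family 1024 10 5 [0,0,1,1] [1,0]"
definition "f116 (u :: unit) = family 1024 10 7 [0,0,1] [0,1,1]"
definition "f117 (u :: unit) = family 1024 10 10 [1,0] [1,1,0,0,1,0,0]"
definition "f118 (u :: unit) = family 1024 10 7 [0,0,1] [0,0,0,1,1,1]"
definition "f119 (u :: unit) = family 1024 10 10 [0,1] [1,1,0,1,1,0]"
definition "f120 (u :: unit) = family 1024 10 20 [1] [0,1,0,0]"
definition "f121 (u :: unit) = family 1024 10 10 [0,1] [0,0,0]"
definition "f122 (u :: unit) = family 1024 10 10 [0,1] [0,0,0,1,1,1,0]"
definition "f123 (u :: unit) = family 1024 10 10 [0,1] [1,0,0,0,1,1,1]"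
definition "f124 (u :: unit) = family 1 20 40 [0] [1,0,1,0,0,1]"
definition "f125 (u :: unit) = family 1024 10 10 [1,0] [1,1,0,0,0]"
definition "f126 (u :: unit) = family 1024 10 10 [1,0] [1,1,1,0,0,0,1]"
definition "f127 (u :: unit) = family 1024 10 10 [0,1] [0,0,0,1,1,1]"
definition "f128 (u :: unit) = family 1 20 40 [0] [1]"

lemmas family_defs =
  f0_def f1_def f2_def f3_def f4_def f5_def f6_def f7_def f8_def f9_def f10_def f11_def f12_def
    f13_def f14_def f15_def f16_def f17_def f18_def f19_def f20_def f21_def f22_def f23_def f24_def
    f25_def f26_def f27_def f28_def f29_def f30_def f31_def f32_def f33_def f34_def f35_def f36_def
    f37_def f38_def f39_def f40_def f41_def f42_def f43_def f44_def f45_def f46_def f47_def f48_def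
    f49_def f50_def f51_def f52_def f53_def f54_def f55_def f56_def f57_def f58_def f59_def f60_def
    f61_def f62_def f63_def f64_def f65_def f66_def f67_def f68_def f69_def f70_def f71_def f72_def
    f73_def f74_def f75_def f76_def f77_def f78_def f79_def f80_def f81_def f82_def f83_def f84_def
    f85_def f86_def f87_def f88_def f89_def f90_def f91_def f92_def f93_def f94_def f95_def f96_def
    f97_def f98_def f99_def f100_def f101_def f102_def f103_def f104_def f105_def f106_def f107_def
    f108_def f109_def f110_def f111_def f112_def f113_def f114_def f115_def f116_def f117_def
    f118_def f119_def f120_def f121_def f122_def f123_def f124_def f125_def f126_def f127_def f128_def

text \<open>Simplified once in advance, so that evaluating a tree does not enumerate the windows
  again at every node.\<close>

lemmas family_codes [code] = family_defs [unfolded family_def Let_def, simplified]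

lemma unavoidable_families [simp]:
  "unavoidable f0" "unavoidable f1" "unavoidable f2" "unavoidable f3" "unavoidable f4" "unavoidable f5"
  "unavoidable f6" "unavoidable f7" "unavoidable f8" "unavoidable f9" "unavoidable f10" "unavoidable f11"
  "unavoidable f12" "unavoidable f13" "unavoidable f14" "unavoidable f15" "unavoidable f16" "unavoidable f17"
  "unavoidable f18" "unavoidable f19" "unavoidable f20" "unavoidable f21" "unavoidable f22" "unavoidable f23"
  "unavoidable f24" "unavoidable f25" "unavoidable f26" "unavoidable f27" "unavoidable f28" "unavoidable f29"
  "unavoidable f30" "unavoidable f31" "unavoidable f32" "unavoidable f33" "unavoidable f34" "unavoidable f35"
  "unavoidable f36" "unavoidable f37" "unavoidable f38" "unavoidable f39" "unavoidable f40" "unavoidable f41"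
  "unavoidable f42" "unavoidable f43" "unavoidable f44" "unavoidable f45" "unavoidable f46" "unavoidable f47"
  "unavoidable f48" "unavoidable f49" "unavoidable f50" "unavoidable f51" "unavoidable f52" "unavoidable f53"
  "unavoidable f54" "unavoidable f55" "unavoidable f56" "unavoidable f57" "unavoidable f58" "unavoidable f59"
  "unavoidable f60" "unavoidable f61" "unavoidable f62" "unavoidable f63" "unavoidable f64" "unavoidable f65"
  "unavoidable f66" "unavoidable f67" "unavoidable f68" "unavoidable f69" "unavoidable f70" "unavoidable f71"
  "unavoidable f72" "unavoidable f73" "unavoidable f74" "unavoidable f75" "unavoidable f76" "unavoidable f77"
  "unavoidable f78" "unavoidable f79" "unavoidable f80" "unavoidable f81" "unavoidable f82" "unavoidable f83"
  "unavoidable f84" "unavoidable f85" "unavoidable f86" "unavoidable f87" "unavoidable f88" "unavoidable f89"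
  "unavoidable f90" "unavoidable f91" "unavoidable f92" "unavoidable f93" "unavoidable f94" "unavoidable f95"
  "unavoidable f96" "unavoidable f97" "unavoidable f98" "unavoidable f99" "unavoidable f100" "unavoidable f101"
  "unavoidable f102" "unavoidable f103" "unavoidable f104" "unavoidable f105" "unavoidable f106"
  "unavoidable f107" "unavoidable f108" "unavoidable f109" "unavoidable f110" "unavoidable f111"
  "unavoidable f112" "unavoidable f113" "unavoidable f114" "unavoidable f115" "unavoidable f116"
  "unavoidable f117" "unavoidable f118" "unavoidable f119" "unavoidable f120" "unavoidable f121"
  "unavoidable f122" "unavoidable f123" "unavoidable f124" "unavoidable f125" "unavoidable f126"
  "unavoidable f127" "unavoidable f128"
  by (rule unavoidable_family, rule family_defs, simp_all)+

section \<open>The search tree\<close>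

lemma bad_0: "bad [sq 4112 0 0,(1044464,1048576,1044464,1048576)]"
  by (rule check_bad(1)[of _
    "Nd f0 [KL[0,1],KL[1,0]] [(sq 1 480597 699050,Nd f1 [KL[1,2,0],KL[0,1],KL[0,1,2]] []),
    (sq 1 699050 480597,Nd f2 [KL[0,2,1],KL[1,0],KL[1,0,2]] []),(sq 1 699050 873813,
    Nd f3 [KL[0,1,2],KL[1,2,0]] []),(sq 1 873813 699050,Nd f3 [KL[0,2,1],KL[2,1,0]] [])]"], code_simp, simp)

text \<open>How to read a tree: the two given boxes are numbers 0 and 1. The triangles on their
  joining edge, in both orientations, reject every box of \<open>f4\<close> outside
  \<open>sq 1024 639 1023\<close>. That box becomes number 2, and with it all boxes of
  \<open>f5\<close> are rejected.\<close>

lemma bad_1: "bad [sq 4112 0 0,sq 1 524287 1048575]"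
  by (rule check_bad(1)[of _
    "Nd f4 [KL[1,0],KL[0,1]] [(sq 1024 639 1023,Nd f5 [KL[2,1,0],KL[0,2]] [])]"], code_simp, simp)

text \<open>The third child is larger than the boxes of \<open>f6\<close>, so that several windows
  can share one branch.\<close>

lemma bad_2: "bad [sq 4112 0 0,sq 1 786431 1048575]"
  by (rule check_bad(1)[of _
    "Nd f6 [KL[1,0],KL[0,1]] [(sq 1024 437 341,Nd f7 [KL[1,0,2],KL[0,2,1],KL[1,0]] []),
    ((311296,352256,696320,712704),Nd f8 [KL[1,2,0],KL[0,1]] []),(sq 1024 341 729,
    Nd f9 [KL[1,2,0],KL[0,1],KL[0,1,2]] []),(sq 1024 426 810,Nd f8 [KL[1,2,0],KL[0,1]] []),
    (sq 1024 682 714,Nd f10 [KL[1,0],KF[1,0,2],KL[2,1,0]] [])]"], code_simp, simp)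

lemma bad_3: "bad [sq 4112 0 0,sq 1 917503 1048575]"
  by (rule check_bad(1)[of _
    "Nd f11 [KL[0,1],KL[1,0]] [(sq 1024 490 341,Nd f12 [KL[1,0],KL[0,2,1]] []),
    (sq 1024 682 917,Nd f13 [KL[0,1],KL[1,2,0]] []),(sq 1024 853 810,Nd f3 [KL[1,0],KL[0,2,
    1],KL[2,1,0]] [])]"], code_simp, simp)

lemma bad_4: "bad [sq 4112 0 0,sq 1 983039 1048575]"
  by (rule check_bad(1)[of _
    "Nd f3 [KL[0,1],KL[1,0]] [(sq 1024 170 341,Nd f13 [KL[0,1],KL[1,2,0]] []),
    (sq 1024 341 170,Nd f12 [KL[0,2,1],KL[1,0,2]] []),(sq 1024 341 554,Nd f13 [KL[0,1],KL[1,
    2,0]] []),(sq 1024 554 341,Nd f14 [KL[1,0,2],KL[0,2],KL[0,2,1]] [])]"], code_simp, simp)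

lemma bad_5: "bad [sq 4112 0 0,sq 1 1015807 1048575]"
  by (rule check_bad(1)[of _
    "Nd f3 [KL[0,1],KL[1,0]] [(sq 1024 170 341,Nd f13 [KL[0,1],KL[1,2,0]] []),
    (sq 1024 341 170,Nd f12 [KL[0,2,1],KL[1,0,2]] []),(sq 1024 341 554,Nd f11 [KL[1,2,0],
    KL[0,1],KL[2,0,1]] []),(sq 1024 554 341,Nd f15 [KL[0,2,1],KL[1,0,2]] [])]"], code_simp, simp)

lemma bad_6: "bad [sq 4112 0 0,sq 1 1032191 1048575]"
  by (rule check_bad(1)[of _
    "Nd f3 [KL[0,1],KL[1,0]] [(sq 1024 170 341,Nd f13 [KL[0,1],KL[1,2,0]] []),
    (sq 1024 341 170,Nd f12 [KL[0,2,1],KL[1,0,2]] []),(sq 1024 341 554,Nd f1 [KL[1,2,0],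
    KL[0,1],KL[0,1,2]] []),(sq 1024 554 341,Nd f12 [KL[0,2,1],KL[1,0,2]] [])]"], code_simp, simp)

lemma bad_7: "bad [sq 4112 0 0,sq 1 1040383 1048575]"
  by (rule check_bad(1)[of _
    "Nd f3 [KL[0,1],KL[1,0]] [(sq 1024 170 341,Nd f12 [KL[1,2,0],KL[2,0,1]] []),
    (sq 1024 341 170,Nd f12 [KL[0,2,1],KL[1,0,2]] []),(sq 1024 341 554,Nd f1 [KL[1,2,0],
    KL[0,1],KL[0,1,2]] []),(sq 1024 554 341,Nd f2 [KL[0,2,1],KL[1,0],KL[1,0,2]] [])]"], code_simp, simp)

section \<open>Box 1 against its own rotation: the points (1/2, 0) and (1/2, 1)\<close>

lemma bad_8: "bad [sq 1 524288 0,sq 1 524287 1048575,sq 1024 409 614,sq 1 611669 349525,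
    sq 1 436906 349525,sq 1 412330 699050]"
  by (rule check_bad(1)[of _
    "Nd f16 [KL[0,3,1],KL[1,5,4,0]] [(sq 1 415061 349525,Nd f17 [KL[0,3,1],KL[1,5,6,0],KL[0,
    3,1,5],KL[1,5,6,0,3]] [(sq 1 406186 699050,Nd f18 [KL[0,3,1],KL[3,1,7,6,0],KL[1,7,6,0,
    3]] [(sq 1 411940 299593,Nd f19 [KL[0,3,1],KL[3,1,7,8,0]] []),(sq 1 599186 205970,
    Nd f20 [KL[8,3,1],KL[3,1,7,6,0],KL[0,8,3,1,7,6],KL[1,7,6,0,8,3]] [(sq 1 582217 149796,
    Nd f21 [KL[0,9,8,3,1],KL[3,1,7,6,0,9,8],KL[1,7,6,0,9],KL[0,9,8,3,1,7]] [])])]),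
    (sq 1 576170 699050,Nd f18 [KL[0,3,7,1],KL[3,7,1,5,6,0],KL[0,3,7,1,
    5]] [(sq 1 599186 599186,Nd f19 [KL[0,3,8,1],KL[8,1,5,6,0],KL[3,8,1,5,6,0]] [])])]),
    (sq 1 628053 349525,Nd f22 [KL[1,5,4,0,6],KL[0,1],KL[0,6,1,5],KL[6,1,5,4,
    0]] [(sq 1 412876 419430,Nd f18 [KL[0,6,1],KL[6,1,5,7,0],KL[0,6,1,5],KL[1,5,7,0,6]] []),
    (sq 1 419430 412876,Nd f18 [KL[0,6,1],KL[6,1,5,7,0],KL[0,6,1,5]] [(sq 1 599186 205970,
    Nd f23 [KL[1,5,7,0],KL[0,8,6,1],KL[7,0,8,6,1],KL[0,8,6,1,5],KL[1,5,7,0,8,6]] []),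
    (sq 1 599186 599186,Nd f24 [KL[0,6,8,1],KL[6,8,1,5,7,0],KL[1,5,7,0,6],KL[7,0,6,8,1,
    5]] [])]),((419008,419456,419008,419456),Nd f25 [KL[0,6,1],KL[6,1,5,7,0],KL[1,5,7,0,6],
    KL[0,6,1,5]] [(sq 1 599186 209481,Nd f23 [KL[1,5,7,0],KL[0,8,6,1],KL[7,0,8,6,1],KL[0,8,
    6,1,5]] [(sq 1 578901 699050,Nd f26 [KL[5,7,0],KL[5,7,0,8,6,9,1],KL[1,5,7,0],KL[8,6,9,
    1],KL[1,5,7,0,8,6]] [(sq 1 449389 292571,Nd f27 [KL[0,1],KF[10,8,6,9,1,5,7]] [])])]),
    (sq 1 411940 411940,Nd f28 [KL[0,6,1],KL[6,1,5,8,0],KL[0,6,1,5],KL[1,5,8,0,6]] [])])]),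
    (sq 1 611669 611669,Nd f29 [KL[0,3,6,1],KL[6,1,5,4,0],KL[3,6,1,5,4,0],KL[1,5,4,0,3],
    KL[0,3,6,1,5,4]] [])]"], code_simp, simp)

text \<open>Many coordinates are fractions of \<open>2^20\<close> rounded down: 349525 and 699050
  are thirds, 449389 and 599186 are 3/7 and 4/7, 419430 and 629145 are 2/5 and 3/5. These belong to
  the periodic orbits to which the families are homoclinic.\<close>

lemma bad_9: "bad [sq 1 524288 0,sq 1 524287 1048575,sq 1024 409 614,sq 1 611669 349525,
    sq 1 633514 349525,sq 1 415061 699050]"
  by (rule check_bad(1)[of _
    "Nd f22 [KL[1,5,2,0,4],KL[0,4,1,5]] [(sq 1 629145 209715,Nd f30 [KL[1,5,2,0,6],KL[0,6,4,
    1,5],KL[5,2,0,6,4,1]] [(sq 1024 435 409,Nd f31 [KL[1,5,2,7,0,6],KL[0,6,4,1,5],KL[2,7,0,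
    6,4,1]] [(sq 1 445644 367001,Nd f32 [KL[0,6,4,1,5],KL[1,5,2,8,0,6]] [])])]),
    (sq 1 419430 412876,Nd f18 [KL[0,4,1],KL[4,1,5,6,0],KL[0,4,1,5],KL[1,5,6,0,4]] []),
    ((419008,419456,419008,419456),Nd f18 [KL[0,4,1],KL[4,1,5,6,0],KL[0,4,1,5],KL[1,5,6,0,
    4]] []),(sq 1 602931 629145,Nd f33 [KL[1,5,2,0,4],KL[0,4,6,1,5]] [(sq 1 445644 419430,
    Nd f34 [KL[1,5,2,7,0,4],KL[0,4,6,1,5],KL[0,4,6,1]] [(sq 1 439091 419430,Nd f35 [KL[0,4,
    6,1],KL[4,6,1,5,2,8,0],KL[1,5,2,8,0,4],KL[8,0,4,6,1],KL[0,4,6,1,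
    5]] [(sq 1 599186 222354,Nd f36 [KL[0,9,4,6,1,5],KL[1,5,2,8,0,9],KF[4,1,5,2,8,0,9],KL[6,
    1,5,2,8,0]] [(sq 1 412876 629145,Nd f37 [KL[1,5,10,8,0],KL[10,8,0,9,4,6,1],KL[6,1,5,10,
    8,0],KL[0,9,4,6,1,5,10],KL[1,5,10,8,0,9,4]] [(sq 1 449389 826221,Nd f31 [KL[1,11,5,10,8,
    0,9],KL[0,9,4,6,1,11,5],KL[8,0,9,4,6,1],KL[0,9,4,6,1,11,5,10],KL[6,1,11,5,10,8,0,9,
    4]] [])])])]),(sq 1 419430 734003,Nd f38 [KL[0,4,6,1,8],KL[1,0],KL[1,8,5,2,7,0,4],KL[1,
    8,5,2,7,0]] [(sq 1 629145 314572,Nd f31 [KL[1,8,5,2,7,0,9],KL[0,9,4,6,1,8],KL[2,7,0,9,4,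
    6,1],KL[0,9,4,6,1,8,5]] [(sq 1 445644 367001,Nd f36 [KL[0,9,4,6,1,8],KL[1,8,5,2,10,0,9],
    KL[10,0,9,4,6,1,8],KL[6,1,8,5,2,10,0]] []),(sq 1 635699 419430,Nd f36 [KL[0,9,4,10,6,1,
    8],KL[1,0],KL[1,8,5,2,7,0,9],KL[1,8,5,2,7,0,9,4,10],KL[10,6,1,8,5,2,7,
    0]] [(sq 1 412876 629145,Nd f24 [KL[0,9,4,10,6,1],KL[10,6,1,8,5,11,7,0],KL[1,8,5,11,7,0,
    9,4,10]] [(sq 1 599186 215332,Nd f39 [KL[1,8,5,11,7,0],KL[11,7,0,12,9,4,10,6,1],KL[1,8,
    5,11,7,0,12,9,4],KL[0,12,9,4,10,6,1,8,5,11]] [(sq 1 449389 833243,Nd f40 [KL[1,13,8,5,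
    11,7,0],KL[0,12,9,4,10,6,1],KL[11,7,0,12,9,4,10,6,1],KL[0,12,9,4,10,6,1,13,8],KL[10,6,1,
    13,8,5,11,7,0,12,9]] [])]),(sq 1 411940 599186,Nd f39 [KF[0,1,8,5,11,7],KF[1,12,7,0,9,4,
    10,6],KL[0,9,4,10,6,1,8,5,11],KL[1,8,5,11,12,7,0,9,4],KL[8,5,11,12,7,0,9,4,10,6,
    1]] [])])])]),(sq 1 609484 629145,Nd f31 [KL[0,4,9,1,8],KL[1,8,5,2,7,0,4],KL[7,0,4,9,1],
    KL[0,4,9,1,8,5]] [(sq 1 635699 419430,Nd f41 [KL[0,4,10,9,1],KL[10,9,1,8,5,2,7,0],KL[0,
    4,10,9,1,8],KL[5,2,7,0,4,10,9,1]] [(sq 1 599186 219428,Nd f27 [KL[0,1],KL[5,2,7,0,11,4,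
    10,9,1,8]] []),(sq 1 599186 706852,Nd f27 [KL[0,1],KF[7,4,10,9,11,1,8,5,2]] [])])])])]),
    (sq 1 419430 838860,Nd f36 [KL[0,4,6,1,7],KL[1,7,5,2,0,4],KL[6,1,7,5,2,0]] [])]),
    (sq 1 629145 602931,Nd f42 [KL[1,5,2,0],KL[2,0,4,6,1],KL[0,4,6,1,5],KL[1,5,2,0,4],KL[5,
    2,0,4,6,1]] []),(sq 1 627507 629145,Nd f27 [KL[0,1],KL[5,2,0,4,6,1]] [])]"], code_simp, simp)

text \<open>The two branches marked \<open>Cut\<close> are \<open>bad_8\<close> and
  \<open>bad_9\<close>, whose box lists are the paths to these branches. The other cut branches
  below are separated in the same way, to be evaluated on their own.\<close>

lemma bad_10: "bad [sq 1 524288 0,sq 1 524287 1048575,sq 1024 409 614,sq 1 611669 349525]"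
  by (rule check_bad(1)[of _
    "Nd f43 [KL[0,3,1],KL[1,2,0]] [(sq 1 436906 349525,Nd f44 [KL[0,3,1],KL[1,2,4,0],KL[4,0,
    3,1]] [(sq 1 611669 218453,Nd f45 [KL[1,2,4,0],KL[0,5,3,1],KL[1,2,4,0,
    5]] [(sq 1024 405 682,Nd f46 [KL[0,5,3,1],KL[1,6,2,4,0],KL[1,6,2,4,0,
    5]] [(sq 1024 405 341,Nd f17 [KL[0,5,3,1],KL[1,6,7,0],KL[1,6,7,0,5,3],KL[7,0,5,3,1],
    KL[0,5,3,1,6]] []),(sq 1024 613 341,Nd f47 [KL[1,6,2,4,0,5],KL[0,5,7,1,6],KF[0,7,1,6,2,
    4],KL[1,6,2,4,0,5,7]] [(sq 1 419430 416051,Nd f23 [KL[1,6,8,0],KL[0,5,7,1],KL[8,0,5,7,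
    1],KL[0,5,7,1,6],KL[1,6,8,0,5,7]] []),((419008,419456,419200,419456),Nd f23 [KL[1,6,8,
    0],KL[0,5,7,1],KL[8,0,5,7,1],KL[0,5,7,1,6]] [(sq 1 578901 699050,Nd f27 [KL[0,1],KL[5,7,
    9,1,6,8]] [])])])])]),(sq 1 412330 699050,Cut),(sq 1 600746 699050,Nd f45 [KL[1,2,4,0],
    KL[0,3,5,1]] [(sq 1024 405 682,Nd f16 [KL[0,3,5,1],KL[1,6,2,4,0],KL[0,3,5,1,6],KL[5,1,6,
    2,4,0]] [(sq 1 611669 611669,Nd f29 [KL[0,3,7,5,1],KL[3,7,5,1,6,2,4,0],KL[1,6,2,4,0,3,
    7],KL[0,3,7,5,1,6,2,4]] [])]),(sq 1024 597 682,Nd f48 [KL[1,2,4,0],KL[2,4,0,3,6,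
    1]] [(sq 1 449389 243419,Nd f49 [KL[6,1,2,4,7,0],KF[1,2,4,7,0,3,6],KL[3,6,1,2,4,7,0],
    KL[0,3,6,1,2],KL[1,2,4,7,0,3]] []),(sq 1 449389 816859,Nd f29 [KL[0,3,6,1],KL[6,1,7,2,4,
    0],KL[3,6,1,7,2,4,0],KL[0,3,6,1,7,2,4],KL[1,7,2,4,0,3,6]] []),(sq 1 465773 898779,
    Nd f19 [KL[0,3,6,1],KL[6,1,7,2,4,0],KL[3,6,1,7,2,4,0]] []),(sq 1 580461 898779,
    Nd f49 [KL[6,7,1,2,4,0],KL[2,4,0,3,6,7,1],KL[3,6,7,1,2,4,0],KL[0,3,6,7,1,2],KL[1,2,4,0,
    3,6]] [])])])]),(sq 1 633514 349525,Nd f50 [KL[1,2,0],KL[0,4,1]] [(sq 1 415061 699050,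
    Cut),(sq 1 611669 699050,Nd f51 [KL[1,2,0],KL[0,4,5,1],KL[1,2,0,4]] [(sq 1024 426 426,
    Nd f48 [KL[1,2,6,0],KF[1,6,0,4,5],KL[2,6,0,4,5,1],KL[0,4,5,1,2],KL[1,2,6,0,4,5]] []),
    (sq 1024 410 682,Nd f34 [KL[0,4,5,1,6],KL[1,0],KL[1,6,2,0,4]] [(sq 1 419430 734003,
    Nd f33 [KL[1,7,2,0,4],KL[0,4,5,1,7],KL[2,0,4,5,1]] []),((628736,629760,628736,634880),
    Nd f48 [KL[1,6,2,0],KF[1,2,0,4,7],KL[0,4,7,1,6],KL[1,6,2,0,4,7],KF[1,6,2,0,4,
    7]] [])])])])]"], code_simp, simp add: bad_8 bad_9)

lemma bad_11: "bad [sq 1 524288 0,sq 1 524287 1048575,sq 1024 614 665,sq 1 436906 699050]"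
  by (rule check_bad(1)[of _
    "Nd f43 [KL[0,2,1],KL[1,3,0],KL[2,1,3,0]] [(sq 1 436906 349525,Nd f52 [KL[0,2,1],KL[1,3,
    4,0]] [(sq 1 611669 349525,Nd f49 [KL[4,0,5,2,1],KL[2,1,3,4,0],KL[5,2,1,3,4,0],KF[1,3,4,
    0,5,2],KL[0,5,2,1,3],KL[1,3,4,0,5,2]] [])]),(sq 1 633514 349525,Nd f53 [KL[1,3,0],KL[0,
    4,2,1],KL[0,4,2,1,3]] [(sq 1 420522 699050,Nd f54 [KL[1,5,0],KL[5,0,4,2,1],KL[1,5,0,4],
    KL[0,4,2,1,5]] []),(sq 1 633514 699050,Nd f54 [KL[1,3,0],KL[0,4,5,
    1]] [(sq 1 449389 449389,Nd f48 [KL[1,3,6,0],KL[6,0,4,5,1],KL[3,6,0,4,5,1],KL[0,4,5,1,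
    3],KL[1,3,6,0,4,5]] []),(sq 1 449389 842605,Nd f55 [KL[0,4,5,1],KL[1,6,3,0],KL[0,4,5,1,
    6],KL[1,6,3,0,4]] [(sq 1 472405 349525,Nd f40 [KL[0,4,5,1],KL[1,6,3,7,0],KL[0,4,5,1,6],
    KL[3,7,0,4,5,1],KL[5,1,6,3,7,0]] []),(sq 1 642389 349525,Nd f56 [KL[6,3,0],KL[3,0,7,5,
    1],KL[0,7,5,1,6,3],KL[1,6,3,0,7,5]] [(sq 1 466358 898779,Nd f57 [KL[1,8,6,3,0],KL[3,0,7,
    5,1,8,6],KL[0,7,5,1,8],KL[1,8,6,3,0,7]] [])])]),((445440,449536,890880,899072),
    Nd f55 [KL[0,4,5,1],KL[1,6,3,0],KL[0,4,5,1,6,3],KL[5,1,6,3,0],KL[1,6,3,0,4]] []),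
    (sq 1 636635 748982,Nd f58 [KL[1,3,0],KL[3,0,4,6,1],KL[1,3,0,4],KL[0,4,6,1,
    3]] [(sq 1 472795 898779,Nd f55 [KL[0,4,6,1],KL[1,7,3,0],KL[0,4,6,1,7,3],KL[6,1,7,3,0],
    KL[1,7,3,0,4]] [])])])])]"], code_simp, simp)

lemma bad_12: "bad [sq 1 524288 0,sq 1 524287 1048575,sq 1024 409 422,sq 1 611669 349525,
    sq 1024 426 682]"
  by (rule check_bad(1)[of _
    "Nd f50 [KL[1,4,2,0],KL[0,3,1],KL[2,0,3,1]] [(sq 1 415061 699050,Nd f16 [KL[0,3,1],KL[1,
    5,2,0]] [(sq 1 415061 349525,Nd f23 [KL[0,3,1],KL[1,5,6,0]] [(sq 1 436906 218453,
    Nd f28 [KL[0,3,1],KL[3,1,5,6,7,0],KL[0,3,1,5],KL[1,5,6,7,0,3]] [(sq 1 575780 149796,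
    Nd f17 [KL[0,8,3,1],KL[1,5,6,7],KL[1,5,6,7,0,8,3],KL[0,8,3,1,5],KL[6,7,0,8,3,1]] [])]),
    (sq 1 406869 699050,Nd f18 [KL[0,3,1],KL[3,1,7,6,0],KL[1,7,6,0,3]] [(sq 1 411940 299593,
    Nd f19 [KL[0,3,1],KL[3,1,7,8,0]] []),(sq 1 599186 205970,Nd f17 [KL[0,8,3,1],KL[1,7,6,
    0],KL[1,7,6,0,8,3],KL[0,8,3,1,7]] [(sq 1 406186 699050,Nd f20 [KL[8,3,1],KL[3,1,9,6,0],
    KL[0,8,3,1,9,6],KL[1,9,6,0,8,3]] [(sq 1 582217 149796,Nd f21 [KL[0,10,8,3,1],KL[3,1,9,6,
    0,10,8],KL[1,9,6,0,10],KL[0,10,8,3,1,9]] [])])])]),(sq 1 578901 699050,Nd f18 [KL[0,3,7,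
    1],KL[3,7,1,5,6,0],KL[0,3,7,1,5]] [(sq 1 599186 599186,Nd f29 [KL[0,3,8,1],KL[8,1,5,6,
    0],KL[3,8,1,5,6,0],KL[1,5,6,0,3],KL[0,3,8,1,5,6]] [])])]),(sq 1 628053 349525,
    Nd f25 [KL[0,6,1],KF[0,6,1,5,2],KL[0,6,1,5],KL[1,5,2,0,6]] [(sq 1 599186 157257,
    Nd f22 [KL[0,7,6,1,5],KL[1,5,2,0,7],KL[6,1,5,2,0],KL[1,5,2,0,7,6]] []),
    (sq 1 599186 209481,Nd f22 [KL[1,5,2,0,7],KL[0,1],KL[0,7,6,1,5],KL[6,1,5,2,0],KL[1,5,2,
    0,7,6]] [(sq 1 419430 412876,Nd f23 [KL[1,5,8,0],KL[0,7,6,1],KL[8,0,7,6,1],KL[0,7,6,1,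
    5]] [(sq 1 578901 699050,Nd f44 [KL[1,5,8,0],KL[0,7,6,9,1],KL[8,0,7,6,9,1],KL[6,9,1,5,8,
    0],KL[1,5,8,0,7,6]] [])]),((419008,419456,419008,419456),Nd f23 [KL[1,5,8,0],KL[0,7,6,
    1],KL[8,0,7,6,1],KL[0,7,6,1,5]] [(sq 1 578901 699050,Nd f44 [KL[1,5,8,0],KL[0,7,6,9,1],
    KL[6,9,1,5,8,0],KL[1,5,8,0,7,6]] [(sq 1 412330 699050,Nd f26 [KL[10,8,0],KL[10,8,0,7,6,
    9,1],KL[1,10,8,0],KL[7,6,9,1],KL[1,10,8,0,7,6]] [(sq 1 449389 292571,Nd f27 [KL[0,1],
    KF[11,7,6,9,1,10,8]] [])])])])]),(sq 1 411940 411940,Nd f18 [KL[0,6,1],KL[6,1,5,7,0],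
    KL[0,6,1,5],KL[1,5,7,0,6]] []),(sq 1 599186 627273,Nd f29 [KL[0,6,7,1],KL[6,7,1,5,2,0],
    KL[1,5,2,0,6],KL[0,6,7,1,5,2]] [])]),(sq 1 611669 611669,Nd f29 [KL[0,3,6,1],KL[6,1,5,2,
    0],KL[3,6,1,5,2,0],KL[1,5,2,0,3],KL[0,3,6,1,5,2]] [])]),(sq 1 611669 699050,
    Nd f48 [KL[1,4,2,0],KL[2,0,3,5,1]] [(sq 1 449389 243419,Nd f49 [KL[2,6,0,3,5,1],KL[5,1,
    4,2,6,0],KL[3,5,1,4,2,6,0],KF[1,4,2,6,0,3,5],KL[0,3,5,1,4,2],KL[1,4,2,6,0,3]] []),
    (sq 1 449389 816859,Nd f43 [KL[0,3,5,1],KL[1,6,4,2,0],KL[5,1,6,4,2,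
    0]] [(sq 1 436906 349525,Nd f29 [KL[0,3,5,1],KL[3,5,1,6,4,2,7,0],KL[0,3,5,1,6,4,2],KL[1,
    6,4,2,7,0,3,5]] [])]),(sq 1 465773 898779,Nd f29 [KL[0,3,5,1],KL[5,1,6,4,2,0],KL[3,5,1,
    6,4,2,0],KL[0,3,5,1,6,4,2],KL[1,6,4,2,0,3,5]] []),(sq 1 580461 898779,Nd f49 [KL[2,0,3,
    5,6,1],KL[5,6,1,4,2,0],KL[3,5,6,1,4,2,0],KF[1,4,2,0,3,5,6],KL[1,4,2,0,3,5],KL[0,3,5,6,1,
    4,2]] [])])]"], code_simp, simp)

lemma bad_13: "bad [sq 1 524288 0,sq 1 524287 1048575,sq 1024 601 614,sq 1 436906 699050,
    sq 1 436906 349525,sq 1 611669 349525,sq 1 611669 699050,sq 1 449389 243419]"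
  by (rule check_bad(1)[of _
    "Nd f49 [KF[0,2,6,1,3,4,7],KL[3,4,7,0,5,2,6,1],KL[1,3,4,7,0,5,2],KL[5,2,6,1,3,4,7,
    0]] [(sq 1 449389 149796,Nd f59 [KL[1,3,4,8],KL[3,4,8,0,5,2,6,1],KL[1,3,4,8,0]] []),
    (sq 1 580461 149796,Nd f32 [KL[1,3,4,7,0,8,5],KL[0,1],KL[7,0,8,5,2,6,1,3],KL[6,1,3,4,7,
    0,8]] [(sq 1 432537 419430,Nd f59 [KL[1,3,9,4,7,0],KL[4,7,0,8,5,2,6,1],KL[3,9,4,7,0,8,5,
    2,6,1]] [])]),(sq 1 599186 243419,Nd f32 [KL[1,3,4,7,0,8,5],KL[0,1],KL[7,0,8,5,2,6,1,3],
    KL[6,1,3,4,7,0,8,5]] [(sq 1 432537 419430,Nd f59 [KL[1,3,9,4,7,0],KL[4,7,0,8,5,2,6,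
    1]] [(sq 1 449389 767707,Nd f29 [KL[8,5,2,6,1],KL[6,1,10,3,9,4,7,0],KL[5,2,6,1,10,3,9,4,
    7,0],KL[0,8,5,2,6,1,10,3,9,4],KL[1,10,3,9,4,7,0,8,5,2]] []),(sq 1 482157 898779,
    Nd f29 [KL[8,5,2,6,1],KL[6,1,10,3,9,4,7,0],KL[5,2,6,1,10,3,9,4,7,0],KL[0,8,5,2,6,1,10,3,
    9,4],KL[1,10,3,9,4,7,0,8,5,2]] [])])]),(sq 1 449389 805156,Nd f29 [KL[0,5,2,6,1],KL[6,1,
    8,3,4,7,0],KL[5,2,6,1,8,3,4,7,0],KL[1,8,3,4,7,0,5,2]] [(sq 1 468114 149796,Nd f19 [KL[0,
    5,2,6,1],KL[6,1,8,3,4,7,9,0],KL[5,2,6,1,8,3,4,7,9,0]] [])]),(sq 1 468114 898779,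
    Nd f29 [KL[0,5,2,6,1],KL[6,1,8,3,4,7,0],KL[5,2,6,1,8,3,4,7,0],KL[1,8,3,4,7,0,5,
    2]] [(sq 1 468114 149796,Nd f27 [KL[0,1],KL[5,2,6,1,8,3,4,7,9]] [])])]"], code_simp, simp)

lemma bad_14: "bad [sq 1 524288 0,sq 1 524287 1048575,sq 1024 601 614,sq 1 436906 699050,
    sq 1 633514 349525,sq 1 611669 699050]"
  by (rule check_bad(1)[of _
    "Nd f53 [KL[1,3,0],KL[0,4,5,1]] [(sq 1 436906 436906,Nd f48 [KL[1,3,6,0],KL[6,0,4,5,1],
    KL[0,4,5,1,3]] [(sq 1 449389 816859,Nd f40 [KL[0,4,5,1],KL[1,7,3,6,0],KL[6,0,4,5,1],
    KL[5,1,7,3,6,0],KL[0,4,5,1,7,3,6]] []),(sq 1 465773 898779,Nd f29 [KL[4,5,1],KL[4,5,1,7,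
    3,6,0],KL[0,4,5,1,7,3],KL[1,7,3,6,0,4]] []),(sq 1 580461 898779,Nd f59 [KL[1,3,6,0],
    KL[6,0,4,5,7,1],KL[3,6,0,4,5,7,1]] [])]),(sq 1 420522 699050,Nd f54 [KL[1,6,0],KL[6,0,4,
    5,1],KL[1,6,0,4]] [(sq 1 449389 449389,Nd f34 [KL[0,4,5,1,6],KL[1,0],KL[1,6,7,0,
    4]] [(sq 1 419430 734003,Nd f33 [KL[1,8,6,7,0,4],KL[0,4,5,1,8],KL[7,0,4,5,1]] []),
    ((628736,629760,628736,634880),Nd f60 [KL[1,6,7,0],KF[1,6,7,0,4,8],KL[0,4,8,1,6],KF[0,8,
    1,6,7],KL[1,6,7,0,4,8]] [])]),(sq 1 449389 842605,Nd f33 [KL[0,4,5,1,7],KL[1,0],KL[1,7,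
    6,0,4],KL[6,0,4,5,1],KL[0,4,5,1,7,6]] [(sq 1 629145 635699,Nd f61 [KL[0,4,8,1],KL[1,7,6,
    0],KL[8,1,7,6,0],KL[1,7,6,0,4]] [(sq 1 469674 349525,Nd f40 [KL[0,4,8,1],KL[1,7,6,9,0],
    KL[6,9,0,4,8,1],KL[0,4,8,1,7,6],KL[8,1,7,6,9,0]] [])]),((629120,629184,629120,629568),
    Nd f61 [KL[0,4,8,1],KL[1,7,6,0],KL[8,1,7,6,0],KL[1,7,6,0,4]] [(sq 1 469674 349525,
    Nd f40 [KL[0,4,8,1],KL[1,7,6,9,0],KL[6,9,0,4,8,1],KL[0,4,8,1,7,6]] [(sq 1 636245 349525,
    Nd f62 [KL[10,8,1],KL[10,8,1,7,6,9,0],KL[0,10,8,1],KL[1,7,6,9,0,10,8],KL[0,10,8,1,7,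
    6]] [])])]),(sq 1 629555 629145,Nd f61 [KL[0,4,8,1],KL[1,7,6,0],KL[8,1,7,6,0],KL[1,7,6,
    0,4]] [(sq 1 469674 349525,Nd f40 [KL[0,4,8,1],KL[1,7,6,9,0],KL[6,9,0,4,8,1],KL[0,4,8,1,
    7,6],KL[8,1,7,6,9,0]] [])])]),((445440,449536,890880,899072),Nd f33 [KL[1,7,6,0,4],KL[0,
    4,5,1,7],KL[6,0,4,5,1],KL[0,4,5,1,7,6]] [])]),(sq 1 633514 699050,Nd f61 [KL[1,3,0],
    KL[0,4,6,1]] [(sq 1 469674 349525,Nd f54 [KL[1,3,7,0],KL[3,7,0,4,6,1],KL[1,3,7,0,
    4]] [(sq 1 449389 449389,Nd f48 [KL[1,3,8,0],KL[8,0,4,6,1],KL[3,8,0,4,6,1],KL[0,4,6,1,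
    3],KL[1,3,8,0,4,6]] [])]),(sq 1 641706 349525,Nd f54 [KL[1,3,0],KL[3,0,7,6,1],KL[0,7,6,
    1,3]] [(sq 1 449389 842605,Nd f55 [KL[0,7,6,1],KL[1,8,3,0],KL[0,7,6,1,8,3],KL[1,8,3,0,
    7]] [(sq 1 642389 349525,Nd f56 [KL[8,3,0],KL[3,0,9,6,1],KL[0,9,6,1,8,3],KL[1,8,3,0,9,
    6]] [(sq 1 466358 898779,Nd f57 [KL[1,10,8,3,0],KL[3,0,9,6,1,10,8],KL[0,9,6,1,10],KL[1,
    10,8,3,0,9]] [])])]),(sq 1 636635 748982,Nd f59 [KL[1,3,0],KL[3,0,7,8,1]] [])]),
    (sq 1 611669 830122,Nd f58 [KL[1,3,0],KL[3,0,4,6,7,1],KL[1,3,0,4],KL[0,4,6,7,1,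
    3]] [(sq 1 472795 898779,Nd f55 [KL[0,4,6,7],KL[1,8,3,0],KL[0,4,6,7,1,8,3],KL[1,8,3,0,
    4],KL[6,7,1,8,3,0]] [])])])]"], code_simp, simp)

lemma bad_15: "bad [sq 1 524288 0,sq 1 524287 1048575,sq 1024 601 614,sq 1 436906 699050,
    sq 1 436906 349525]"
  by (rule check_bad(1)[of _
    "Nd f52 [KL[0,2,1],KL[1,3,4,0]] [(sq 1 611669 349525,Nd f50 [KL[1,3,4,0],KL[0,5,2,
    1]] [(sq 1 415061 699050,Nd f29 [KL[0,5,2,1],KL[2,1,6,4,0],KL[5,2,1,6,4,0],KL[1,6,4,0,
    5],KL[0,5,2,1,6,4]] []),(sq 1 611669 699050,Nd f48 [KL[1,3,4,0],KL[0,
    1]] [(sq 1 449389 243419,Cut),(sq 1 449389 816859,Nd f29 [KL[0,5,2,6,1],KF[0,2,6,1,7,3,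
    4]] [(sq 1 468114 149796,Nd f19 [KL[0,5,2,6,1],KL[6,1,7,3,4,8,0],KL[5,2,6,1,7,3,4,8,
    0]] []),(sq 1 582802 149796,Nd f32 [KL[1,7,3,4,0,8,5],KL[0,8,5,2,6,1,7],KL[6,1,7,3,4,0,
    8],KL[4,0,8,5,2,6,1,7,3]] []),(sq 1 599186 231716,Nd f32 [KL[1,7,3,4,0,8],KL[0,8,5,2,6,
    1,7],KL[6,1,7,3,4,0,8]] [(sq 1 432537 419430,Nd f26 [KL[7,3,9,4,0],KL[9,4,0,8,5,2,6,1],
    KL[6,1,7,3,9,4,0],KL[3,9,4,0,8,5,2,6,1],KF[6,1,7,3,9,4,0,8,5,2]] [(sq 1 449389 292571,
    Nd f27 [KL[0,1],KL[5,2,6,1,7,3,9,4,10,0,8]] []),(sq 1 449389 823003,Nd f27 [KL[0,1],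
    KL[5,2,6,1,10,3,9,4,0,8]] [])])]),(sq 1 599186 805156,Nd f32 [KL[8,1,7,3,4,0,5],KL[0,5,
    2,6,8,1,7]] [(sq 1 432537 419430,Nd f19 [KL[0,5,2,6,8,1],KL[6,8,1,7,3,9,4,0],KL[5,2,6,8,
    1,7,3,9,4,0]] [])])]),(sq 1 580461 898779,Nd f49 [KF[0,2,6,7,1,3,4],KL[4,0,5,2,6,7,1],
    KL[0,5,2,6,7,1,3],KL[3,4,0,5,2,6,7,1]] [(sq 1 580461 149796,Nd f59 [KL[1,3,4,0],KL[3,4,
    0,8,5,2,6,7,1]] []),(sq 1 599186 243419,Nd f32 [KL[7,1,3,4,0,8],KL[0,1],KL[0,8,5,2,6,7,
    1,3],KL[6,7,1,3,4,0,8]] [(sq 1 432537 419430,Nd f59 [KL[1,3,9,4,0],KL[4,0,8,5,2,6,7,1],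
    KL[3,9,4,0,8,5,2,6,7,1]] [])]),(sq 1 449389 805156,Nd f32 [KL[7,1,8,3,4,0,5],KL[0,5,2,6,
    7,1,8],KL[6,7,1,8,3,4,0]] [(sq 1 432537 419430,Nd f19 [KL[0,5,2,6,7],KL[6,7,1,8,3,9,4,
    0],KL[0,5,2,6,7,1],KL[5,2,6,7,1,8,3,9,4,0]] [])]),(sq 1 468114 898779,Nd f19 [KL[0,5,2,
    6,7],KL[6,7,1,8,3,4,0],KL[5,2,6,7,1,8,3,4,0],KL[0,5,2,6,7,1]] []),(sq 1 599186 898779,
    Nd f59 [KL[1,3,4,0],KL[4,0,5,2,6,8,1],KL[3,4,0,5,2,6,8,1]] [])]),((448512,452608,886784,
    899072),Nd f29 [KL[0,5,2,6,1],KL[6,1,7,3,4,0],KL[5,2,6,1,7,3,4,0],KL[1,7,3,4,0,5,2],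
    KL[0,5,2,6,1,7,3,4]] []),(sq 1 465773 898779,Nd f29 [KL[0,5,2,6,1],KL[2,6,1,7,3,4,0],
    KL[5,2,6,1,7,3,4,0]] [(sq 1 468114 149796,Nd f27 [KL[0,1],KL[5,2,6,1,7,3,4,8]] []),
    (sq 1 599186 231716,Nd f32 [KL[1,7,3,4,0,8],KL[0,1],KL[0,8,5,2,6,1,7],KL[4,0,8,5,2,6,1,
    7,3],KL[6,1,7,3,4,0,8]] []),(sq 1 599186 805156,Nd f19 [KL[0,5,2,6,8,1],KL[6,8,1,7,3,4,
    0],KL[5,2,6,8,1,7,3,4,0]] [])])])])]"], code_simp, simp add: bad_13)

lemma bad_16: "bad [sq 1 524288 0,sq 1 524287 1048575,sq 1024 601 614,sq 1 699050 699050]"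
  by (rule check_bad(1)[of _
    "Nd f63 [KL[1,0],KL[0,3,1]] [(sq 1024 443 877,Nd f64 [KL[1,4,0],KL[0,3,1]] []),
    (sq 1024 475 877,Nd f65 [KL[1,4,0],KL[0,3,1]] [(sq 1024 694 731,Nd f0 [KL[3,1,4,0],KL[0,
    5],KL[0,3,1]] [(sq 1 480597 699050,Nd f13 [KL[0,5],KL[5,1,4,6,0],KL[0,3,1]] []),
    (sq 1 699050 873813,Nd f59 [KL[1,4,0],KL[0,3,6,1],KL[1,4,0,3],KF[1,0,3,5,6]] [])])]),
    (sq 1024 731 877,Nd f66 [KL[4,1,0],KL[0,4],KL[1,0,4]] [(sq 1024 502 877,Nd f13 [KL[0,4],
    KL[4,1,5,0],KL[0,4,1]] [])]),((745472,753664,745472,770048),Nd f67 [KL[1,0],KL[1,0,4],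
    KL[0,4,1]] [(sq 1024 750 750,Nd f0 [KL[5,1,0],KL[0,4],KL[1,0,5],KL[0,5,1]] [])]),
    (sq 1024 749 731,Nd f0 [KL[4,1,0],KL[0,4],KL[1,0,4],KL[0,4,1]] [])]"], code_simp, simp)

lemma bad_17: "bad [sq 1 524288 0,sq 1 524287 1048575,(627712,629760,628736,632832),
    sq 1 436906 699050,sq 1024 618 341,sq 1 469674 349525,sq 1 449389 842605]"
  by (rule check_bad(1)[of _
    "Nd f40 [KL[0,4,2,1],KL[1,6,3,5,0],KL[0,4,2,1,6,3]] [(sq 1 636245 349525,Nd f62 [KL[7,2,
    1],KL[7,2,1,6,3,5,0],KL[0,7,2,1],KL[6,3,5,0]] [(sq 1 484498 149796,Nd f53 [KL[1,6,3,8,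
    0],KL[0,7,2,1],KL[8,0,7,2,1,6],KL[1,6,3,8,0,7]] []),((583680,600064,149504,159744),
    Nd f53 [KL[1,6,3,5,0],KL[0,8,7,2,1],KL[0,8,7,2,1,6],KL[5,0,8,7,2,1,6],KF[7,1,6,3,5,0,
    8]] []),(sq 1 599186 225572,Nd f33 [KL[0,8,7,2,1,6],KL[1,0],KL[1,6,3,5,0,8,7],KL[5,0,8,
    7,2,1],KL[0,8,7,2,1,6,3]] [((628736,635904,628736,635904),Nd f53 [KL[1,6,3,5,0],KL[0,8,
    7,9,1],KL[0,8,7,9,1,6],KL[1,6,3,5,0,8,7]] [(sq 1 420522 699050,Nd f27 [KL[0,1],KL[7,9,1,
    6,10,5,0,8]] [])])]),(sq 1 599186 756004,Nd f29 [KL[7,2,8,1],KL[7,2,8,1,6,3,5,0],KL[0,7,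
    2,8,1,6,3]] [(sq 1 582802 149796,Nd f53 [KL[1,6,3,5,0],KL[0,9,7,2,8,1],KL[0,9,7,2,8,1,
    6],KL[1,6,3,5,0,9,7]] []),(sq 1 599186 231716,Nd f53 [KL[1,6,3,5,0],KL[0,9,7,2,8,1],
    KL[0,9,7,2,8,1,6],KL[1,6,3,5,0,9,7]] [(sq 1 420522 699050,Nd f27 [KL[0,1],KL[7,2,8,1,6,
    10,5,0,9]] [])]),(sq 1 599186 805156,Nd f53 [KL[1,6,3,5,0],KF[9,0,7,2],KL[0,7,2,9,1,6],
    KL[1,6,3,5,0,7]] [])])]),(sq 1 436906 830122,Nd f29 [KL[4,2,1],KF[0,4,2,1,7,3,5],KL[0,4,
    2,1,7]] [((581632,602112,147456,163840),Nd f53 [KL[1,7,3,5,0],KL[0,8,4,2,1],KL[5,0,8,4,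
    2,1,7],KF[4,1,7,3,5,0,8]] []),(sq 1 599186 231716,Nd f53 [KL[1,7,3,5,0],KL[0,8,4,2,1],
    KL[5,0,8,4,2,1,7],KL[1,7,3,5,0,8,4]] []),(sq 1 599186 805156,Nd f53 [KL[1,7,3,5,0],KF[8,
    0,4,2],KL[0,4,2,8,1,7],KL[1,7,3,5,0,4]] [])])]"], code_simp, simp)

lemma bad_18: "bad [sq 1 524288 0,sq 1 524287 1048575,(627712,629760,628736,632832),
    sq 1 436906 699050,sq 1024 618 341]"
  by (rule check_bad(1)[of _
    "Nd f61 [KL[1,3,0],KL[0,4,2,1]] [(sq 1 469674 349525,Nd f54 [KL[1,3,5,0],KL[5,0,4,2,
    1]] [(sq 1 449389 449389,Nd f7 [KL[1,3,6,0],KL[0,1],KL[0,4,2,1,3]] [(sq 1024 438 797,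
    Nd f40 [KL[0,4,2,1],KL[1,7,3,6,0],KF[3,0,4,2,1,7]] [(sq 1 636245 349525,Nd f42 [KL[7,3,
    6,0],KF[1,3,6,0,8,2],KL[1,7,3,6,0,8],KL[0,8,2,1,7]] [(sq 1 449389 421302,Nd f53 [KL[1,7,
    3,9,0],KL[0,8,2,1],KL[9,0,8,2,1],KL[0,8,2,1,7,3],KL[1,7,3,9,0,8]] []),
    (sq 1 449389 839094,Nd f53 [KL[1,9,3,6,0],KL[0,8,2,1],KL[0,8,2,1,9],KL[6,0,8,2,1,9],
    KL[1,9,3,6,0,8]] [])]),(sq 1 436906 830122,Nd f53 [KL[1,8,3,6,0],KL[0,4,2,1],KL[0,4,2,1,
    8],KL[6,0,4,2,1,8],KL[1,8,3,6,0,4]] [])]),((446464,466944,884736,901120),Nd f40 [KL[0,4,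
    2,1],KL[1,7,3,6,0],KF[3,0,4,2,1,7]] [(sq 1 636245 349525,Nd f53 [KL[1,7,3,6,0],KL[0,8,2,
    1],KF[3,0,8,2,1,7],KL[1,7,3,6,0,8]] [(sq 1 420522 699050,Nd f27 [KL[0,1],KL[9,6,0,8,2,1,
    7]] [])]),(sq 1 436906 830122,Nd f53 [KL[1,7,3,6,0],KL[0,4,2,1],KL[1,7,3,6,0,4],KF[3,0,
    4,2,1,7,8]] [(sq 1 420522 699050,Nd f27 [KL[0,1],KL[8,9,6,0,4,2,1]] [])])]),
    (sq 1024 566 877,Nd f53 [KL[1,3,6,0],KL[0,4,2,7],KL[6,0,4,2,7,1],KL[0,4,2,7,1,
    3]] [(sq 1 633514 699050,Nd f27 [KL[0,1],KL[3,6,0,4,8,7,1]] [])])]),(sq 1 449389 842605,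
    Cut),((445440,449536,890880,899072),Nd f53 [KL[1,6,3,5,0],KL[0,4,2,1],KL[0,4,2,1,6],
    KL[1,6,3,5,0,4]] [(sq 1 420522 699050,Nd f27 [KL[0,1],KL[7,5,0,4,2,1,6]] [])]),
    (sq 1 636635 748982,Nd f59 [KL[1,3,5,0],KL[3,5,0,4,6,1]] [])]),(sq 1 641706 349525,
    Nd f53 [KL[1,3,0],KL[0,5,2,1],KL[0,5,2,1,3]] [(sq 1 420522 699050,Nd f54 [KL[1,6,0],
    KF[1,6,0,5,2],KL[1,6,0,5],KL[0,5,2,1,6]] []),(sq 1 633514 699050,Nd f54 [KL[1,3,0],KL[3,
    0,5,6,1],KL[0,5,6,1,3]] [(sq 1 449389 842605,Nd f55 [KL[0,5,6,1],KL[1,7,3,0],KL[0,5,6,1,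
    7,3],KL[1,7,3,0,5]] [(sq 1 642389 349525,Nd f56 [KL[7,3,0],KL[3,0,8,6,1],KL[0,8,6,1,7,
    3],KL[1,7,3,0,8,6]] [(sq 1 466358 898779,Nd f57 [KL[1,9,7,3,0],KL[3,0,8,6,1,9,7],KL[0,8,
    6,1,9],KL[1,9,7,3,0,8]] [])])]),(sq 1 636635 748982,Nd f59 [KL[1,3,0],KL[3,0,5,7,
    1]] [])])]),(sq 1 611669 830122,Nd f51 [KL[1,3,0],KL[0,4,2,5,1],KL[0,4,2,5,1,
    3]] [(sq 1024 618 682,Nd f58 [KL[1,3,0],KL[3,0,4,6,5,1],KL[1,3,0,4],KF[3,0,4,6,5,
    1]] [(sq 1 449389 847286,Nd f40 [KL[1,7,3,0],KL[0,4,6,5],KL[3,0,4,6,5,1],KL[0,4,6,5,1,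
    7],KL[6,5,1,7,3,0]] []),(sq 1 472795 898779,Nd f55 [KL[0,4,6,5],KL[1,7,3,0],KL[0,4,6,5,
    1,7,3],KL[1,7,3,0,4],KL[6,5,1,7,3,0]] [])])])]"], code_simp, simp add: bad_17)

lemma bad_19: "bad [sq 1 524288 0,sq 1 524287 1048575,(627712,629760,628736,632832),
    sq 1 699050 699050]"
  by (rule check_bad(1)[of _
    "Nd f63 [KL[1,0],KL[0,3,1]] [(sq 1024 443 877,Nd f64 [KL[1,4,0],KL[0,3,1]] []),
    (sq 1024 475 877,Nd f65 [KL[1,4,0],KL[0,3,1]] [(sq 1024 694 731,Nd f0 [KL[3,1,4,0],KL[0,
    5],KL[0,3,1]] [(sq 1 480597 699050,Nd f13 [KL[0,5],KL[5,1,4,6,0],KL[0,3,1]] []),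
    (sq 1 699050 873813,Nd f59 [KL[1,4,0],KL[0,3,6,1],KL[1,4,0,3],KF[1,0,3,5,6]] [])])]),
    (sq 1024 731 877,Nd f66 [KL[4,1,0],KL[0,4],KL[1,0,4]] [(sq 1024 502 877,Nd f13 [KL[0,4],
    KL[4,1,5,0],KL[0,4,1]] [])]),((745472,753664,745472,770048),Nd f67 [KL[1,0],KL[1,0,4],
    KL[0,4,1]] [(sq 1024 750 750,Nd f0 [KL[5,1,0],KL[0,4],KL[1,0,5],KL[0,5,1]] [])]),
    (sq 1024 749 731,Nd f0 [KL[4,1,0],KL[0,4],KL[1,0,4],KL[0,4,1]] [])]"], code_simp, simp)

lemma bad_20: "bad [sq 1 524288 0,sq 1 524287 1048575,sq 1024 406 409,sq 1 611669 349525]"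
  by (rule check_bad(1)[of _
    "Nd f68 [KL[1,2,0],KL[0,3,1],KL[2,0,3,1]] [(sq 1 436906 699050,Nd f44 [KL[0,3,1],KL[1,4,
    2,0],KL[2,0,3,1]] [(sq 1 611669 218453,Nd f45 [KL[1,4,2,0],KL[0,5,3,1],KL[1,4,2,0,
    5]] [(sq 1024 405 682,Nd f16 [KL[0,5,3,1],KL[1,6,2,0],KL[1,6,2,0,
    5]] [(sq 1 415061 349525,Nd f17 [KL[0,5,3,1],KL[1,6,7,0],KL[1,6,7,0,5,3],KL[7,0,5,3,1],
    KL[0,5,3,1,6]] [])])]),(sq 1 412330 699050,Nd f16 [KL[0,3,1],KL[1,5,2,0],KL[1,5,2,0,
    3]] [(sq 1 415061 349525,Nd f17 [KL[0,3,1],KL[1,5,6,0],KL[0,3,1,5],KL[1,5,6,0,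
    3]] [(sq 1 406186 699050,Nd f18 [KL[0,3,1],KL[3,1,7,6,0],KL[1,7,6,0,
    3]] [(sq 1 411940 299593,Nd f19 [KL[0,3,1],KL[3,1,7,8,0]] []),(sq 1 599186 205970,
    Nd f20 [KL[8,3,1],KL[3,1,7,6,0],KL[0,8,3,1,7,6],KL[1,7,6,0,8,3]] [(sq 1 582217 149796,
    Nd f21 [KL[0,9,8,3,1],KL[3,1,7,6,0,9,8],KL[1,7,6,0,9],KL[0,9,8,3,1,7]] [])])]),
    (sq 1 576170 699050,Nd f18 [KL[0,3,7,1],KL[3,7,1,5,6,0],KL[0,3,7,1,
    5]] [(sq 1 599186 599186,Nd f19 [KL[0,3,8,1],KL[8,1,5,6,0],KL[3,8,1,5,6,0]] [])])]),
    (sq 1 628053 349525,Nd f25 [KL[0,6,1],KL[6,1,5,2,0],KL[1,5,2,0,6],KL[0,6,1,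
    5]] [(sq 1 599186 209481,Nd f20 [KL[7,6,1],KL[6,1,5,2,0],KL[0,7,6,1,5,2],KL[7,6,1,5,2,
    0],KF[6,1,5,2,0,7]] []),(sq 1 411940 411940,Nd f28 [KL[0,6,1],KL[6,1,5,7,0],KL[0,6,1,5],
    KL[1,5,7,0,6]] [])])]),(sq 1 600746 699050,Nd f50 [KL[1,4,2,0],KL[0,3,5,
    1]] [(sq 1 415061 699050,Nd f19 [KL[0,3,5,1],KL[5,1,6,2,0],KL[3,5,1,6,2,0]] []),
    (sq 1 611669 699050,Nd f29 [KL[0,3,6,1],KF[0,6,1,4,2],KL[0,3,6,1,4,2],KL[3,6,1,4,2,
    0]] [(sq 1 599186 231716,Nd f59 [KL[1,4,2,0],KL[2,0,7,3,6,1],KL[4,2,0,7,3,6,1]] []),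
    (sq 1 599186 805156,Nd f48 [KL[4,2,0],KF[1,2,0,3,6,7],KL[1,4,2,0],KL[0,3,6,7,1,4,
    2]] [(sq 1 580461 898779,Nd f27 [KL[0,1],KF[4,2,0,3,6,7,8,1]] [])])])])])]"], code_simp, simp)

lemma bad_21: "bad [sq 1 524288 0,sq 1 524287 1048575,(418816,419840,418816,420864),
    sq 1 611669 349525]"
  by (rule check_bad(1)[of _
    "Nd f68 [KL[1,2,0],KL[0,3,1],KL[2,0,3,1]] [(sq 1 436906 699050,Nd f44 [KL[0,3,1],KL[1,4,
    2,0],KL[2,0,3,1]] [(sq 1 611669 218453,Nd f45 [KL[1,4,2,0],KL[0,5,3,1],KL[1,4,2,0,
    5]] [(sq 1024 405 682,Nd f16 [KL[0,5,3,1],KL[1,6,2,0],KL[1,6,2,0,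
    5]] [(sq 1 415061 349525,Nd f17 [KL[0,5,3,1],KL[1,6,7,0],KL[1,6,7,0,5,3],KL[7,0,5,3,1],
    KL[0,5,3,1,6]] []),(sq 1 628053 349525,Nd f48 [KL[6,2,0],KL[6,2,0,5,7,1],KL[1,6,2,0,5],
    KL[0,5,7,1,6,2]] [(sq 1 449389 816859,Nd f23 [KL[0,5,7,1],KL[1,8,6,2,0],KL[2,0,5,7,1],
    KL[0,5,7,1,8,6],KL[1,8,6,2,0,5,7]] [])])])]),(sq 1 412330 699050,Nd f16 [KL[0,3,1],KL[1,
    5,2,0]] [(sq 1 415061 349525,Nd f17 [KL[0,3,1],KL[1,5,6,0],KL[0,3,1,5],KL[1,5,6,0,
    3]] [(sq 1 406186 699050,Nd f18 [KL[0,3,1],KL[3,1,7,6,0],KL[1,7,6,0,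
    3]] [(sq 1 411940 299593,Nd f19 [KL[0,3,1],KL[3,1,7,8,0]] []),(sq 1 599186 205970,
    Nd f20 [KL[8,3,1],KL[3,1,7,6,0],KL[0,8,3,1,7,6],KL[1,7,6,0,8,3]] [(sq 1 582217 149796,
    Nd f21 [KL[0,9,8,3,1],KL[3,1,7,6,0,9,8],KL[1,7,6,0,9],KL[0,9,8,3,1,7]] [])])]),
    (sq 1 576170 699050,Nd f18 [KL[0,3,7,1],KL[3,7,1,5,6,0],KL[0,3,7,1,
    5]] [(sq 1 599186 599186,Nd f19 [KL[0,3,8,1],KL[8,1,5,6,0],KL[3,8,1,5,6,0]] [])])]),
    (sq 1 628053 349525,Nd f18 [KL[0,6,1],KL[6,1,5,2,0],KL[0,6,1,5]] [(sq 1 599186 205970,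
    Nd f23 [KL[1,5,2,0],KL[0,7,6,1],KF[1,2,0,7,6],KL[0,7,6,1,5]] [(sq 1 578901 699050,
    Nd f26 [KL[5,2,0],KL[5,2,0,7,6,8,1],KL[1,5,2,0],KL[7,6,8,1],KL[1,5,2,0,7,
    6]] [(sq 1 449389 292571,Nd f27 [KL[0,1],KF[9,7,6,8,1,5,2]] [])])]),(sq 1 599186 599186,
    Nd f25 [KL[0,6,7,1],KL[6,7,1,5,2,0],KL[0,6,7,1,5],KL[1,5,2,0,6]] [])]),
    (sq 1 611669 611669,Nd f29 [KL[0,3,6,1],KL[6,1,5,2,0],KL[1,5,2,0,3],KL[0,3,6,1,5,2],
    KL[3,6,1,5,2,0]] [])]),(sq 1 600746 699050,Nd f50 [KL[1,4,2,0],KL[0,3,5,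
    1]] [(sq 1 415061 699050,Nd f29 [KL[0,3,5,1],KL[5,1,6,2,0],KL[3,5,1,6,2,0],KL[1,6,2,0,
    3],KL[0,3,5,1,6,2]] []),(sq 1 611669 699050,Nd f29 [KL[0,3,6,1],KL[3,6,1,4,2,
    0]] [(sq 1 468114 149796,Nd f59 [KL[1,4,2,7],KL[2,7,0,3,6,1],KL[4,2,7,0,3,6,1],KL[1,4,2,
    7,0]] []),(sq 1 582802 149796,Nd f48 [KL[1,4,2,0],KF[1,2,0,7,3,6],KL[0,7,3,6,1,4,2],
    KL[1,4,2,0,7,3,6]] []),(sq 1 599186 231716,Nd f48 [KL[1,4,2,0],KF[1,2,0,7,3,6],KL[0,7,3,
    6,1,4,2],KL[1,4,2,0,7,3,6],KL[4,2,0,7,3,6,1]] []),(sq 1 599186 805156,Nd f49 [KL[2,0,3,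
    6,7,1],KL[6,7,1,4,2,0],KL[3,6,7,1,4,2,0],KL[4,2,0,3,6,7,1],KL[1,4,2,0,3,6],KL[0,3,6,7,1,
    4,2]] [])])])])]"], code_simp, simp)

lemma bad_22: "bad [sq 1 524288 0,sq 1 524287 1048575,sq 1024 409 422]"
  by (rule check_bad(1)[of _
    "Nd f52 [KL[1,2,0],KL[0,1]] [(sq 1 349525 349525,Nd f69 [KL[0,1],KL[1,3,
    0]] [(sq 1024 292 146,Nd f70 [KL[4,0,1],KL[1,4],KL[0,1,4]] [(sq 1024 521 146,
    Nd f45 [KL[1,4],KL[4,0,5,1],KL[1,4,0]] [])]),(sq 1024 548 146,Nd f71 [KL[0,4,1],KL[1,3,
    0]] [(sq 1024 329 292,Nd f72 [KL[5,0,4,1],KL[1,5],KL[1,3,0]] [(sq 1 349525 174762,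
    Nd f19 [KL[0,4,1],KL[1,3,6,0],KL[0,4,1,3],KF[0,1,3,5,6]] []),(sq 1 567978 349525,
    Nd f45 [KL[1,5],KL[5,0,4,6,1],KL[1,3,0]] [])])]),(sq 1024 580 146,Nd f73 [KL[0,4,1],
    KL[1,3,0]] []),(sq 1024 274 292,Nd f72 [KL[4,0,1],KL[1,4],KL[0,1,4],KL[1,4,0]] []),
    ((294912,303104,278528,303104),Nd f74 [KL[0,1],KL[0,1,4],KL[1,4,0]] [(sq 1024 273 273,
    Nd f72 [KL[5,0,1],KL[1,4],KL[0,1,5],KL[1,5,0]] [])])]),(sq 1 611669 349525,Nd f75 [KL[1,
    2,0],KL[0,3,1]] [(sq 1024 362 682,Nd f19 [KL[0,3,1],KL[3,1,4,2,0]] []),(sq 1024 426 682,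
    Cut)]),(sq 1 349525 611669,Nd f71 [KL[0,1,3],KL[1,3,0]] [(sq 1024 329 292,Nd f69 [KL[0,
    1,3],KL[1,3,4],KL[1,3,4,0]] []),(sq 1024 292 585,Nd f74 [KL[0,1,4],KL[1,4,0]] [])]),
    (sq 1 305834 699050,Nd f76 [KL[0,1,3],KL[1,3,0]] []),(sq 1 349525 677205,Nd f69 [KL[0,1,
    3],KL[1,3,0]] [(sq 1024 548 146,Nd f77 [KL[0,4,1,3],KL[1,3,0]] []),(sq 1024 580 146,
    Nd f73 [KL[0,4,1],KL[1,3,0]] [])]),((337920,350208,692224,700416),Nd f73 [KL[0,1,3],
    KL[1,3,0]] [(sq 1 337042 299593,Nd f27 [KL[0,1],KL[1,3,4]] []),(sq 1 299593 599186,
    Nd f74 [KL[0,1,3],KF[0,1,3,4]] [])])]"], code_simp, simp add: bad_12)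

lemma bad_23: "bad [sq 1 524288 0,sq 1 524287 1048575,sq 1024 358 409]"
  by (rule check_bad(1)[of _
    "Nd f74 [KL[0,1]] [(sq 1024 273 273,Nd f72 [KL[3,0,1],KL[1,3],KL[0,1,3],KL[1,3,0]] []),
    ((559104,562176,69632,74752),Nd f71 [KL[0,3,1],KL[1,2,0]] [(sq 1024 329 292,
    Nd f45 [KL[1,4],KL[4,0,3,1],KF[0,1,2,4]] [(sq 1024 341 426,Nd f72 [KL[4,0,3,1],KL[1,4],
    KL[1,5,4,0,3],KL[0,3,1,5]] []),(sq 1024 405 682,Nd f72 [KL[4,0,3,1],KL[1,4],KL[1,5,4,0,
    3],KL[0,3,1,5,4]] [])]),((598016,610304,147456,172032),Nd f78 [KL[1,2,0],KL[2,0,3,4,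
    1]] [(sq 1024 341 341,Nd f27 [KL[0,1],KF[0,4,1,5]] []),(sq 1024 597 341,Nd f27 [KL[0,1],
    KF[2,4,5,1]] [])]),(sq 1024 585 292,Nd f52 [KL[0,3,4,1],KL[1,2,0]] [(sq 1 611669 349525,
    Nd f27 [KL[0,1],KF[2,3,5,1]] [])])]),(sq 1024 580 68,Nd f79 [KL[2,0,3,1],KL[1,2,0,3],
    KL[0,3,1,2]] []),(sq 1024 546 136,Nd f71 [KL[0,3,1],KL[1,2,0]] [(sq 1024 329 292,
    Nd f45 [KL[1,4],KL[4,0,3,1],KF[0,1,2,4]] [(sq 1024 341 426,Nd f72 [KL[4,0,3,1],KL[1,4],
    KL[1,5,4,0,3],KL[0,3,1,5]] []),(sq 1024 405 682,Nd f72 [KL[4,0,3,1],KL[1,4],KL[1,5,4,0,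
    3],KL[0,3,1,5,4]] [])]),((598016,610304,147456,172032),Nd f78 [KL[0,4,1],KL[1,2,
    0]] [(sq 1024 597 341,Nd f27 [KL[0,1],KF[2,4,5,1]] [])]),(sq 1024 585 292,Nd f45 [KL[1,
    2,0],KL[2,0,3,4,1],KF[1,0,3,4],KL[1,2,0,3]] [(sq 1024 405 682,Nd f52 [KF[1,0,3,4],KL[1,
    5,2,0]] [])])]),((278528,282624,139264,149504),Nd f50 [KL[1,3],KF[1,3,0],KL[1,3,0]] []),
    (sq 1024 290 136,Nd f70 [KL[3,0,1],KL[1,3],KL[0,1,2,3]] [(sq 1024 521 146,Nd f45 [KL[1,
    3],KL[3,0,4,1],KF[0,1,2,3]] [])])]"], code_simp, simp)

lemma bad_24: "bad [sq 1 524288 0,sq 1 524287 1048575,sq 1024 409 614]"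
  by (rule check_bad(1)[of _
    "Nd f52 [KL[1,2,0],KL[0,1]] [(sq 1 349525 349525,Nd f69 [KL[0,1],KF[0,1,2,
    3]] [(sq 1024 292 146,Nd f70 [KL[4,0,1],KL[1,4],KL[0,1,2,4]] [(sq 1024 521 146,
    Nd f45 [KL[1,4],KL[4,0,5,1],KF[0,1,2,4]] [])]),(sq 1024 548 146,Nd f80 [KL[1,2,0],KL[3,
    0,4,1]] [(sq 1 349525 218453,Nd f50 [KL[1,5],KL[5,0,4,1],KL[1,2,5,0],KL[3,5,0,4,1]] []),
    (sq 1 404138 699050,Nd f73 [KL[0,4,1],KL[1,5,3,0],KL[0,4,1,5]] []),(sq 1 567978 699050,
    Nd f71 [KL[0,4,5,1],KF[0,1,2,3]] [])]),(sq 1024 580 146,Nd f73 [KL[0,4,1],KF[0,1,2,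
    3]] []),(sq 1024 274 292,Nd f72 [KL[4,0,1],KL[1,4],KL[0,1,4],KL[1,4,0]] []),((294912,
    303104,278528,303104),Nd f74 [KL[0,1],KL[0,1,4],KL[1,4,0]] [(sq 1024 273 273,
    Nd f72 [KL[5,0,1],KL[1,4],KL[0,1,5],KL[1,5,0]] [])])]),(sq 1 611669 349525,Cut),
    (sq 1 349525 611669,Nd f71 [KL[0,1,3],KL[1,3,0]] [(sq 1024 329 292,Nd f69 [KL[0,1,3],
    KL[1,3,4],KL[1,3,4,0]] []),(sq 1024 292 585,Nd f74 [KL[0,1,4],KL[1,4,0]] [])]),
    (sq 1 305834 699050,Nd f76 [KL[0,1,3],KL[1,3,0]] []),(sq 1 349525 677205,Nd f69 [KL[0,1,
    3],KL[1,3,0]] [(sq 1024 548 146,Nd f77 [KL[0,4,1,3],KL[1,3,0]] []),(sq 1024 580 146,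
    Nd f73 [KL[0,4,1],KL[1,3,0]] [])]),((337920,350208,692224,700416),Nd f73 [KL[0,1,3],
    KL[1,3,0]] [(sq 1 337042 299593,Nd f27 [KL[0,1],KL[1,3,4]] []),(sq 1 299593 599186,
    Nd f74 [KL[0,1,3],KF[0,1,3,4]] [])])]"], code_simp, simp add: bad_10)

lemma bad_25: "bad [sq 1 524288 0,sq 1 524287 1048575,sq 1024 406 409]"
  by (rule check_bad(1)[of _
    "Nd f52 [KL[1,2,0],KL[0,1]] [(sq 1 349525 349525,Nd f69 [KL[0,1],KL[1,3,
    0]] [(sq 1024 292 146,Nd f70 [KL[4,0,1],KL[1,4],KL[0,1,4]] [(sq 1024 521 146,
    Nd f45 [KL[1,4],KL[4,0,5,1],KL[1,4,0]] [])]),(sq 1024 548 146,Nd f71 [KL[0,4,1],KL[1,3,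
    0]] [(sq 1024 329 292,Nd f72 [KL[5,0,4,1],KL[1,5],KL[1,3,0]] [(sq 1 349525 174762,
    Nd f19 [KL[0,4,1],KL[1,3,6,0],KL[0,4,1,3],KF[0,1,3,5,6]] []),(sq 1 567978 349525,
    Nd f45 [KL[1,5],KL[5,0,4,6,1],KL[1,3,0]] [])])]),(sq 1024 580 146,Nd f73 [KL[0,4,1],
    KL[1,3,0]] []),(sq 1024 274 292,Nd f72 [KL[4,0,1],KL[1,4],KL[0,1,4],KL[1,4,0]] []),
    ((294912,303104,278528,303104),Nd f74 [KL[0,1],KL[0,1,4],KL[1,4,0]] [(sq 1024 273 273,
    Nd f72 [KL[5,0,1],KL[1,4],KL[0,1,5],KL[1,5,0]] [])])]),(sq 1 611669 349525,Cut),
    (sq 1 349525 611669,Nd f71 [KL[0,1,3],KL[1,3,0]] [(sq 1024 329 292,Nd f69 [KL[0,1,3],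
    KL[1,3,4],KL[1,3,4,0]] []),(sq 1024 292 585,Nd f74 [KL[0,1,4],KL[1,4,0]] [])]),
    (sq 1 305834 699050,Nd f76 [KL[0,1,3],KL[1,3,0]] []),(sq 1 349525 677205,Nd f69 [KL[0,1,
    3],KL[1,3,0]] [(sq 1024 548 146,Nd f77 [KL[0,4,1,3],KL[1,3,0]] []),(sq 1024 580 146,
    Nd f73 [KL[0,4,1],KL[1,3,0]] [])]),((337920,350208,692224,700416),Nd f73 [KL[0,1,3],
    KL[1,3,0]] [(sq 1 337042 299593,Nd f27 [KL[0,1],KL[1,3,4]] []),(sq 1 299593 599186,
    Nd f74 [KL[0,1,3],KF[0,1,3,4]] [])])]"], code_simp, simp add: bad_20)

lemma bad_26: "bad [sq 1 524288 0,sq 1 524287 1048575,(418816,419840,418816,420864)]"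
  by (rule check_bad(1)[of _
    "Nd f52 [KL[1,2,0],KL[0,1]] [(sq 1 349525 349525,Nd f69 [KL[0,1],KL[1,3,
    0]] [(sq 1024 292 146,Nd f70 [KL[4,0,1],KL[1,4],KL[0,1,4]] [(sq 1024 521 146,
    Nd f45 [KL[1,4],KL[4,0,5,1],KL[1,4,0]] [])]),(sq 1024 548 146,Nd f71 [KL[0,4,1],KL[1,3,
    0]] [(sq 1024 329 292,Nd f72 [KL[5,0,4,1],KL[1,5],KL[1,3,0]] [(sq 1 349525 174762,
    Nd f19 [KL[0,4,1],KL[1,3,6,0],KL[0,4,1,3],KF[0,1,3,5,6]] []),(sq 1 567978 349525,
    Nd f45 [KL[1,5],KL[5,0,4,6,1],KL[1,3,0]] [])])]),(sq 1024 580 146,Nd f73 [KL[0,4,1],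
    KL[1,3,0]] []),(sq 1024 274 292,Nd f72 [KL[4,0,1],KL[1,4],KL[0,1,4],KL[1,4,0]] []),
    ((294912,303104,278528,303104),Nd f74 [KL[0,1],KL[0,1,4],KL[1,4,0]] [(sq 1024 273 273,
    Nd f72 [KL[5,0,1],KL[1,4],KL[0,1,5],KL[1,5,0]] [])])]),(sq 1 611669 349525,Cut),
    (sq 1 349525 611669,Nd f71 [KL[0,1,3],KL[1,3,0]] [(sq 1024 329 292,Nd f69 [KL[0,1,3],
    KL[1,3,4],KL[1,3,4,0]] []),(sq 1024 292 585,Nd f74 [KL[0,1,4],KL[1,4,0]] [])]),
    (sq 1 305834 699050,Nd f76 [KL[0,1,3],KL[1,3,0]] []),(sq 1 349525 677205,Nd f69 [KL[0,1,
    3],KL[1,3,0]] [(sq 1024 548 146,Nd f77 [KL[0,4,1,3],KL[1,3,0]] []),(sq 1024 580 146,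
    Nd f73 [KL[0,4,1],KL[1,3,0]] [])]),((337920,350208,692224,700416),Nd f73 [KL[0,1,3],
    KL[1,3,0]] [(sq 1 337042 299593,Nd f27 [KL[0,1],KL[1,3,4]] []),(sq 1 299593 599186,
    Nd f74 [KL[0,1,3],KF[0,1,3,4]] [])])]"], code_simp, simp add: bad_21)

lemma bad_27: "bad [sq 1 524288 0,sq 1 524287 1048575,sq 1024 601 614]"
  by (rule check_bad(1)[of _
    "Nd f68 [KL[0,2,1],KL[1,0]] [(sq 1 371370 699050,Nd f81 [KL[0,2,1],KL[2,1,3,0]] []),
    (sq 1 436906 699050,Nd f43 [KL[0,2,1],KL[1,3,0]] [(sq 1 436906 349525,Cut),
    (sq 1 633514 349525,Nd f50 [KL[1,3,0],KL[0,4,2,1]] [(sq 1 415061 699050,Nd f33 [KL[0,4,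
    2,1,5],KL[1,5,0,4],KL[5,0,4,2,1]] [(sq 1 445644 419430,Nd f60 [KL[1,5,6,0],KL[5,6,0,4,2,
    1],KL[0,4,2,1,5],KL[2,1,5,6,0],KL[1,5,6,0,4]] [(sq 1 449389 829147,Nd f35 [KL[0,4,2,1],
    KL[4,2,1,7,5,6,0],KL[6,0,4,2,1],KL[0,4,2,1,7,5],KL[1,7,5,6,0,4,2]] [])]),((629120,
    629568,629120,629568),Nd f54 [KL[1,5,0],KL[5,0,4,6,1],KL[1,5,0,4],KL[0,4,6,1,5]] []),
    (sq 1 629145 635699,Nd f54 [KL[1,5,0],KL[5,0,4,6,1],KL[1,5,0,4],KL[0,4,6,1,5]] [])]),
    (sq 1 611669 699050,Cut)]),(sq 1 682666 349525,Nd f58 [KL[1,3,0],KL[3,0,4,1],KL[3,0,4],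
    KL[0,4,1,3]] [])]),(sq 1 742741 349525,Nd f15 [KL[1,0,3],KL[0,3,1]] []),
    (sq 1 699050 436906,Nd f65 [KL[1,0,3],KL[0,3,1]] [(sq 1024 731 438,Nd f67 [KL[1,0,4],
    KL[0,4,1]] []),(sq 1024 694 731,Nd f63 [KL[1,0,3],KL[0,3,4],KL[0,3,4,1]] [])]),
    (sq 1 699050 699050,Cut),((698368,710656,348160,356352),Nd f64 [KL[1,0,3],KL[0,3,
    1]] [(sq 1 748982 449389,Nd f67 [KL[1,0,3],KF[1,0,3,4]] []),(sq 1 711533 748982,
    Nd f27 [KL[0,1],KF[4,1,0,3]] [])]),(sq 1 699050 371370,Nd f63 [KL[1,0,3],KL[0,3,
    1]] [(sq 1024 443 877,Nd f64 [KL[1,4,0],KL[0,3,1]] []),(sq 1024 475 877,Nd f82 [KL[1,4,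
    0,3],KL[0,3,1]] [])])]"], code_simp, simp add: bad_14 bad_15 bad_16)

lemma bad_28: "bad [sq 1 524288 0,sq 1 524287 1048575,(627712,629760,628736,632832)]"
  by (rule check_bad(1)[of _
    "Nd f68 [KL[0,2,1],KL[1,0]] [(sq 1 742741 349525,Nd f15 [KL[1,0,3],KL[0,3,1]] []),
    (sq 1 699050 436906,Nd f65 [KL[1,0,3],KL[0,3,1]] [(sq 1024 731 438,Nd f67 [KL[1,0,4],
    KL[0,4,1]] []),(sq 1024 694 731,Nd f63 [KL[1,0,3],KL[0,3,4],KL[0,3,4,1]] [])]),
    (sq 1 436906 699050,Nd f13 [KL[0,2,1],KL[1,3,0],KL[2,1,3,0]] [(sq 1024 426 341,
    Nd f73 [KL[0,2,1],KF[0,2,1,3,4]] [(sq 1 599186 299593,Nd f52 [KL[0,5,2,1],KL[1,3,4,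
    0]] [(sq 1 611669 349525,Nd f29 [KL[0,6,2,1],KF[0,2,1,3,4]] [(sq 1 468114 149796,
    Nd f49 [KL[4,7,0,6,2,1],KL[2,1,3,4,7,0],KL[6,2,1,3,4,7,0],KL[3,4,7,0,6,2,1],KL[0,6,2,1,
    3,4],KL[1,3,4,7,0,6,2]] []),(sq 1 582802 149796,Nd f48 [KL[1,3,4,0],KL[4,0,7,6,2,1],
    KL[3,4,0,7,6,2,1],KL[0,7,6,2,1,3,4],KL[1,3,4,0,7,6,2]] []),(sq 1 599186 231716,
    Nd f48 [KL[1,3,4,0],KL[4,0,7,6,2,1],KL[3,4,0,7,6,2,1],KL[1,3,4,0,7,6,
    2]] [(sq 1 449389 243419,Nd f27 [KL[0,1],KL[7,6,2,1,3,4,8]] [])]),(sq 1 599186 805156,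
    Nd f49 [KL[4,0,6,2,7,1],KL[2,7,1,3,4,0],KL[6,2,7,1,3,4,0],KL[3,4,0,6,2,7,1],KL[0,6,2,7,
    1,3],KL[1,3,4,0,6,2]] [])])])]),(sq 1024 618 341,Cut)]),(sq 1 699050 699050,Cut),
    ((698368,710656,348160,356352),Nd f64 [KL[1,0,3],KL[0,3,1]] [(sq 1 748982 449389,
    Nd f67 [KL[1,0,3],KF[1,0,3,4]] []),(sq 1 711533 748982,Nd f27 [KL[0,1],KF[4,1,0,
    3]] [])]),(sq 1 699050 371370,Nd f63 [KL[1,0,3],KL[0,3,1]] [(sq 1024 443 877,
    Nd f64 [KL[1,4,0],KL[0,3,1]] []),(sq 1024 475 877,Nd f82 [KL[1,4,0,3],KL[0,3,1]] [])])]"], code_simp, simp add: bad_18 bad_19)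

text \<open>The two points span a vertical segment through the centre of the square, and this pair
  needs the deepest search. \<open>bad_11\<close> and \<open>bad_22\<close> to \<open>bad_28\<close>
  close the cut branches.\<close>

lemma bad_29: "bad [sq 1 524288 0,sq 1 524287 1048575]"
  by (rule check_bad(1)[of _
    "Nd f83 [KL[1,0],KL[0,1]] [(sq 1024 716 204,Nd f84 [KL[1,0,2],KL[0,2,1]] []),
    (sq 1024 358 409,Cut),(sq 1024 409 614,Cut),(sq 1024 614 665,Nd f68 [KL[0,2,1],KL[1,
    0]] [((696320,712704,348160,372736),Nd f63 [KL[1,0,3],KL[0,3,2,1]] [(sq 1024 475 877,
    Nd f65 [KL[1,4,0],KL[0,3,2,1],KL[1,4,0,3]] [])]),(sq 1 742741 349525,Nd f15 [KL[1,0,3],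
    KL[0,3,1]] []),(sq 1 699050 436906,Nd f65 [KL[1,0,3],KL[0,3,2,1]] [(sq 1024 731 438,
    Nd f67 [KL[1,0,4],KL[0,4,1]] []),(sq 1024 694 731,Nd f63 [KL[1,0,3],KL[0,3,4],KL[0,3,4,
    1]] [])]),(sq 1 436906 699050,Cut),(sq 1 699050 699050,Nd f63 [KL[1,0],KL[0,3,
    1]] [(sq 1024 443 877,Nd f64 [KL[1,4,0],KL[0,3,1]] []),(sq 1024 475 877,Nd f65 [KL[1,4,
    0],KL[0,3,1]] [(sq 1024 694 731,Nd f0 [KL[3,1,4,0],KL[0,5],KL[0,3,
    1]] [(sq 1 480597 699050,Nd f13 [KL[0,5],KL[5,1,4,6,0],KL[0,3,1]] []),
    (sq 1 699050 873813,Nd f59 [KL[1,4,0],KL[0,3,6,1],KL[1,4,0,3],KF[1,0,3,5,6]] [])])]),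
    (sq 1024 731 877,Nd f66 [KL[4,1,0],KL[0,4],KL[1,0,4]] [(sq 1024 502 877,Nd f13 [KL[0,4],
    KL[4,1,5,0],KL[0,4,1]] [])]),((745472,753664,745472,770048),Nd f67 [KL[1,0],KL[1,0,4],
    KL[0,4,1]] [(sq 1024 750 750,Nd f0 [KL[5,1,0],KL[0,4],KL[1,0,5],KL[0,5,1]] [])]),
    (sq 1024 749 731,Nd f0 [KL[4,1,0],KL[0,4],KL[1,0,4],KL[0,4,1]] [])])]),(sq 1024 409 422,
    Cut),(sq 1024 601 614,Cut),((627712,629760,628736,632832),Cut),(sq 1024 406 409,Cut),
    ((418816,419840,418816,420864),Cut)]"], code_simp, simp add: bad_11 bad_22 bad_23 bad_24 bad_25 bad_26 bad_27 bad_28)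

section \<open>Box 1, the point (1/2, 0), against the rotations of boxes 2 to 14\<close>

lemma bad_30: "bad [sq 1 524288 0,sq 1 786431 1048575]"
  by (rule check_bad(1)[of _
    "Nd f85 [KL[0,1]] [(sq 1024 352 0,Nd f86 [KL[2,0,1],KL[1,2,0]] []),(sq 1024 704 0,
    Nd f4 [KL[1,0,2],KL[0,2,1]] []),(sq 1024 768 256,Nd f87 [KL[2,1],KL[1,0],KL[0,2,1]] []),
    (sq 1024 512 640,Nd f88 [KL[0,1],KL[1,2,0],KL[0,1,2]] [(sq 1024 448 640,Nd f89 [KL[3,0],
    KL[3,0,1],KL[1,3,0]] []),(sq 1024 512 848,Nd f90 [KL[1,3,0],KL[0,1],KL[0,1,
    3]] [(sq 1024 566 950,Nd f13 [KL[0,1],KL[1,4,3,0],KL[0,1,4]] [])])])]"], code_simp, simp)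

lemma bad_31: "bad [sq 1 524288 0,sq 1 917503 1048575]"
  by (rule check_bad(1)[of _
    "Nd f87 [KL[0,1],KL[1,0]] [(sq 1024 384 0,Nd f91 [KL[0,1],KL[1,2,0]] [(sq 1024 300 0,
    Nd f4 [KL[1,3,0],KL[3,0,1]] []),(sq 1024 600 0,Nd f85 [KL[3,1],KL[1,2]] [])]),
    (sq 1024 512 512,Nd f92 [KL[0,1],KL[1,2,0],KL[0,1,2]] [])]"], code_simp, simp)

lemma bad_32: "bad [sq 1 524288 0,sq 1 983039 1048575]"
  by (rule check_bad(1)[of _
    "Nd f87 [KL[0,1],KL[1,0]] [(sq 1024 384 0,Nd f93 [KL[2,0,1],KL[1,2],KL[1,2,0]] []),
    (sq 1024 512 512,Nd f94 [KL[0,1],KL[1,2,0]] [])]"], code_simp, simp)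

lemma bad_33: "bad [sq 1 524288 0,sq 1 1015807 1048575]"
  by (rule check_bad(1)[of _
    "Nd f87 [KL[0,1],KL[1,0]] [(sq 1024 384 0,Nd f95 [KL[2,0,1],KL[1,2]] []),
    (sq 1024 512 512,Nd f96 [KL[0,1],KL[1,2],KL[0,1,2]] [])]"], code_simp, simp)

lemma bad_34: "bad [sq 1 524288 0,sq 1 1032191 1048575]"
  by (rule check_bad(1)[of _
    "Nd f87 [KL[0,1],KL[1,0]] [(sq 1024 384 0,Nd f95 [KL[2,0,1],KL[1,2]] [])]"], code_simp, simp)

lemma bad_35: "bad [sq 1 524288 0,sq 1 1040383 1048575]"
  by (rule check_bad(1)[of _
    "Nd f87 [KL[0,1],KL[1,0]] [(sq 1024 384 0,Nd f95 [KL[2,0,1],KL[1,2]] [])]"], code_simp, simp)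

lemma bad_36: "bad [sq 1 524288 0,sq 1 1048575 524287]"
  by (rule check_bad(1)[of _
    "Nd f87 [KL[0,1]] [(sq 1024 48 0,Nd f97 [KL[2,0,1],KL[1,2]] []),(sq 1024 96 0,
    Nd f97 [KL[2,0,1],KL[1,2]] []),(sq 1024 192 0,Nd f98 [KL[2,0,1],KL[1,2,0]] []),
    (sq 1024 384 0,Nd f4 [KL[2,1],KL[2,0,1]] [(sq 1024 1023 255,Nd f99 [KL[2,0,3,1],KL[1,
    2]] []),(sq 1024 1023 639,Nd f100 [KL[2,0,1,3],KL[1,3,2]] [((811008,815104,90112,
    102400),Nd f14 [KL[2,4],KL[2,0,4,1],KL[3,2,0,4]] [])])]),(sq 1024 768 0,Nd f4 [KL[0,2,
    1]] [(sq 1024 1023 255,Nd f99 [KL[0,2,3,1]] [(sq 1024 981 85,Nd f45 [KL[0,2,4,3,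
    1]] [])]),(sq 1024 1023 639,Nd f101 [KL[0,2,1,3],KL[3,0]] [])])]"], code_simp, simp)

lemma bad_37: "bad [sq 1 524288 0,sq 1 1048575 786431]"
  by (rule check_bad(1)[of _
    "Nd f87 [KL[0,1]] [(sq 1024 192 0,Nd f102 [KL[2,0,1],KL[1,2,0]] []),(sq 1024 384 0,
    Nd f103 [KF[1,2,0]] [(sq 1 734003 104857,Nd f100 [KL[0,3,1],KL[1,2]] []),((806912,
    839680,208896,217088),Nd f100 [KL[0,3,1],KL[1,2]] []),(sq 1 838860 288358,Nd f100 [KL[0,
    3,1],KL[1,2]] [])]),(sq 1024 768 0,Nd f104 [KL[0,2,1],KL[1,0]] [])]"], code_simp, simp)

lemma bad_38: "bad [sq 1 524288 0,sq 1 1048575 917503]"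
  by (rule check_bad(1)[of _
    "Nd f87 [KL[0,1]] [(sq 1024 384 0,Nd f8 [KL[2,0,1],KL[1,2]] [(sq 1024 614 409,
    Nd f95 [KL[2,0,1],KL[1,3,2]] [])]),(sq 1024 768 0,Nd f1 [KL[0,2,1],KL[1,0]] [])]"], code_simp, simp)

lemma bad_39: "bad [sq 1 524288 0,sq 1 1048575 983039]"
  by (rule check_bad(1)[of _
    "Nd f87 [KL[0,1]] [(sq 1024 384 0,Nd f95 [KL[2,0,1],KL[1,2],KL[1,2,0]] []),
    (sq 1024 768 0,Nd f105 [KL[2,1],KL[1,0]] [])]"], code_simp, simp)

lemma bad_40: "bad [sq 1 524288 0,sq 1 1048575 1015807]"
  by (rule check_bad(1)[of _
    "Nd f87 [KL[0,1],KL[1,0]] [(sq 1024 384 0,Nd f95 [KL[2,0,1],KL[1,2]] [])]"], code_simp, simp)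

lemma bad_41: "bad [sq 1 524288 0,sq 1 1048575 1032191]"
  by (rule check_bad(1)[of _
    "Nd f87 [KL[0,1],KL[1,0]] [(sq 1024 384 0,Nd f95 [KL[2,0,1],KL[1,2]] [])]"], code_simp, simp)

lemma bad_42: "bad [sq 1 524288 0,sq 1 1048575 1040383]"
  by (rule check_bad(1)[of _
    "Nd f87 [KL[0,1],KL[1,0]] [(sq 1024 384 0,Nd f95 [KL[2,0,1],KL[1,2]] [])]"], code_simp, simp)

section \<open>Box 2, the point (1/4, 0)\<close>

lemma bad_43: "bad [sq 1 262144 0,sq 1 786431 1048575]"
  by (rule check_bad(1)[of _
    "Nd f68 [KL[1,0],KL[0,1]] [(sq 1 371370 699050,Nd f106 [KL[0,1,2],KL[1,2,0]] []),
    (sq 1 436906 699050,Nd f107 [KL[0,1],KL[1,2,0],KL[0,1,2]] []),(sq 1 699050 436906,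
    Nd f108 [KL[1,0,2],KL[0,2,1]] []),(sq 1 699050 699050,Nd f86 [KL[1,0],KL[0,2,
    1]] [(sq 1024 341 469,Nd f14 [KL[1,3,0],KL[3,0,2,1]] []),(sq 1024 458 682,Nd f109 [KL[0,
    2,1],KL[2,1,3,0],KL[0,2,1,3]] []),(sq 1024 597 853,Nd f110 [KL[0,1],KL[1,3,0],KL[0,2,1,
    3],KL[2,1,3,0]] []),(sq 1024 810 682,Nd f111 [KL[0,3,1],KL[3,1,0]] [])])]"], code_simp, simp)

lemma bad_44: "bad [sq 1 262144 0,sq 1 917503 1048575]"
  by (rule check_bad(1)[of _
    "Nd f86 [KL[0,1],KL[1,0]] [(sq 1024 341 469,Nd f109 [KL[0,1,2],KL[1,2,0]] []),((696320,
    716800,319488,352256),Nd f87 [KL[2,1],KL[2,1,0],KL[0,2,1]] []),(sq 1024 458 682,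
    Nd f109 [KL[0,1,2],KL[1,2,0]] []),(sq 1024 597 853,Nd f109 [KL[0,1,2],KL[1,2,0]] []),
    (sq 1024 810 682,Nd f69 [KL[0,2,1],KL[2,1,0]] [(sq 1024 292 146,Nd f112 [KL[0,2,1],KL[1,
    3,0],KL[2,1,3]] [])])]"], code_simp, simp)

lemma bad_45: "bad [sq 1 262144 0,sq 1 983039 1048575]"
  by (rule check_bad(1)[of _
    "Nd f45 [KL[0,1],KL[1,0]] [(sq 1024 341 426,Nd f109 [KL[0,1,2],KL[1,2,0]] []),
    (sq 1024 682 309,Nd f83 [KL[0,2,1],KL[1,0]] []),((698368,708608,339968,350208),
    Nd f83 [KL[0,2,1],KL[1,0]] []),(sq 1024 714 341,Nd f113 [KL[0,2,1],KL[2,1,0]] []),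
    (sq 1024 597 682,Nd f86 [KL[0,1],KL[1,2,0]] [(sq 1024 341 469,Nd f106 [KL[0,1,3],KL[1,3,
    0]] []),(sq 1024 810 682,Nd f109 [KL[0,3,1],KL[3,1,2,0],KL[0,3,1,2]] [])])]"], code_simp, simp)

lemma bad_46: "bad [sq 1 262144 0,sq 1 1015807 1048575]"
  by (rule check_bad(1)[of _
    "Nd f45 [KL[0,1],KL[1,0]] [(sq 1024 341 426,Nd f109 [KL[0,1,2],KL[1,2,0]] []),
    (sq 1024 682 309,Nd f83 [KL[0,2,1],KL[1,0]] []),((698368,708608,339968,350208),
    Nd f83 [KL[0,2,1],KL[1,0]] []),(sq 1024 714 341,Nd f113 [KL[0,2,1],KL[2,1,0]] []),
    (sq 1024 597 682,Nd f78 [KL[0,1],KL[1,2,0]] [(sq 1024 341 341,Nd f12 [KL[0,1],KL[1,2,3,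
    0],KL[3,0,1]] [])])]"], code_simp, simp)

lemma bad_47: "bad [sq 1 262144 0,sq 1 1032191 1048575]"
  by (rule check_bad(1)[of _
    "Nd f45 [KL[0,1],KL[1,0]] [(sq 1024 341 426,Nd f109 [KL[0,1,2],KL[1,2,0]] []),
    (sq 1024 682 309,Nd f83 [KL[0,2,1],KL[1,0]] []),((698368,708608,339968,350208),
    Nd f83 [KL[0,2,1],KL[1,0]] []),(sq 1024 714 341,Nd f83 [KL[0,2,1],KL[1,0]] []),
    (sq 1024 597 682,Nd f78 [KL[0,1],KL[1,2,0]] [(sq 1024 341 341,Nd f111 [KL[0,1,2],KL[1,2,
    3],KL[0,1,2,3]] [])])]"], code_simp, simp)

lemma bad_48: "bad [sq 1 262144 0,sq 1 1040383 1048575]"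
  by (rule check_bad(1)[of _
    "Nd f45 [KL[0,1],KL[1,0]] [(sq 1024 341 426,Nd f109 [KL[0,1,2],KL[1,2,0]] []),
    (sq 1024 682 309,Nd f83 [KL[0,2,1],KL[1,0]] []),((698368,708608,339968,350208),
    Nd f83 [KL[0,2,1],KL[1,0]] []),(sq 1024 714 341,Nd f83 [KL[0,2,1],KL[1,0]] []),
    (sq 1024 597 682,Nd f78 [KL[0,1],KL[1,2,0]] [(sq 1024 341 341,Nd f111 [KL[0,1,2],KL[1,2,
    3],KL[0,1,2,3]] [])])]"], code_simp, simp)

lemma bad_49: "bad [sq 1 262144 0,sq 1 1048575 786431]"
  by (rule check_bad(1)[of _
    "Nd f83 [KL[0,1],KL[1,0]] [(sq 1024 358 409,Nd f114 [KL[2,0,1],KL[1,2,0]] []),((415744,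
    419840,417792,434176),Nd f45 [KL[0,1],KL[1,2,0]] []),(sq 1024 716 204,Nd f115 [KL[0,2,
    1],KL[1,0]] []),(sq 1024 819 307,Nd f115 [KL[0,2,1],KL[1,0]] []),((614400,630784,628736,
    632832),Nd f45 [KL[0,1],KL[1,2,0]] []),(sq 1024 614 665,Nd f85 [KL[0,1,2],KL[1,2,
    0]] [])]"], code_simp, simp)

lemma bad_50: "bad [sq 1 262144 0,sq 1 1048575 917503]"
  by (rule check_bad(1)[of _
    "Nd f116 [KL[0,1],KL[1,0]] [((299008,311296,299008,319488),Nd f45 [KL[0,1],KL[1,2,0],
    KL[2,0,1]] []),(sq 1024 356 292,Nd f45 [KL[0,1],KL[1,2,0],KL[2,0,1]] []),((598016,
    618496,147456,159744),Nd f83 [KL[0,2,1],KL[1,0]] []),(sq 1024 585 210,Nd f83 [KL[0,2,1],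
    KL[1,0]] []),(sq 1024 585 658,Nd f85 [KL[0,1,2],KL[1,2,0]] [])]"], code_simp, simp)

lemma bad_51: "bad [sq 1 262144 0,sq 1 1048575 983039]"
  by (rule check_bad(1)[of _
    "Nd f117 [KL[0,1],KL[1,0]] [(sq 1024 341 309,Nd f2 [KL[0,1],KL[1,2,0]] [(sq 1024 810 853,
    Nd f118 [KL[0,1,3],KL[1,3,2],KL[3,2,0]] [])]),(sq 1024 597 213,Nd f83 [KL[0,2,1],KL[1,
    0]] []),(sq 1024 682 294,Nd f83 [KL[0,2,1],KL[1,0]] []),((696320,737280,335872,352256),
    Nd f83 [KL[0,2,1],KL[1,0]] []),(sq 1024 586 682,Nd f109 [KL[0,1,2],KL[1,2,0]] [])]"], code_simp, simp)

lemma bad_52: "bad [sq 1 262144 0,sq 1 1048575 1015807]"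
  by (rule check_bad(1)[of _
    "Nd f45 [KL[0,1],KL[1,0]] [(sq 1024 341 426,Nd f106 [KL[0,1,2],KL[1,2,0]] []),
    (sq 1024 682 309,Nd f83 [KL[0,2,1],KL[1,0]] []),((698368,708608,339968,350208),
    Nd f83 [KL[0,2,1],KL[1,0]] []),(sq 1024 714 341,Nd f83 [KL[0,2,1],KL[1,0]] []),
    (sq 1024 597 682,Nd f118 [KL[0,1,2],KL[1,2,0],KL[0,1]] [])]"], code_simp, simp)

lemma bad_53: "bad [sq 1 262144 0,sq 1 1048575 1032191]"
  by (rule check_bad(1)[of _
    "Nd f45 [KL[0,1],KL[1,0]] [(sq 1024 341 426,Nd f106 [KL[0,1,2],KL[1,2,0]] []),
    (sq 1024 682 309,Nd f83 [KL[0,2,1],KL[1,0]] []),((698368,708608,339968,350208),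
    Nd f83 [KL[0,2,1],KL[1,0]] []),(sq 1024 714 341,Nd f83 [KL[0,2,1],KL[1,0]] []),
    (sq 1024 597 682,Nd f118 [KL[0,1,2],KL[1,2,0],KL[0,1]] [])]"], code_simp, simp)

lemma bad_54: "bad [sq 1 262144 0,sq 1 1048575 1040383]"
  by (rule check_bad(1)[of _
    "Nd f117 [KL[0,1],KL[1,0]] [(sq 1024 341 309,Nd f119 [KL[0,1],KL[1,2,0],KL[2,0,1]] []),
    (sq 1024 597 213,Nd f83 [KL[0,2,1],KL[1,0]] []),(sq 1024 682 294,Nd f83 [KL[0,2,1],KL[1,
    0]] []),((696320,737280,335872,352256),Nd f83 [KL[0,2,1],KL[1,0]] []),(sq 1024 586 682,
    Nd f109 [KL[0,1,2],KL[1,2,0]] [])]"], code_simp, simp)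

section \<open>Box 3, the point (1/8, 0)\<close>

lemma bad_55: "bad [sq 1 131072 0,sq 1 917503 1048575]"
  by (rule check_bad(1)[of _
    "Nd f3 [KL[0,1],KL[1,0]] [(sq 1024 170 341,Nd f120 [KL[1,2,0],KL[2,0,1]] []),
    (sq 1024 341 170,Nd f86 [KL[1,0],KL[0,2,1]] [(sq 1024 341 469,Nd f120 [KL[1,3,0,2],KL[3,
    0,2,1]] []),(sq 1024 810 682,Nd f118 [KL[0,2,3,1],KL[1,0],KL[3,1,0]] [])]),
    (sq 1024 341 554,Nd f13 [KL[0,1],KL[1,2,0]] []),(sq 1024 554 341,Nd f45 [KL[1,0],KL[0,2,
    1]] [(sq 1024 597 682,Nd f12 [KL[0,2,1],KL[1,3,0]] [])])]"], code_simp, simp)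

lemma bad_56: "bad [sq 1 131072 0,sq 1 983039 1048575]"
  by (rule check_bad(1)[of _
    "Nd f12 [KL[0,1],KL[1,0]] [(sq 1024 469 682,Nd f109 [KL[0,1,2],KL[1,2,0]] []),
    (sq 1024 682 469,Nd f45 [KL[1,0],KL[0,2,1]] []),(sq 1024 682 853,Nd f3 [KL[0,1,2],KL[1,
    0],KL[1,2,0]] [(sq 1024 341 170,Nd f121 [KL[0,1],KL[1,2,0],KL[0,3,1,2]] [])]),
    (sq 1024 853 682,Nd f45 [KL[1,0],KL[0,2,1]] [])]"], code_simp, simp)

lemma bad_57: "bad [sq 1 131072 0,sq 1 1015807 1048575]"
  by (rule check_bad(1)[of _
    "Nd f86 [KL[0,1],KL[1,0]] [(sq 1024 341 469,Nd f3 [KL[0,1],KL[1,2,0]] []),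
    (sq 1024 810 682,Nd f45 [KL[1,0],KL[0,1],KL[0,2,1]] [(sq 1024 597 682,Nd f12 [KL[0,2,1],
    KL[1,3,0]] [])])]"], code_simp, simp)

lemma bad_58: "bad [sq 1 131072 0,sq 1 1032191 1048575]"
  by (rule check_bad(1)[of _
    "Nd f86 [KL[0,1],KL[1,0]] [(sq 1024 341 469,Nd f3 [KL[0,1],KL[1,2,0]] []),
    (sq 1024 810 682,Nd f45 [KL[1,0],KL[0,1],KL[0,2,1]] [(sq 1024 597 682,Nd f122 [KL[0,2,
    1],KL[1,3,0]] [])])]"], code_simp, simp)

lemma bad_59: "bad [sq 1 131072 0,sq 1 1040383 1048575]"
  by (rule check_bad(1)[of _
    "Nd f86 [KL[0,1],KL[1,0]] [(sq 1024 341 469,Nd f3 [KL[0,1],KL[1,2,0]] []),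
    (sq 1024 810 682,Nd f119 [KL[0,2,1],KL[1,0]] [(sq 1024 869 682,Nd f45 [KL[1,0],KL[0,3,
    1]] [])])]"], code_simp, simp)

lemma bad_60: "bad [sq 1 131072 0,sq 1 1048575 917503]"
  by (rule check_bad(1)[of _
    "Nd f45 [KL[0,1],KL[1,0]] [(sq 1024 341 426,Nd f123 [KL[0,1],KL[1,2,0],KL[2,0,1]] []),
    (sq 1024 682 309,Nd f83 [KL[0,2,1],KL[1,0]] []),((698368,708608,339968,350208),
    Nd f83 [KL[0,2,1],KL[1,0]] []),(sq 1024 714 341,Nd f83 [KL[0,2,1],KL[1,0]] []),
    (sq 1024 597 682,Nd f122 [KL[0,1],KL[1,2,0],KL[0,1,2]] [])]"], code_simp, simp)

lemma bad_61: "bad [sq 1 131072 0,sq 1 1048575 983039]"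
  by (rule check_bad(1)[of _
    "Nd f45 [KL[0,1],KL[1,0]] [(sq 1024 341 426,Nd f12 [KL[0,1],KL[1,2,0],KL[2,0,1]] []),
    ((698368,708608,339968,350208),Nd f116 [KL[0,2,1],KL[1,0]] []),(sq 1024 597 682,
    Nd f3 [KL[0,1],KL[1,2,0]] [(sq 1024 341 170,Nd f122 [KL[0,3,1],KL[1,2,0]] [])])]"], code_simp, simp)

lemma bad_62: "bad [sq 1 131072 0,sq 1 1048575 1015807]"
  by (rule check_bad(1)[of _
    "Nd f45 [KL[0,1],KL[1,0]] [(sq 1024 341 426,Nd f12 [KL[0,1],KL[1,2,0],KL[2,0,1]] []),
    ((698368,701440,347136,350208),Nd f124 [KL[2,1],KL[2,1,0]] []),(sq 1024 597 682,
    Nd f12 [KL[0,1],KL[1,2,0]] [(sq 1024 682 853,Nd f3 [KL[0,1],KL[1,3,0]] [])])]"], code_simp, simp)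

lemma bad_63: "bad [sq 1 131072 0,sq 1 1048575 1032191]"
  by (rule check_bad(1)[of _
    "Nd f86 [KL[0,1],KL[1,0]] [(sq 1024 341 469,Nd f3 [KL[0,1],KL[1,2,0]] []),
    (sq 1024 810 682,Nd f119 [KL[0,2,1],KL[1,0]] [(sq 1024 869 682,Nd f45 [KL[1,0],KL[0,3,
    1]] [])])]"], code_simp, simp)

lemma bad_64: "bad [sq 1 131072 0,sq 1 1048575 1040383]"
  by (rule check_bad(1)[of _
    "Nd f86 [KL[0,1],KL[1,0]] [(sq 1024 341 469,Nd f3 [KL[0,1],KL[1,2,0]] []),
    (sq 1024 810 682,Nd f119 [KL[0,2,1],KL[1,0]] [(sq 1024 869 682,Nd f45 [KL[1,0],KL[0,3,
    1]] [])])]"], code_simp, simp)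

section \<open>Box 4, the point (1/16, 0)\<close>

lemma bad_65: "bad [sq 1 65536 0,sq 1 983039 1048575]"
  by (rule check_bad(1)[of _
    "Nd f3 [KL[0,1],KL[1,0]] [(sq 1024 170 341,Nd f13 [KL[0,1],KL[1,2,0]] []),
    (sq 1024 341 170,Nd f122 [KL[0,2,1],KL[1,0]] [(sq 1024 569 341,Nd f15 [KL[0,2,3,1],KL[1,
    0,2,3]] [])]),(sq 1024 341 554,Nd f13 [KL[0,1],KL[1,2,0]] []),(sq 1024 554 341,
    Nd f45 [KL[1,0],KL[0,2,1]] [])]"], code_simp, simp)

lemma bad_66: "bad [sq 1 65536 0,sq 1 1015807 1048575]"
  by (rule check_bad(1)[of _
    "Nd f12 [KL[0,1],KL[1,0]] [(sq 1024 469 682,Nd f13 [KL[0,1],KL[1,2,0]] []),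
    (sq 1024 682 469,Nd f45 [KL[1,0],KL[0,2,1]] []),(sq 1024 682 853,Nd f3 [KL[0,1,2],KL[1,
    2,0]] []),(sq 1024 853 682,Nd f45 [KL[1,0],KL[0,2,1]] [])]"], code_simp, simp)

lemma bad_67: "bad [sq 1 65536 0,sq 1 1032191 1048575]"
  by (rule check_bad(1)[of _
    "Nd f12 [KL[0,1],KL[1,0]] [(sq 1024 469 682,Nd f13 [KL[0,1],KL[1,2,0]] []),
    (sq 1024 682 469,Nd f45 [KL[1,0],KL[0,2,1]] []),(sq 1024 682 853,Nd f3 [KL[0,1,2],KL[1,
    2,0]] []),(sq 1024 853 682,Nd f45 [KL[1,0],KL[0,2,1]] [])]"], code_simp, simp)

lemma bad_68: "bad [sq 1 65536 0,sq 1 1040383 1048575]"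
  by (rule check_bad(1)[of _
    "Nd f12 [KL[0,1],KL[1,0]] [(sq 1024 469 682,Nd f109 [KL[0,1,2],KL[1,2,0]] []),
    (sq 1024 682 469,Nd f45 [KL[1,0],KL[0,2,1]] []),(sq 1024 682 853,Nd f3 [KL[0,1,2],KL[1,
    2,0]] []),(sq 1024 853 682,Nd f45 [KL[1,0],KL[0,2,1]] [])]"], code_simp, simp)

lemma bad_69: "bad [sq 1 65536 0,sq 1 1048575 983039]"
  by (rule check_bad(1)[of _
    "Nd f119 [KL[1,0],KL[0,1]] [(sq 1024 341 442,Nd f12 [KL[0,1],KL[1,2,0],KL[2,0,1]] []),
    (sq 1024 597 746,Nd f76 [KL[0,1,2],KL[1,2,0]] []),(sq 1024 714 853,Nd f122 [KL[0,1,2],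
    KL[1,2,0]] []),(sq 1024 869 682,Nd f45 [KL[1,0],KL[0,2,1]] [])]"], code_simp, simp)

lemma bad_70: "bad [sq 1 65536 0,sq 1 1048575 1015807]"
  by (rule check_bad(1)[of _
    "Nd f12 [KL[0,1],KL[1,0]] [(sq 1024 682 469,Nd f45 [KL[1,0],KL[0,2,1]] []),
    (sq 1024 682 853,Nd f76 [KL[0,1,2],KL[1,2,0]] []),(sq 1024 853 682,Nd f45 [KL[1,0],KL[0,
    2,1]] [])]"], code_simp, simp)

lemma bad_71: "bad [sq 1 65536 0,sq 1 1048575 1032191]"
  by (rule check_bad(1)[of _
    "Nd f125 [KL[0,1],KL[1,0]] [(sq 1024 341 213,Nd f45 [KL[1,0],KL[0,1]] [(sq 1024 341 426,
    Nd f12 [KL[0,2,1],KL[1,3,0]] []),(sq 1024 597 682,Nd f12 [KL[0,2,1],KL[1,3,0]] [])]),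
    (sq 1024 554 682,Nd f3 [KL[0,1],KL[1,2,0],KL[0,1,2]] [])]"], code_simp, simp)

lemma bad_72: "bad [sq 1 65536 0,sq 1 1048575 1040383]"
  by (rule check_bad(1)[of _
    "Nd f86 [KL[0,1],KL[1,0]] [(sq 1024 341 469,Nd f126 [KL[0,1],KL[1,2,0]] []),
    (sq 1024 810 682,Nd f45 [KL[1,0],KL[0,1]] [(sq 1024 341 426,Nd f12 [KL[0,2,1],KL[1,3,
    0]] []),(sq 1024 597 682,Nd f12 [KL[0,2,1],KL[1,3,0]] [])])]"], code_simp, simp)

section \<open>Boxes 5 to 7, the points (1/32, 0), (1/64, 0) and (1/128, 0)\<close>

lemma bad_73: "bad [sq 1 32768 0,sq 1 1015807 1048575]"
  by (rule check_bad(1)[of _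
    "Nd f3 [KL[0,1],KL[1,0]] [(sq 1024 170 341,Nd f13 [KL[0,1],KL[1,2,0]] []),
    (sq 1024 341 170,Nd f12 [KL[0,2,1],KL[1,0,2]] []),(sq 1024 341 554,Nd f13 [KL[0,1],KL[1,
    2,0]] []),(sq 1024 554 341,Nd f45 [KL[1,0],KL[0,2,1]] [])]"], code_simp, simp)

lemma bad_74: "bad [sq 1 32768 0,sq 1 1032191 1048575]"
  by (rule check_bad(1)[of _
    "Nd f12 [KL[0,1],KL[1,0]] [(sq 1024 469 682,Nd f13 [KL[0,1],KL[1,2,0]] []),
    (sq 1024 682 469,Nd f45 [KL[1,0],KL[0,2,1]] []),(sq 1024 682 853,Nd f3 [KL[0,1,2],KL[1,
    2,0]] []),(sq 1024 853 682,Nd f45 [KL[1,0],KL[0,2,1]] [])]"], code_simp, simp)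

lemma bad_75: "bad [sq 1 32768 0,sq 1 1040383 1048575]"
  by (rule check_bad(1)[of _
    "Nd f12 [KL[0,1],KL[1,0]] [(sq 1024 469 682,Nd f13 [KL[0,1],KL[1,2,0]] []),
    (sq 1024 682 469,Nd f45 [KL[1,0],KL[0,2,1]] []),(sq 1024 682 853,Nd f3 [KL[0,1,2],KL[1,
    2,0]] []),(sq 1024 853 682,Nd f45 [KL[1,0],KL[0,2,1]] [])]"], code_simp, simp)

lemma bad_76: "bad [sq 1 32768 0,sq 1 1048575 1015807]"
  by (rule check_bad(1)[of _
    "Nd f127 [KL[0,1],KL[1,0]] [(sq 1024 234 341,Nd f12 [KL[1,2,0],KL[2,0,1]] []),
    (sq 1024 570 341,Nd f45 [KL[1,0],KL[0,2,1]] []),(sq 1024 682 453,Nd f45 [KL[1,0],KL[0,2,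
    1]] []),(sq 1024 682 789,Nd f3 [KL[0,1,2],KL[1,2,0]] [])]"], code_simp, simp)

lemma bad_77: "bad [sq 1 32768 0,sq 1 1048575 1032191]"
  by (rule check_bad(1)[of _
    "Nd f12 [KL[0,1],KL[1,0]] [(sq 1024 469 682,Nd f76 [KL[0,1,2],KL[1,2,0]] []),
    (sq 1024 682 469,Nd f45 [KL[1,0],KL[0,2,1]] []),(sq 1024 682 853,Nd f13 [KL[0,1],KL[1,2,
    0]] []),(sq 1024 853 682,Nd f45 [KL[1,0],KL[0,2,1]] [])]"], code_simp, simp)

lemma bad_78: "bad [sq 1 32768 0,sq 1 1048575 1040383]"
  by (rule check_bad(1)[of _
    "Nd f12 [KL[0,1],KL[1,0]] [(sq 1024 469 682,Nd f13 [KL[0,1],KL[1,2,0]] []),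
    (sq 1024 682 469,Nd f45 [KL[1,0],KL[0,2,1]] []),(sq 1024 682 853,Nd f76 [KL[0,1,2],KL[1,
    2,0]] []),(sq 1024 853 682,Nd f45 [KL[1,0],KL[0,2,1]] [])]"], code_simp, simp)

lemma bad_79: "bad [sq 1 16384 0,sq 1 1032191 1048575]"
  by (rule check_bad(1)[of _
    "Nd f3 [KL[0,1],KL[1,0]] [(sq 1024 170 341,Nd f13 [KL[0,1],KL[1,2,0]] []),
    (sq 1024 341 170,Nd f12 [KL[0,2,1],KL[1,0,2]] []),(sq 1024 341 554,Nd f13 [KL[0,1],KL[1,
    2,0]] []),(sq 1024 554 341,Nd f45 [KL[1,0],KL[0,2,1]] [])]"], code_simp, simp)

lemma bad_80: "bad [sq 1 16384 0,sq 1 1040383 1048575]"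
  by (rule check_bad(1)[of _
    "Nd f12 [KL[0,1],KL[1,0]] [(sq 1024 469 682,Nd f13 [KL[0,1],KL[1,2,0]] []),
    (sq 1024 682 469,Nd f45 [KL[1,0],KL[0,2,1]] []),(sq 1024 682 853,Nd f13 [KL[0,1],KL[1,2,
    0]] []),(sq 1024 853 682,Nd f45 [KL[1,0],KL[0,2,1]] [])]"], code_simp, simp)

lemma bad_81: "bad [sq 1 16384 0,sq 1 1048575 1032191]"
  by (rule check_bad(1)[of _
    "Nd f3 [KL[0,1],KL[1,0]] [(sq 1024 170 341,Nd f13 [KL[0,1],KL[1,2,0]] []),
    (sq 1024 341 170,Nd f45 [KL[1,0],KL[0,2,1]] []),(sq 1024 341 554,Nd f13 [KL[0,1],KL[1,2,
    0]] []),(sq 1024 554 341,Nd f45 [KL[1,0],KL[0,2,1]] [])]"], code_simp, simp)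

lemma bad_82: "bad [sq 1 16384 0,sq 1 1048575 1040383]"
  by (rule check_bad(1)[of _
    "Nd f12 [KL[0,1],KL[1,0]] [(sq 1024 469 682,Nd f13 [KL[0,1],KL[1,2,0]] []),
    (sq 1024 682 469,Nd f45 [KL[1,0],KL[0,2,1]] []),(sq 1024 682 853,Nd f13 [KL[0,1],KL[1,2,
    0]] []),(sq 1024 853 682,Nd f45 [KL[1,0],KL[0,2,1]] [])]"], code_simp, simp)

lemma bad_83: "bad [sq 1 8192 0,sq 1 1040383 1048575]"
  by (rule check_bad(1)[of _
    "Nd f3 [KL[0,1],KL[1,0]] [(sq 1024 170 341,Nd f13 [KL[0,1],KL[1,2,0]] []),
    (sq 1024 341 170,Nd f45 [KL[1,0],KL[0,2,1]] []),(sq 1024 341 554,Nd f13 [KL[0,1],KL[1,2,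
    0]] []),(sq 1024 554 341,Nd f45 [KL[1,0],KL[0,2,1]] [])]"], code_simp, simp)

lemma bad_84: "bad [sq 1 8192 0,sq 1 1048575 1040383]"
  by (rule check_bad(1)[of _
    "Nd f3 [KL[0,1],KL[1,0]] [(sq 1024 170 341,Nd f13 [KL[0,1],KL[1,2,0]] []),
    (sq 1024 341 170,Nd f45 [KL[1,0],KL[0,2,1]] []),(sq 1024 341 554,Nd f13 [KL[0,1],KL[1,2,
    0]] []),(sq 1024 554 341,Nd f45 [KL[1,0],KL[0,2,1]] [])]"], code_simp, simp)

text \<open>
  The orbit homoclinic to 0 through \<open>\<dots>00100\<dots>\<close> consists of the points \<open>(2\<^sup>-\<^sup>k, 0)\<close>, here at
  positions 1 to 7, and \<open>(0, 2\<^sup>-\<^sup>k)\<close>, at positions 8 to 14.  Box 0 contains the others.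
\<close>

definition corner_boxes :: "box list" where
  "corner_boxes = [sq 4112 0 0, sq 1 524288 0, sq 1 262144 0, sq 1 131072 0, sq 1 65536 0, sq 1 32768 0,
    sq 1 16384 0, sq 1 8192 0, sq 1 0 524288, sq 1 0 262144, sq 1 0 131072, sq 1 0 65536,
    sq 1 0 32768, sq 1 0 16384, sq 1 0 8192]"

lemmas root_bads = bad_0 bad_1 bad_2 bad_3 bad_4 bad_5 bad_6 bad_7 bad_29 bad_30 bad_31 bad_32 bad_33 bad_34 bad_35
    bad_36 bad_37 bad_38 bad_39 bad_40 bad_41 bad_42 bad_43 bad_44 bad_45 bad_46 bad_47 bad_48 bad_49
    bad_50 bad_51 bad_52 bad_53 bad_54 bad_55 bad_56 bad_57 bad_58 bad_59 bad_60 bad_61 bad_62 bad_63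
    bad_64 bad_65 bad_66 bad_67 bad_68 bad_69 bad_70 bad_71 bad_72 bad_73 bad_74 bad_75 bad_76 bad_77
    bad_78 bad_79 bad_80 bad_81 bad_82 bad_83 bad_84

section \<open>The theorem\<close>

lemma rotb_swapb: "rotb (swapb q) = swapb (rotb q)"
  by (cases q) simp

text \<open>The half turn maps p to \<open>rotb p\<close> and \<open>rotb q\<close> to q, so it
  exchanges the roles of the two boxes.\<close>

lemma bad_transpose: "bad [q, rotb p] \<Longrightarrow> bad [p, rotb q]"
  by (rule bad_rot, rule bad_mono[of "[q, rotb p]"]) auto

lemma bad_swap_pair: "bad [swapb p, rotb (swapb q)] \<Longrightarrow> bad [p, rotb q]"
  by (rule bad_swap) (simp add: rotb_swapb)

text \<open>
  The position of the transposed box.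
\<close>

definition mirror :: "nat \<Rightarrow> nat" where
  "mirror i = (if i = 0 then 0 else if i < 8 then i + 7 else i - 7)"

lemma corner_boxes_mirror: "i < 15 \<Longrightarrow> corner_boxes ! mirror i = swapb (corner_boxes ! i)"
proof -
  have "\<forall>i\<in>set [0..<15]. corner_boxes ! mirror i = swapb (corner_boxes ! i)"
    by (simp add: upt_rec mirror_def corner_boxes_def sq_def)
  then show "i < 15 \<Longrightarrow> corner_boxes ! mirror i = swapb (corner_boxes ! i)" by simp
qed

text \<open>Selects one pair from each class of index pairs under exchanging the two indices and
  mirroring both: 64 of the 225 pairs, one for each of \<open>root_bads\<close>.\<close>

definition canonical :: "nat \<Rightarrow> nat \<Rightarrow> bool" where
  "canonical i j \<longleftrightarrow> i \<le> 7 \<and> i \<le> j \<and> (j \<le> 7 \<or> 1 \<le> i \<and> i + 7 \<le> j)"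

lemma canonical_bad: "canonical i j \<Longrightarrow> j < 15 \<Longrightarrow> bad [corner_boxes ! i, rotb (corner_boxes ! j)]"
proof -
  have "\<forall>i\<in>set [0..<8]. \<forall>j\<in>set [0..<15]. canonical i j \<longrightarrow> bad [corner_boxes ! i, rotb (corner_boxes ! j)]"
    by (simp add: upt_rec canonical_def corner_boxes_def sq_def root_bads [unfolded sq_def, simplified])
  then show "canonical i j \<Longrightarrow> j < 15 \<Longrightarrow> bad [corner_boxes ! i, rotb (corner_boxes ! j)]"
    by (simp add: canonical_def)
qed

lemma corner_boxes_bad:
  assumes "i < 15" "j < 15"
  shows "bad [corner_boxes ! i, rotb (corner_boxes ! j)]"
proof -
  have "canonical i j \<or> canonical j i \<or> canonical (mirror i) (mirror j) \<or> canonical (mirror j) (mirror i)"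
    using assms unfolding canonical_def mirror_def
    by (cases "i = 0"; cases "j = 0"; cases "i < 8"; cases "j < 8") auto
  moreover have "mirror i < 15" "mirror j < 15" using assms by (auto simp: mirror_def)
  ultimately have "bad [corner_boxes ! i, rotb (corner_boxes ! j)] \<or> bad [corner_boxes ! j, rotb (corner_boxes ! i)] \<or>
      bad [swapb (corner_boxes ! i), rotb (swapb (corner_boxes ! j))] \<or>
      bad [swapb (corner_boxes ! j), rotb (swapb (corner_boxes ! i))]"
    using canonical_bad assms by (metis corner_boxes_mirror)
  then show ?thesis using bad_transpose bad_swap_pair by blast
qed

lemma trap_hits_corner_box:
  assumes "trap H"
  shows "\<exists>i<15. hit H (corner_boxes ! i)"
proof -
  \<comment> \<open>Without tests, \<open>covered\<close> only asserts that each window lies in one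
    of the corner boxes. The side 4112 of box 0 exceeds 4097, the right end of the window at
    \<open>(2^-8, 0)\<close>.\<close>
  have "covered (f128 ()) [] (map (\<lambda>b. (b, Cut)) corner_boxes)"
    by code_simp
  then have "\<forall>x\<in>set (f128 ()). \<exists>p\<in>set corner_boxes. box_le x p"
    by (simp add: covered_iff in_child_iff image_image)
  moreover obtain x where "x \<in> set (f128 ())" "hit H x"
    using unavoidable_families(129) assms unfolding unavoidable_def by blast
  ultimately obtain p where "p \<in> set corner_boxes" "hit H p"
    using box_le_hit by blast
  moreover have "length corner_boxes = 15" by (simp add: corner_boxes_def)
  ultimately show ?thesis by (metis in_set_conv_nth)
qed

text \<open>The orbit homoclinic to 1 through a single 0 is the rotation of the orbit homoclinic to
  0 through a single 1. Hence the corner boxes apply to H and to its rotation, which yields a pair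
  that is already excluded.\<close>

lemma no_trap: "\<not> trap H"
proof
  assume H: "trap H"
  obtain i where i: "i < 15" "hit H (corner_boxes ! i)" using trap_hits_corner_box[OF H] by blast
  obtain j where j: "j < 15" "hit ((\<lambda>z. (1, 1) - z) ` H) (corner_boxes ! j)"
    using trap_hits_corner_box[OF trap_rot[OF H]] by blast
  have "hit H (rotb (corner_boxes ! j))"
    using hit_rot[OF j(2)] by (simp add: image_image)
  then show False using corner_boxes_bad[OF i(1) j(1)] H i(2) by (simp add: bad_def)
qed

theorem theorem6p2:
  fixes H :: "(real \<times> real) set"
  assumes "H \<subseteq> unit_square"
    and "openin (top_of_set unit_square) H"
    and "convex H"
    and "measure lebesgue H < 0.11802"
  shows "hausdorff_dim (survivor_set H) > 0"
proof (rule ccontr)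
  assume dim: "\<not> 0 < hausdorff_dim (survivor_set H)"
  \<comment> \<open>A relatively open subset of the closed square is Borel, which is all that
    \<open>trap\<close> asks of the topology.\<close>
  obtain T where "open T" "H = unit_square \<inter> T"
    using assms(2) by (auto simp: openin_open)
  moreover have "unit_square \<in> sets borel"
    by (intro borel_closed closed_Times) auto
  ultimately have "H \<in> sets borel" by auto
  then have "trap H"
    unfolding trap_def using assms window_hit[OF _ _ _ dim] by blast
  then show False using no_trap by blast
qed

end
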